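(* Let $n\ge2$ and let $v_{\mathrm{init}}$ be a positive function, smooth for small $r>0$, with $v_{\mathrm{init}}(r)=[1+o(1)]v_0(r)$ as $r\searrow0$. Let $v$ denote any solution of the Cauchy problem $$v_t=\mathcal F[v],\qquad v(r,0)=v_{\mathrm{init}}(r),$$ that is smooth (in the sense specified in the context) for a short time $0<t<t_1$. Let $v^{\pm}_{\varepsilon,\delta}$ be the sub- and supersolutions, depending on $\varepsilon,\delta>0$, constructed in the context. Then for all small enough $\varepsilon,\delta>0$ there exist $\bar r=\bar r_{\varepsilon,\delta}>0$ and $\bar t=\bar t_{\varepsilon,\delta}>0$ such that $$v^-_{\varepsilon,\delta}(r,t)\le v(r,t)\le v^+_{\varepsilon,\delta}(r,t)$$ for all $(r,t)\in[0,\bar r]\times[0,\bar t\,]$, $(r,t)\neq(0,0)$.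
   Context: Operator. $\mathcal F[v]=vv_{rr}-\tfrac12v_r^2+\frac{n-1-v}{r}v_r+\frac{2(n-1)}{r^2}v(1-v)$, and $v_0(r)=\frac{n-1}{-4\log r}$ for $0<r<1$. A subsolution (supersolution) satisfies $v_t\le\mathcal F[v]$ ($v_t\ge\mathcal F[v]$). Smooth solution. $v$ comes from a smooth complete rotationally symmetric Ricci flow $g(t)=\frac{(dr)^2}{v(r,t)}+r^2g_{\mathrm{can}}$ near the pole $r=0$ ($g_{\mathrm{can}}$ the unit round metric on $\mathcal S^n$): $v>0$ is smooth on $[0,r_1]\times(0,t_1)$ as a function of $(r^2,t)$, with $v(0,t)=1$ for $0<t<t_1$, and it extends smoothly to $t=0$ for $r>0$ with $v(r,0)=v_{\mathrm{init}}(r)$. Special functions. $\mathfrak B:(0,\infty)\to(0,1)$ is the strictly decreasing solution of $\mathcal F[\mathfrak B]=0$ (with $r$ replaced by $\sigma$) with $\mathfrak B(\sigma)\to1$ as $\sigma\searrow0$ and $\mathfrak B(\sigma)=\sigma^{-2}+o(\sigma^{-2})$ as $\sigma\to\infty$ (so $\frac{(d\sigma)^2}{\mathfrak B}+\sigma^2g_{\mathrm{can}}$ is the Bryant steady soliton). $\mathfrak C:(0,\infty)\to(0,\infty)$ is a fixed strictly positive solution, with $\mathfrak C(\sigma)=M\sigma^2+o(\sigma^2)$ as $\sigma\searrow0$ for some $M>0$, of $d\mathcal F_{\mathfrak B}[\mathfrak C]=-\sigma\mathfrak B'(\sigma)$, where $$d\mathcal F_{V}[W]=VW''+\Big[\tfrac{n-1-V}{\sigma}-V'\Big]W'+\Big[V''-\tfrac{V'}{\sigma}+\tfrac{2(n-1)}{\sigma^2}(1-2V)\Big]W.$$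 Variables. $\tau=\log t$, $\rho=r/\sqrt t$, $\theta=\sqrt{t/(-\log t)}$, $\sigma=r/\theta$, $\theta_t=d\theta/dt$, $W_0(\rho)=\frac{n-1}{2}\big[1+\frac{2(n-1)}{\rho^2}\big]$. Barriers. For small $\varepsilon,\delta>0$ and constants $A=A(n)>0$, $B\geq1$, put $\rho_*=A/\sqrt\varepsilon$, $\sigma_*=B/\sqrt\varepsilon$, $$\gamma_\pm=\delta+\frac{(1\pm\delta)\varepsilon^2}{\varepsilon+2A^2/(n-1)},\qquad k_\pm=\frac1{n-1}\Big(1\pm\gamma_\pm\pm\frac{\varepsilon}{2(n-1)^2}\Big)^{-1/2},$$ $$v^\pm_{\mathrm{out}}=(1\pm\delta)v_0+(1\pm\varepsilon)t\,\mathcal F[(1\pm\delta)v_0]\quad(\rho_*\sqrt t\le r\le r_* ),$$ $$v^\pm_{\mathrm{par}}=\frac{1}{-\tau}\Big[(1\pm\gamma_\pm)W_0(\rho)\pm\frac{B^2}{-\tau\rho^4}\Big]\quad(\sigma_*\theta\le r\le3\rho_*\sqrt t),$$ $$v^\pm_{\mathrm{in}}=\mathfrak B(k_\pm\sigma)+(1\mp\varepsilon)\theta\theta_tk_\pm^{-2}\mathfrak C(k_\pm\sigma)\quad(0<r\le3\sigma_*\theta),$$ for $0<t<t_*$. Here $A$, $B$ are chosen large and then $r_*<1$, $t_*$ small (depending on $n,\varepsilon,\delta$) so that these functions are sub- ($-$) and super- ($+$) solutions on the indicated domains and so that $v^-_{\mathrm{par}}>v^-_{\mathrm{out}}$ at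 $r=\rho_*\sqrt t$, $v^-_{\mathrm{par}}<v^-_{\mathrm{out}}$ at $r=3\rho_*\sqrt t$, $v^-_{\mathrm{in}}>v^-_{\mathrm{par}}$ at $r=\sigma_*\theta$, $v^-_{\mathrm{in}}<v^-_{\mathrm{par}}$ at $r=3\sigma_*\theta$, with all these inequalities reversed for the superscript $+$. Then $v^-_{\varepsilon,\delta}$ is defined on $0<r\le r_*$, $0<t<t_*$ as $v^-_{\mathrm{in}}$ for $r\le\sigma_*\theta$, $\max\{v^-_{\mathrm{in}},v^-_{\mathrm{par}}\}$ for $\sigma_*\theta\le r\le3\sigma_*\theta$, $v^-_{\mathrm{par}}$ for $3\sigma_*\theta\le r\le\rho_*\sqrt t$, $\max\{v^-_{\mathrm{par}},v^-_{\mathrm{out}}\}$ for $\rho_*\sqrt t\le r\le3\rho_*\sqrt t$, and $v^-_{\mathrm{out}}$ for $3\rho_*\sqrt t\le r\le r_*$; $v^+_{\varepsilon,\delta}$ is defined in the same way with superscript $+$ and $\min$ in place of $\max$. By continuity $v^\pm_{\varepsilon,\delta}(0,t)=1$ for $t>0$ and $v^\pm_{\varepsilon,\delta}(r,0)=(1\pm\delta)v_0(r)$ for $r>0$. *)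

theory Defs
  imports "HOL-Analysis.Analysis" "HOL-Library.Landau_Symbols"
begin

section \<open>The operator and its linearisation\<close>

text \<open>Differential expressions use \<^const>\<open>deriv\<close>, which is arbitrary where a derivative does not
  exist; every notion of solution below therefore also demands the derivatives to exist.\<close>

definition F_op :: "nat \<Rightarrow> (real \<Rightarrow> real) \<Rightarrow> real \<Rightarrow> real" where
  "F_op n v r = v r * deriv (deriv v) r - 1/2 * (deriv v r)\<^sup>2
     + (real n - 1 - v r) / r * deriv v r
     + 2 * (real n - 1) / r\<^sup>2 * v r * (1 - v r)"

definition dF_op :: "nat \<Rightarrow> (real \<Rightarrow> real) \<Rightarrow> (real \<Rightarrow> real) \<Rightarrow> real \<Rightarrow> real" where
  "dF_op n V W x = V x * deriv (deriv W) x
     + ((real n - 1 - V x) / x - deriv V x) * deriv W x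
     + (deriv (deriv V) x - deriv V x / x + 2 * (real n - 1) / x\<^sup>2 * (1 - 2 * V x)) * W x"

definition v0 :: "nat \<Rightarrow> real \<Rightarrow> real" where
  "v0 n r = (real n - 1) / (- 4 * ln r)"

definition twice_diff_at :: "(real \<Rightarrow> real) \<Rightarrow> real \<Rightarrow> bool" where
  "twice_diff_at f x \<longleftrightarrow>
     eventually (\<lambda>y. f differentiable (at y)) (nhds x) \<and> deriv f differentiable (at x)"

definition regular_at :: "(real \<Rightarrow> real \<Rightarrow> real) \<Rightarrow> real \<Rightarrow> real \<Rightarrow> bool" where
  "regular_at v r t \<longleftrightarrow> (\<lambda>t'. v r t') differentiable (at t) \<and> twice_diff_at (\<lambda>r'. v r' t) r"

definition is_subsolution :: "nat \<Rightarrow> (real \<times> real) set \<Rightarrow> (real \<Rightarrow> real \<Rightarrow> real) \<Rightarrow> bool" where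
  "is_subsolution n D v \<longleftrightarrow> (\<forall>(r, t) \<in> D.
     regular_at v r t \<and> deriv (\<lambda>t'. v r t') t \<le> F_op n (\<lambda>r'. v r' t) r)"

definition is_supersolution :: "nat \<Rightarrow> (real \<times> real) set \<Rightarrow> (real \<Rightarrow> real \<Rightarrow> real) \<Rightarrow> bool" where
  "is_supersolution n D v \<longleftrightarrow> (\<forall>(r, t) \<in> D.
     regular_at v r t \<and> deriv (\<lambda>t'. v r t') t \<ge> F_op n (\<lambda>r'. v r' t) r)"

section \<open>Smooth solutions of the Cauchy problem\<close>

text \<open>Functions of class $C^k$ on a subset of the plane. Derivatives are taken within \<open>S\<close>, so that
  at boundary points this expresses smoothness up to the boundary; it is used only for products
  of two nondegenerate intervals, where the derivative within \<open>S\<close> is unique.\<close>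

fun Ck_on :: "nat \<Rightarrow> (real \<times> real) set \<Rightarrow> (real \<times> real \<Rightarrow> real) \<Rightarrow> bool" where
  "Ck_on 0 S f \<longleftrightarrow> continuous_on S f"
| "Ck_on (Suc k) S f \<longleftrightarrow> (\<exists>f1 f2.
     (\<forall>p\<in>S. (f has_derivative (\<lambda>h. f1 p * fst h + f2 p * snd h)) (at p within S))
     \<and> Ck_on k S f1 \<and> Ck_on k S f2)"

definition smooth2_on :: "(real \<times> real) set \<Rightarrow> (real \<times> real \<Rightarrow> real) \<Rightarrow> bool" where
  "smooth2_on S f \<longleftrightarrow> (\<forall>k. Ck_on k S f)"

definition smooth1_on :: "real set \<Rightarrow> (real \<Rightarrow> real) \<Rightarrow> bool" where
  "smooth1_on S f \<longleftrightarrow> (\<forall>k. \<forall>x\<in>S. (deriv ^^ k) f differentiable (at x))"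

text \<open>Here \<open>v r t\<close> is the coefficient in the metric $g(t) = (dr)^2/v + r^2 g_{can}$. Smoothness of
  the metric at the pole is smoothness in \<open>(r\<^sup>2, t)\<close> up to \<open>r = 0\<close> together with \<open>v 0 t = 1\<close>.\<close>

definition smooth_solution ::
  "nat \<Rightarrow> (real \<Rightarrow> real) \<Rightarrow> real \<Rightarrow> real \<Rightarrow> (real \<Rightarrow> real \<Rightarrow> real) \<Rightarrow> bool" where
  "smooth_solution n vinit r1 t1 v \<longleftrightarrow>
     (\<forall>r\<in>{0..r1}. \<forall>t\<in>{0<..<t1}. v r t > 0)
   \<and> (\<exists>u. smooth2_on ({0..r1\<^sup>2} \<times> {0<..<t1}) u
          \<and> (\<forall>r\<in>{0..r1}. \<forall>t\<in>{0<..<t1}. v r t = u (r\<^sup>2, t)))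
   \<and> (\<forall>t\<in>{0<..<t1}. v 0 t = 1)
   \<and> smooth2_on ({0<..r1} \<times> {0..<t1}) (\<lambda>(r, t). v r t)
   \<and> (\<forall>r\<in>{0<..r1}. v r 0 = vinit r)
   \<and> (\<forall>r\<in>{0<..<r1}. \<forall>t\<in>{0<..<t1}.
        deriv (\<lambda>t'. v r t') t = F_op n (\<lambda>r'. v r' t) r)"

section \<open>The special functions\<close>

definition is_bryant :: "nat \<Rightarrow> (real \<Rightarrow> real) \<Rightarrow> bool" where
  "is_bryant n \<BB> \<longleftrightarrow>
     (\<forall>x>0. 0 < \<BB> x \<and> \<BB> x < 1)
   \<and> strict_antimono_on {0<..} \<BB>
   \<and> (\<forall>x>0. twice_diff_at \<BB> x \<and> F_op n \<BB> x = 0)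
   \<and> (\<BB> \<longlongrightarrow> 1) (at_right 0)
   \<and> (\<lambda>x. \<BB> x - 1 / x\<^sup>2) \<in> o[at_top](\<lambda>x. 1 / x\<^sup>2)"

definition is_corrector :: "nat \<Rightarrow> (real \<Rightarrow> real) \<Rightarrow> (real \<Rightarrow> real) \<Rightarrow> bool" where
  "is_corrector n \<BB> \<CC> \<longleftrightarrow>
     (\<forall>x>0. \<CC> x > 0)
   \<and> (\<forall>x>0. twice_diff_at \<CC> x \<and> dF_op n \<BB> \<CC> x = - x * deriv \<BB> x)
   \<and> (\<exists>M>0. (\<lambda>x. \<CC> x - M * x\<^sup>2) \<in> o[at_right 0](\<lambda>x. x\<^sup>2))"

section \<open>The barriers\<close>

text \<open>The sign \<open>s\<close> is \<open>-1\<close> for the lower and \<open>1\<close> for the upper barrier.\<close>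

definition \<theta> :: "real \<Rightarrow> real" where
  "\<theta> t = sqrt (t / (- ln t))"

definition W0 :: "nat \<Rightarrow> real \<Rightarrow> real" where
  "W0 n \<rho> = (real n - 1) / 2 * (1 + 2 * (real n - 1) / \<rho>\<^sup>2)"

definition \<rho>_star :: "real \<Rightarrow> real \<Rightarrow> real" where
  "\<rho>_star A \<epsilon> = A / sqrt \<epsilon>"

definition \<sigma>_star :: "real \<Rightarrow> real \<Rightarrow> real" where
  "\<sigma>_star B \<epsilon> = B / sqrt \<epsilon>"

definition gam :: "nat \<Rightarrow> real \<Rightarrow> real \<Rightarrow> real \<Rightarrow> real \<Rightarrow> real" where
  "gam n A \<epsilon> \<delta> s = \<delta> + (1 + s * \<delta>) * \<epsilon>\<^sup>2 / (\<epsilon> + 2 * A\<^sup>2 / (real n - 1))"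

definition kk :: "nat \<Rightarrow> real \<Rightarrow> real \<Rightarrow> real \<Rightarrow> real \<Rightarrow> real" where
  "kk n A \<epsilon> \<delta> s =
     1 / (real n - 1) * (1 + s * gam n A \<epsilon> \<delta> s + s * \<epsilon> / (2 * (real n - 1)\<^sup>2)) powr (- 1 / 2)"

definition v_out :: "nat \<Rightarrow> real \<Rightarrow> real \<Rightarrow> real \<Rightarrow> real \<Rightarrow> real \<Rightarrow> real" where
  "v_out n \<epsilon> \<delta> s r t =
     (1 + s * \<delta>) * v0 n r + (1 + s * \<epsilon>) * t * F_op n (\<lambda>r'. (1 + s * \<delta>) * v0 n r') r"

definition v_par :: "nat \<Rightarrow> real \<Rightarrow> real \<Rightarrow> real \<Rightarrow> real \<Rightarrow> real \<Rightarrow> real \<Rightarrow> real \<Rightarrow> real" where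
  "v_par n A B \<epsilon> \<delta> s r t = (let \<tau> = ln t; \<rho> = r / sqrt t in
     1 / (- \<tau>) * ((1 + s * gam n A \<epsilon> \<delta> s) * W0 n \<rho> + s * (B\<^sup>2 / (- \<tau> * \<rho> ^ 4))))"

definition v_in :: "nat \<Rightarrow> (real \<Rightarrow> real) \<Rightarrow> (real \<Rightarrow> real) \<Rightarrow> real \<Rightarrow> real \<Rightarrow> real \<Rightarrow> real
    \<Rightarrow> real \<Rightarrow> real \<Rightarrow> real" where
  "v_in n \<BB> \<CC> A \<epsilon> \<delta> s r t = (let \<sigma> = r / \<theta> t; k = kk n A \<epsilon> \<delta> s in
     \<BB> (k * \<sigma>) + (1 - s * \<epsilon>) * \<theta> t * deriv \<theta> t / k\<^sup>2 * \<CC> (k * \<sigma>))"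

definition glue :: "real \<Rightarrow> real \<Rightarrow> real \<Rightarrow> real" where
  "glue s x y = (if s < 0 then max x y else min x y)"

definition barrier :: "nat \<Rightarrow> (real \<Rightarrow> real) \<Rightarrow> (real \<Rightarrow> real) \<Rightarrow> real \<Rightarrow> real \<Rightarrow> real \<Rightarrow> real
    \<Rightarrow> real \<Rightarrow> real \<Rightarrow> real \<Rightarrow> real" where
  "barrier n \<BB> \<CC> A B \<epsilon> \<delta> s r t =
    (if t = 0 then (1 + s * \<delta>) * v0 n r
     else if r = 0 then 1
     else if r \<le> \<sigma>_star B \<epsilon> * \<theta> t then v_in n \<BB> \<CC> A \<epsilon> \<delta> s r t
     else if r \<le> 3 * \<sigma>_star B \<epsilon> * \<theta> t
       then glue s (v_in n \<BB> \<CC> A \<epsilon> \<delta> s r t) (v_par n A B \<epsilon> \<delta> s r t)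
     else if r \<le> \<rho>_star A \<epsilon> * sqrt t then v_par n A B \<epsilon> \<delta> s r t
     else if r \<le> 3 * \<rho>_star A \<epsilon> * sqrt t
       then glue s (v_par n A B \<epsilon> \<delta> s r t) (v_out n \<epsilon> \<delta> s r t)
     else v_out n \<epsilon> \<delta> s r t)"

abbreviation v_lower where "v_lower n \<BB> \<CC> A B \<epsilon> \<delta> \<equiv> barrier n \<BB> \<CC> A B \<epsilon> \<delta> (- 1)"
abbreviation v_upper where "v_upper n \<BB> \<CC> A B \<epsilon> \<delta> \<equiv> barrier n \<BB> \<CC> A B \<epsilon> \<delta> 1"

definition dom_out :: "real \<Rightarrow> real \<Rightarrow> real \<Rightarrow> real \<Rightarrow> (real \<times> real) set" where
  "dom_out A \<epsilon> rs ts = {(r, t). 0 < t \<and> t < ts \<and> \<rho>_star A \<epsilon> * sqrt t \<le> r \<and> r \<le> rs}"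

definition dom_par :: "real \<Rightarrow> real \<Rightarrow> real \<Rightarrow> real \<Rightarrow> (real \<times> real) set" where
  "dom_par A B \<epsilon> ts = {(r, t). 0 < t \<and> t < ts \<and>
     \<sigma>_star B \<epsilon> * \<theta> t \<le> r \<and> r \<le> 3 * \<rho>_star A \<epsilon> * sqrt t}"

definition dom_in :: "real \<Rightarrow> real \<Rightarrow> real \<Rightarrow> (real \<times> real) set" where
  "dom_in B \<epsilon> ts = {(r, t). 0 < t \<and> t < ts \<and> 0 < r \<and> r \<le> 3 * \<sigma>_star B \<epsilon> * \<theta> t}"

text \<open>Multiplying by \<open>s\<close> reverses the ordering for the lower barrier: with \<open>s = -1\<close> the first
  inequality reads \<open>v_par > v_out\<close>.\<close>

definition ordering_ok :: "nat \<Rightarrow> (real \<Rightarrow> real) \<Rightarrow> (real \<Rightarrow> real) \<Rightarrow> real \<Rightarrow> real \<Rightarrow> real \<Rightarrow> real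
    \<Rightarrow> real \<Rightarrow> real \<Rightarrow> bool" where
  "ordering_ok n \<BB> \<CC> A B \<epsilon> \<delta> ts s \<longleftrightarrow> (\<forall>t. 0 < t \<and> t < ts \<longrightarrow>
     (let r1 = \<rho>_star A \<epsilon> * sqrt t; r2 = \<sigma>_star B \<epsilon> * \<theta> t in
       s * v_par n A B \<epsilon> \<delta> s r1 t < s * v_out n \<epsilon> \<delta> s r1 t
     \<and> s * v_par n A B \<epsilon> \<delta> s (3 * r1) t > s * v_out n \<epsilon> \<delta> s (3 * r1) t
     \<and> s * v_in n \<BB> \<CC> A \<epsilon> \<delta> s r2 t < s * v_par n A B \<epsilon> \<delta> s r2 t
     \<and> s * v_in n \<BB> \<CC> A \<epsilon> \<delta> s (3 * r2) t > s * v_par n A B \<epsilon> \<delta> s (3 * r2) t))"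

text \<open>The requirements on the constants under which the barriers are constructed. The regions of the
  piecewise definition must be nested and lie below \<open>rs < 1\<close>.\<close>

definition admissible :: "nat \<Rightarrow> (real \<Rightarrow> real) \<Rightarrow> (real \<Rightarrow> real) \<Rightarrow> real \<Rightarrow> real \<Rightarrow> real \<Rightarrow> real
    \<Rightarrow> real \<Rightarrow> real \<Rightarrow> bool" where
  "admissible n \<BB> \<CC> A B \<epsilon> \<delta> rs ts \<longleftrightarrow>
     A > 0 \<and> B \<ge> 1 \<and> 0 < rs \<and> rs < 1 \<and> 0 < ts \<and> ts < 1
   \<and> (\<forall>t. 0 < t \<and> t < ts \<longrightarrow>
        3 * \<sigma>_star B \<epsilon> * \<theta> t \<le> \<rho>_star A \<epsilon> * sqrt t \<and> 3 * \<rho>_star A \<epsilon> * sqrt t \<le> rs)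
   \<and> is_subsolution n (dom_out A \<epsilon> rs ts) (v_out n \<epsilon> \<delta> (- 1))
   \<and> is_subsolution n (dom_par A B \<epsilon> ts) (v_par n A B \<epsilon> \<delta> (- 1))
   \<and> is_subsolution n (dom_in B \<epsilon> ts) (v_in n \<BB> \<CC> A \<epsilon> \<delta> (- 1))
   \<and> is_supersolution n (dom_out A \<epsilon> rs ts) (v_out n \<epsilon> \<delta> 1)
   \<and> is_supersolution n (dom_par A B \<epsilon> ts) (v_par n A B \<epsilon> \<delta> 1)
   \<and> is_supersolution n (dom_in B \<epsilon> ts) (v_in n \<BB> \<CC> A \<epsilon> \<delta> 1)
   \<and> ordering_ok n \<BB> \<CC> A B \<epsilon> \<delta> ts (- 1)
   \<and> ordering_ok n \<BB> \<CC> A B \<epsilon> \<delta> ts 1"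

end

theory Submission
  imports Defs
begin

text \<open>The theorem is a comparison principle whose whole difficulty sits at the corner \<open>(r, t) = (0, 0)\<close>:
  a solution equals \<open>1\<close> on the axis \<open>r = 0\<close>, \<open>t > 0\<close>, its values tend to \<open>0\<close> along \<open>t = 0\<close>, and
  nothing is known beforehand about how it behaves in between.

  Away from the corner the first contact of a solution with a barrier is ruled out at a single
  point (\<open>first_contact\<close>, \<open>contact_relations\<close>). The glued barriers are maxima of subsolutions and
  minima of supersolutions, so a contact with the glued barrier is a contact with one smooth piece,
  and the strict ordering of the pieces at the ends of their domains moves it into the interior of
  one of these domains (\<open>better_zone\<close>). Write $F = Q + \Lambda$ with $Q$ homogeneous quadratic and
  $\Lambda$ linear. Then $F[mV] = mF[V] + m(m-1)Q[V]$ for a factor $m(t)$, so that multiplying the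
  barriers by \<open>m = 1 \<plusminus> \<kappa> exp (\<mu> t)\<close> makes all inequalities strict, also on the axis, where solution
  and barrier are both \<open>1\<close>, at the price of a bound $Q[v] \le C v$ for the solution or $Q[V] \le 0$ for
  the piece (\<open>multiplicative_contact\<close>). Then \<open>\<kappa>\<close> tends to \<open>0\<close>.

  The corner is avoided by a shift in time. For the lower bound \<open>v r (t + s)\<close> is compared with the
  barrier at time \<open>t\<close>. The shifted solution is smooth up to \<open>t = 0\<close> and close to \<open>1\<close> near the corner,
  where the lower barrier is at most \<open>1 + o(1)\<close>. What is needed at \<open>t = 0\<close> is
  \<open>v r s \<ge> (1 - \<delta>) * v0 n r\<close>. This holds because \<open>(1 - \<delta>) * v0 n r - \<eta>\<close> is a strict stationary
  subsolution which is negative near the pole, where the positivity of \<open>v\<close> is then enough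
  (\<open>a_priori_lower_bound\<close>).

  For the upper bound \<open>v r (t - s)\<close> is compared with the barrier at time \<open>t\<close>. Now the barrier is
  continuous and equal to \<open>1\<close> where \<open>v\<close> is uncontrolled, and the comparison can start once \<open>v \<le> 1\<close> is
  known near the corner (\<open>solution_le_one\<close>). This bound has three steps. First, $1 + r^2/(t-s)$ is a
  supersolution with infinite initial values, whence $v \le 1 + r^2/t$ for all initial data. Secondly,
  \<open>z = sqrt v\<close> satisfies, with $x = r^2$,
  $$z_t = 4xz^2z_{xx} + 2(n-1)z_x + (n-1)z(1-z^2)/x.$$
  Because the diffusion degenerates where $z$ is small, large values near the pole cannot invade a
  region where $z$ is small: a ramp in $x$ of slope $t^{-3/4}$, smoothed at its foot, is a supersolution
  that exceeds the bound of the first step at its left end and moves only by a multiple of $t^{1/4}$.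
  So \<open>v \<le> 1\<close> for \<open>r \<ge> K * sqrt t\<close>. Thirdly, inside this parabola \<open>v\<close> is bounded, and the excess over
  \<open>1\<close> is dominated by a multiple of $(s/t)^k$, which tends to \<open>0\<close> with \<open>s\<close>.

  Close to the pole the bound for \<open>Q[v]\<close> is not available in the upper comparison, and the bound for
  the barrier is used instead. It rests on two facts about the special functions that follow from
  their differential equations: \<open>x * deriv \<BB> x\<close> tends to \<open>0\<close>, and \<open>x * deriv \<CC> x\<close> has no negative
  limit points, as \<open>x\<close> tends to \<open>0\<close> (\<open>pole_profile_estimates\<close>).\<close>

section \<open>First contact with a barrier\<close>

lemma sign_at_local_min:
  fixes f :: "real \<Rightarrow> real"
  assumes f: "twice_diff_at f x" and e: "e > 0" and mn: "\<And>y. \<bar>y - x\<bar> < e \<Longrightarrow> f x \<le> f y"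
  shows "deriv f x = 0" "deriv (deriv f) x \<ge> 0"
proof -
  from f obtain d where d: "d > 0" "\<And>y. \<bar>y - x\<bar> < d \<Longrightarrow> f differentiable (at y)"
    by (auto simp: twice_diff_at_def eventually_nhds_metric dist_real_def)
  have D: "(f has_real_derivative deriv f y) (at y)" if "\<bar>y - x\<bar> < d" for y
    using d(2)[OF that] by (simp add: DERIV_deriv_iff_real_differentiable)
  show z: "deriv f x = 0"
    using DERIV_local_min[OF D[of x] e] d(1) mn by (auto simp: abs_minus_commute)
  have D2: "(deriv f has_real_derivative deriv (deriv f) x) (at x)"
    using f by (simp add: twice_diff_at_def DERIV_deriv_iff_real_differentiable)
  show "deriv (deriv f) x \<ge> 0"
  proof (rule ccontr)
    assume "\<not> deriv (deriv f) x \<ge> 0"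
    then obtain d' where d': "d' > 0" "\<And>h. 0 < h \<Longrightarrow> h < d' \<Longrightarrow> deriv f x > deriv f (x + h)"
      using DERIV_neg_dec_right[OF D2] by auto
    define h where "h = Min {d, d', e} / 2"
    have h: "h > 0" "h < d" "h < d'" "h < e" using d d' e by (auto simp: h_def)
    have "\<exists>z>x. z < x + h \<and> f (x + h) - f x = (x + h - x) * deriv f z"
      by (rule MVT2) (use h in \<open>auto intro!: D\<close>)
    then obtain z where z: "x < z" "z < x + h" "f (x + h) - f x = h * deriv f z" by auto
    have "deriv f z < 0" using d'(2)[of "z - x"] z h \<open>deriv f x = 0\<close> by auto
    then have "f (x + h) - f x < 0" using z(3) h(1) by (simp add: mult_pos_neg)
    then show False using mn[of "x + h"] h by auto
  qed
qed

lemma twice_diff_at_diff: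
  assumes "twice_diff_at f x" "twice_diff_at g x"
  shows "twice_diff_at (\<lambda>y. f y - g y) x"
    "deriv (\<lambda>y. f y - g y) x = deriv f x - deriv g x"
    "deriv (deriv (\<lambda>y. f y - g y)) x = deriv (deriv f) x - deriv (deriv g) x"
proof -
  have ev: "\<forall>\<^sub>F y in nhds x. f differentiable (at y) \<and> g differentiable (at y)"
    using assms by (auto simp: twice_diff_at_def eventually_conj_iff)
  have dd: "deriv (\<lambda>y. f y - g y) y = deriv f y - deriv g y"
    if "f differentiable (at y) \<and> g differentiable (at y)" for y
    using that by (auto intro!: DERIV_imp_deriv derivative_eq_intros simp: DERIV_deriv_iff_real_differentiable)
  have evd: "\<forall>\<^sub>F y in nhds x. deriv (\<lambda>y. f y - g y) y = deriv f y - deriv g y"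
    using ev by eventually_elim (rule dd)
  show "deriv (\<lambda>y. f y - g y) x = deriv f x - deriv g x"
    using ev dd eventually_nhds_x_imp_x by blast
  have 1: "((\<lambda>y. deriv f y - deriv g y) has_real_derivative (deriv (deriv f) x - deriv (deriv g) x)) (at x)"
    using assms by (auto intro!: derivative_eq_intros simp: DERIV_deriv_iff_real_differentiable twice_diff_at_def)
  have 2: "(deriv (\<lambda>y. f y - g y) has_real_derivative (deriv (deriv f) x - deriv (deriv g) x)) (at x)"
    by (rule DERIV_cong_ev[THEN iffD2, OF refl evd refl 1])
  show "deriv (deriv (\<lambda>y. f y - g y)) x = deriv (deriv f) x - deriv (deriv g) x"
    by (rule DERIV_imp_deriv[OF 2])
  show "twice_diff_at (\<lambda>y. f y - g y) x"
    using ev 2 by (auto simp: twice_diff_at_def real_differentiable_def elim!: eventually_mono intro: DERIV_diff)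
qed

lemma contact_relations:
  assumes v: "regular_at v r t" and V: "regular_at V r t" and eq: "V r t = v r t" and e: "e > 0"
    and sp: "\<And>r'. \<bar>r' - r\<bar> < e \<Longrightarrow> V r' t \<le> v r' t"
    and tm: "\<And>t'. t - e < t' \<Longrightarrow> t' < t \<Longrightarrow> V r t' \<le> v r t'"
  shows "deriv (\<lambda>r'. V r' t) r = deriv (\<lambda>r'. v r' t) r"
    "deriv (deriv (\<lambda>r'. V r' t)) r \<le> deriv (deriv (\<lambda>r'. v r' t)) r"
    "deriv (\<lambda>t'. v r t') t \<le> deriv (\<lambda>t'. V r t') t"
proof -
  have tw: "twice_diff_at (\<lambda>r'. v r' t) r" "twice_diff_at (\<lambda>r'. V r' t) r"
    using v V by (auto simp: regular_at_def)
  note dd = twice_diff_at_diff[OF tw]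
  have *: "v r t - V r t \<le> v y t - V y t" if "\<bar>y - r\<bar> < e" for y
    using sp[OF that] eq by simp
  note mn = sign_at_local_min[OF dd(1) e *]
  show "deriv (\<lambda>r'. V r' t) r = deriv (\<lambda>r'. v r' t) r"
    "deriv (deriv (\<lambda>r'. V r' t)) r \<le> deriv (deriv (\<lambda>r'. v r' t)) r"
    using mn dd(2,3) by auto
  have D: "((\<lambda>t'. v r t' - V r t') has_real_derivative (deriv (v r) t - deriv (V r) t)) (at t)"
    using v V by (auto intro!: derivative_eq_intros simp: DERIV_deriv_iff_real_differentiable regular_at_def)
  show "deriv (\<lambda>t'. v r t') t \<le> deriv (\<lambda>t'. V r t') t"
  proof (rule ccontr)
    assume "\<not> ?thesis"
    then obtain d where d: "d > 0" "\<And>h. 0 < h \<Longrightarrow> h < d \<Longrightarrow> v r (t - h) - V r (t - h) < v r t - V r t"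
      using DERIV_pos_inc_left[OF D] by auto
    define h where "h = min d e / 2"
    have "0 < h" "h < d" "h < e" using d e by (auto simp: h_def)
    then show False using d(2)[of h] tm[of "t - h"] eq by auto
  qed
qed

text \<open>Interior points in the parabolic sense: both sides in space, only the past in time. Points at the
  final time of a domain count as interior, because a first contact may happen there.\<close>

definition past_interior :: "(real \<times> real) set \<Rightarrow> real \<Rightarrow> real \<Rightarrow> bool" where
  "past_interior K r t \<longleftrightarrow>
     (\<exists>e>0. \<forall>r' t'. \<bar>r' - r\<bar> < e \<and> t - e < t' \<and> t' \<le> t \<longrightarrow> (r', t') \<in> K)"

lemma past_interior_self: "past_interior K r t \<Longrightarrow> (r, t) \<in> K"
  unfolding past_interior_def by (elim exE conjE) simp

text \<open>At the earliest time at which one of the functions is nonpositive, the chosen point can be taken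
  interior to the domain of its function. By continuity from the past that function vanishes there
  and is nonnegative nearby, at the same time and before. The family makes the lemma apply
  to glued barriers, whose pieces live on different domains.\<close>

lemma first_contact:
  fixes f :: "'i \<Rightarrow> real \<times> real \<Rightarrow> real"
  assumes fin: "finite I" and K: "\<And>i. i \<in> I \<Longrightarrow> compact (K i)"
    and cont: "\<And>i. i \<in> I \<Longrightarrow> continuous_on (K i) (f i)"
    and bd: "\<And>i r t. i \<in> I \<Longrightarrow> (r, t) \<in> K i \<Longrightarrow> f i (r, t) \<le> 0 \<Longrightarrow>
               \<exists>j\<in>I. past_interior (K j) r t \<and> f j (r, t) \<le> 0"
    and no: "\<And>i r t e. i \<in> I \<Longrightarrow> past_interior (K i) r t \<Longrightarrow> f i (r, t) = 0 \<Longrightarrow> e > 0 \<Longrightarrow>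
               (\<And>r'. \<bar>r' - r\<bar> < e \<Longrightarrow> 0 \<le> f i (r', t)) \<Longrightarrow>
               (\<And>t'. t - e < t' \<Longrightarrow> t' < t \<Longrightarrow> 0 \<le> f i (r, t')) \<Longrightarrow> False"
    and p: "i \<in> I" "p \<in> K i"
  shows "f i p > 0"
proof (rule ccontr)
  assume neg: "\<not> f i p > 0"
  define B where "B = (\<Union>i\<in>I. {p \<in> K i. f i p \<le> 0})"
  have "compact {p \<in> K i. f i p \<le> 0}" if "i \<in> I" for i
  proof -
    have "closedin (top_of_set (K i)) (K i \<inter> f i -` {..0})"
      by (rule continuous_closedin_preimage[OF cont[OF that]]) auto
    then have "compact (K i \<inter> f i -` {..0})" using K[OF that] by (rule closedin_compact[rotated])
    moreover have "K i \<inter> f i -` {..0} = {p \<in> K i. f i p \<le> 0}" by auto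
    ultimately show ?thesis by simp
  qed
  then have "compact B" unfolding B_def using fin by (intro compact_UN) auto
  then have "compact (snd ` B)" by (intro compact_continuous_image continuous_on_snd continuous_on_id)
  moreover have "p \<in> B" using p neg by (auto simp: B_def not_less)
  then have "snd ` B \<noteq> {}" by blast
  ultimately obtain t where t: "t \<in> snd ` B" "\<And>t'. t' \<in> snd ` B \<Longrightarrow> t \<le> t'"
    using compact_attains_inf[of "snd ` B"] by blast
  then obtain r j where j: "j \<in> I" "(r, t) \<in> K j" "f j (r, t) \<le> 0" by (auto simp: B_def)
  obtain k where k: "k \<in> I" "past_interior (K k) r t" "f k (r, t) \<le> 0"
    using bd[OF j] by blast
  then obtain e where e: "e > 0" "\<And>r' t'. \<bar>r' - r\<bar> < e \<Longrightarrow> t - e < t' \<Longrightarrow> t' \<le> t \<Longrightarrow> (r', t') \<in> K k"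
    by (auto simp: past_interior_def)
  have past: "f k (r', t') > 0" if "\<bar>r' - r\<bar> < e" "t - e < t'" "t' < t" for r' t'
  proof (rule ccontr)
    assume "\<not> f k (r', t') > 0"
    then have "(r', t') \<in> B" using e(2)[of r' t'] that k(1) by (auto simp: B_def)
    then show False using t(2)[of t'] that by force
  qed
  have now: "0 \<le> f k (r', t)" if r': "\<bar>r' - r\<bar> < e" for r'
  proof -
    have "continuous_on {t - e/2..t} (\<lambda>t'. f k (r', t'))"
      by (rule continuous_on_compose2[OF cont[OF k(1)]]) (use e r' in \<open>auto intro!: continuous_intros\<close>)
    then have "((\<lambda>t'. f k (r', t')) \<longlongrightarrow> f k (r', t)) (at t within {t - e/2..t})"
      using e(1) by (simp add: continuous_on_def)
    then have "((\<lambda>t'. f k (r', t')) \<longlongrightarrow> f k (r', t)) (at_left t)"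
      using e(1) at_within_Icc_at_left[of "t - e/2" t] by simp
    moreover have "\<forall>\<^sub>F t' in at_left t. 0 \<le> f k (r', t')"
      using eventually_at_left_real[of "t - e" t] e(1) past[OF r'] by (auto elim!: eventually_mono intro: less_imp_le)
    ultimately show ?thesis by (rule tendsto_lowerbound) auto
  qed
  have "f k (r, t) = 0" using now[of r] k(3) e(1) by auto
  then show False
  proof (rule no[OF k(1,2) _ e(1)])
    show "0 \<le> f k (r', t)" if "\<bar>r' - r\<bar> < e" for r' using now[OF that] .
    show "0 \<le> f k (r, t')" if "t - e < t'" "t' < t" for t' using past[of r t'] that e(1) by simp
  qed
qed

text \<open>The operator \<open>F_op\<close> as a function of the value \<open>a\<close> and the derivatives \<open>p\<close>, \<open>q\<close> at a point, and the
  part of it that is linear in the unknown. The rest is homogeneous of degree two.\<close>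

definition jet :: "nat \<Rightarrow> real \<Rightarrow> real \<Rightarrow> real \<Rightarrow> real \<Rightarrow> real" where
  "jet n r a p q = a * q - 1/2 * p\<^sup>2 + (real n - 1 - a) / r * p + 2 * (real n - 1) / r\<^sup>2 * a * (1 - a)"

definition linear_part :: "nat \<Rightarrow> real \<Rightarrow> real \<Rightarrow> real \<Rightarrow> real" where
  "linear_part n r a p = (real n - 1) / r * p + 2 * (real n - 1) / r\<^sup>2 * a"

lemma F_op_jet: "F_op n v r = jet n r (v r) (deriv v r) (deriv (deriv v) r)"
  by (simp add: F_op_def jet_def)

lemma jet_mono: "0 \<le> a \<Longrightarrow> q \<le> q' \<Longrightarrow> jet n r a p q \<le> jet n r a p q'"
  by (simp add: jet_def mult_left_mono)

text \<open>Turns derivative rules for an explicit barrier into the form in which the notions of regularity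
  and of the operator are phrased.\<close>

lemma derivatives_of_barrier:
  assumes S: "open S" "r \<in> S"
    and 1: "\<And>x. x \<in> S \<Longrightarrow> ((\<lambda>r'. V r' t) has_real_derivative V' x) (at x)"
    and 2: "(V' has_real_derivative q) (at r)"
    and 3: "((\<lambda>t'. V r t') has_real_derivative s) (at t)"
  shows "regular_at V r t" "deriv (\<lambda>r'. V r' t) r = V' r" "deriv (deriv (\<lambda>r'. V r' t)) r = q"
    "deriv (\<lambda>t'. V r t') t = s" "F_op n (\<lambda>r'. V r' t) r = jet n r (V r t) (V' r) q"
proof -
  have ev: "\<forall>\<^sub>F x in nhds r. x \<in> S" using S by (auto simp: eventually_nhds)
  have d: "deriv (\<lambda>r'. V r' t) x = V' x" if "x \<in> S" for x using 1[OF that] by (rule DERIV_imp_deriv)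
  then show d1: "deriv (\<lambda>r'. V r' t) r = V' r" using S by blast
  have ev': "\<forall>\<^sub>F x in nhds r. deriv (\<lambda>r'. V r' t) x = V' x" using ev by eventually_elim (rule d)
  have D2: "(deriv (\<lambda>r'. V r' t) has_real_derivative q) (at r)"
    by (rule DERIV_cong_ev[THEN iffD2, OF refl ev' refl 2])
  then show d2: "deriv (deriv (\<lambda>r'. V r' t)) r = q" by (rule DERIV_imp_deriv)
  show "deriv (\<lambda>t'. V r t') t = s" using 3 by (rule DERIV_imp_deriv)
  show "regular_at V r t" unfolding regular_at_def twice_diff_at_def real_differentiable_def
    using 3 D2 ev 1 by (auto elim!: eventually_mono)
  show "F_op n (\<lambda>r'. V r' t) r = jet n r (V r t) (V' r) q"
    by (simp add: F_op_jet d1 d2)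
qed

definition solves_on :: "nat \<Rightarrow> (real \<times> real) set \<Rightarrow> (real \<Rightarrow> real \<Rightarrow> real) \<Rightarrow> bool" where
  "solves_on n D v \<longleftrightarrow> (\<forall>(r, t)\<in>D. v r t > 0 \<and> regular_at v r t \<and>
     deriv (\<lambda>t'. v r t') t = F_op n (\<lambda>r'. v r' t) r)"

lemma past_interior_rectangle:
  assumes "a < r" "r < b" "c < t" "t \<le> d"
  shows "past_interior ({a..b} \<times> {c..d}) r t"
  unfolding past_interior_def
  using assms by (intro exI[of _ "Min {r - a, b - r, t - c}"]) auto

lemma past_interior_rectangleD:
  assumes "past_interior ({a..b} \<times> {c..d}) r t"
  shows "a < r" "r < b" "c < t" "t \<le> d"
proof -
  obtain e where e: "e > 0" "\<And>r' t'. \<bar>r' - r\<bar> < e \<Longrightarrow> t - e < t' \<Longrightarrow> t' \<le> t \<Longrightarrow> (r', t') \<in> {a..b} \<times> {c..d}"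
    using assms by (auto simp: past_interior_def)
  show "a < r" "r < b" "c < t" "t \<le> d"
    using e(2)[of "r - e/2" t] e(2)[of "r + e/2" t] e(2)[of r "t - e/2"] e(1) by auto
qed

text \<open>For \<open>s = 1\<close> the function \<open>V\<close> stays above the solution, for \<open>s = - 1\<close> below it. Strictness is required only
  where \<open>V\<close> meets the solution, so that properties of the solution may be used to verify it.\<close>

lemma strict_comparison:
  fixes s :: real
  assumes s: "s = 1 \<or> s = - 1"
    and sol: "solves_on n ({a<..<b} \<times> {c<..d}) v"
    and cv: "continuous_on ({a..b} \<times> {c..d}) (\<lambda>(r, t). v r t)"
    and cV: "continuous_on ({a..b} \<times> {c..d}) (\<lambda>(r, t). V r t)"
    and reg: "\<And>r t. a < r \<Longrightarrow> r < b \<Longrightarrow> c < t \<Longrightarrow> t \<le> d \<Longrightarrow> regular_at V r t"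
    and bc: "\<And>t. c \<le> t \<Longrightarrow> t \<le> d \<Longrightarrow> s * v a t < s * V a t \<and> s * v b t < s * V b t"
    and ic: "\<And>r. a \<le> r \<Longrightarrow> r \<le> b \<Longrightarrow> s * v r c < s * V r c"
    and strict: "\<And>r t. a < r \<Longrightarrow> r < b \<Longrightarrow> c < t \<Longrightarrow> t \<le> d \<Longrightarrow> V r t = v r t \<Longrightarrow>
      s * F_op n (\<lambda>r'. V r' t) r < s * deriv (\<lambda>t'. V r t') t"
    and rt: "r \<in> {a..b}" "t \<in> {c..d}"
  shows "s * v r t < s * V r t"
proof -
  define f where "f = (\<lambda>(r, t). s * V r t - s * v r t)"
  have "f (r, t) > 0"
  proof (rule first_contact[where I="{()}" and K="\<lambda>_. {a..b} \<times> {c..d}" and f="\<lambda>_. f"])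
    show "continuous_on ({a..b} \<times> {c..d}) f"
      using cV cv unfolding f_def case_prod_unfold by (intro continuous_intros)
    fix r t assume p: "(r, t) \<in> {a..b} \<times> {c..d}" and le: "f (r, t) \<le> 0"
    then have "r \<noteq> a" "r \<noteq> b" "t \<noteq> c" using bc[of t] ic[of r] by (auto simp: f_def)
    then have "past_interior ({a..b} \<times> {c..d}) r t"
      using p by (intro past_interior_rectangle) auto
    with le show "\<exists>j\<in>{()}. past_interior ({a..b} \<times> {c..d}) r t \<and> f (r, t) \<le> 0" by auto
  next
    fix r t e
    assume pi: "past_interior ({a..b} \<times> {c..d}) r t" and z: "f (r, t) = 0" and e: "(e::real) > 0"
      and sp: "\<And>r'. \<bar>r' - r\<bar> < e \<Longrightarrow> 0 \<le> f (r', t)"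
      and tm: "\<And>t'. t - e < t' \<Longrightarrow> t' < t \<Longrightarrow> 0 \<le> f (r, t')"
    note i = past_interior_rectangleD[OF pi]
    have so: "v r t > 0" "regular_at v r t" "deriv (\<lambda>t'. v r t') t = F_op n (\<lambda>r'. v r' t) r"
      using sol i by (auto simp: solves_on_def)
    have eq: "V r t = v r t" using z s by (auto simp: f_def)
    have st: "s * F_op n (\<lambda>r'. V r' t) r < s * deriv (V r) t" using strict i eq by auto
    from s show False
    proof
      assume s1: "s = 1"
      note c = contact_relations[OF reg[OF i] so(2) eq[symmetric] e]
      have "deriv (V r) t \<le> deriv (v r) t" using c(3) sp tm by (auto simp: f_def s1)
      moreover have "F_op n (\<lambda>r'. v r' t) r \<le> F_op n (\<lambda>r'. V r' t) r"
        unfolding F_op_jet using c(1,2) sp tm so(1) eq by (auto simp: f_def s1 intro!: jet_mono)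
      ultimately show False using so(3) st by (simp add: s1)
    next
      assume s1: "s = - 1"
      note c = contact_relations[OF so(2) reg[OF i] eq e]
      have "deriv (v r) t \<le> deriv (V r) t" using c(3) sp tm by (auto simp: f_def s1)
      moreover have "F_op n (\<lambda>r'. V r' t) r \<le> F_op n (\<lambda>r'. v r' t) r"
        unfolding F_op_jet using c(1,2) sp tm so(1) eq by (auto simp: f_def s1 intro!: jet_mono)
      ultimately show False using so(3) st by (simp add: s1)
    qed
  qed (use rt in \<open>auto intro: compact_Times\<close>)
  then show ?thesis by (simp add: f_def)
qed

lemmas strict_supersolution_above = strict_comparison[of 1, simplified]
lemmas strict_subsolution_below = strict_comparison[of "- 1", simplified]

section \<open>Regularity of smooth solutions\<close>

lemma partial_derivatives:
  assumes "(f has_derivative (\<lambda>h. a * fst h + b * snd h)) (at (r, t))"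
  shows "((\<lambda>r'. f (r', t)) has_real_derivative a) (at r)"
    "((\<lambda>t'. f (r, t')) has_real_derivative b) (at t)"
proof -
  have "((\<lambda>r'. f (r', t)) has_derivative (\<lambda>h. a * fst (h, 0::real) + b * snd (h, 0::real))) (at r)"
    by (rule has_derivative_compose[OF has_derivative_Pair[OF has_derivative_ident has_derivative_const] assms])
  then show "((\<lambda>r'. f (r', t)) has_real_derivative a) (at r)"
    by (simp add: has_field_derivative_def)
  have "((\<lambda>t'. f (r, t')) has_derivative (\<lambda>h. a * fst (0::real, h) + b * snd (0::real, h))) (at t)"
    by (rule has_derivative_compose[OF has_derivative_Pair[OF has_derivative_const has_derivative_ident] assms])
  then show "((\<lambda>t'. f (r, t')) has_real_derivative b) (at t)"
    by (simp add: has_field_derivative_def)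
qed

lemma smooth_solution_regularity:
  assumes sol: "smooth_solution n vinit r1 t1 v"
  obtains vr vt where
    "continuous_on ({0<..r1} \<times> {0..<t1}) (\<lambda>(r, t). v r t)"
    "continuous_on ({0<..r1} \<times> {0..<t1}) vr" "continuous_on ({0<..r1} \<times> {0..<t1}) vt"
    "\<And>r t. 0 < r \<Longrightarrow> r < r1 \<Longrightarrow> 0 < t \<Longrightarrow> t < t1 \<Longrightarrow> deriv (\<lambda>r'. v r' t) r = vr (r, t)"
    "\<And>r t. 0 < r \<Longrightarrow> r < r1 \<Longrightarrow> 0 < t \<Longrightarrow> t < t1 \<Longrightarrow> deriv (\<lambda>t'. v r t') t = vt (r, t)"
    "solves_on n ({0<..<r1} \<times> {0<..<t1}) v"
proof -
  let ?S = "{0<..r1} \<times> {0..<t1}" and ?I = "{0<..<r1} \<times> {0<..<t1}"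
  have sm: "smooth2_on ?S (\<lambda>(r, t). v r t)" using sol by (simp add: smooth_solution_def)
  then have "Ck_on (Suc (Suc 0)) ?S (\<lambda>(r, t). v r t)" by (simp only: smooth2_on_def)
  then obtain vr vt where
    d: "\<And>p. p \<in> ?S \<Longrightarrow> ((\<lambda>(r, t). v r t) has_derivative (\<lambda>h. vr p * fst h + vt p * snd h)) (at p within ?S)"
    and c: "Ck_on (Suc 0) ?S vr" "Ck_on (Suc 0) ?S vt" by auto
  obtain vrr vrt where
    d2: "\<And>p. p \<in> ?S \<Longrightarrow> (vr has_derivative (\<lambda>h. vrr p * fst h + vrt p * snd h)) (at p within ?S)"
    using c(1) by auto
  have dc: "continuous_on ?S g" if "Ck_on (Suc 0) ?S g" for g
  proof -
    obtain f1 f2 where "\<And>p. p \<in> ?S \<Longrightarrow> (g has_derivative (\<lambda>h. f1 p * fst h + f2 p * snd h)) (at p within ?S)"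
      using \<open>Ck_on (Suc 0) ?S g\<close> by auto
    then show ?thesis by (rule has_derivative_continuous_on)
  qed
  have int: "(g has_derivative g') (at p)" if "(g has_derivative g') (at p within ?S)" "p \<in> ?I"
    for g :: "real \<times> real \<Rightarrow> real" and g' p
  proof -
    have "(g has_derivative g') (at p within ?I)" by (rule has_derivative_subset[OF that(1)]) auto
    moreover have "open ?I" by (intro open_Times open_greaterThanLessThan)
    note at_within_open[OF that(2) this]
    ultimately show ?thesis by (simp only:)
  qed
  have D: "((\<lambda>r'. v r' t) has_real_derivative vr (r, t)) (at r)"
    "((\<lambda>t'. v r t') has_real_derivative vt (r, t)) (at t)"
    "((\<lambda>r'. vr (r', t)) has_real_derivative vrr (r, t)) (at r)"
    if "0 < r" "r < r1" "0 < t" "t < t1" for r t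
  proof -
    have p: "(r, t) \<in> ?S" "(r, t) \<in> ?I" using that by auto
    show "((\<lambda>r'. v r' t) has_real_derivative vr (r, t)) (at r)"
      "((\<lambda>t'. v r t') has_real_derivative vt (r, t)) (at t)"
      using partial_derivatives[OF int[OF d[OF p(1)] p(2)]] by simp_all
    show "((\<lambda>r'. vr (r', t)) has_real_derivative vrr (r, t)) (at r)"
      using partial_derivatives(1)[OF int[OF d2[OF p(1)] p(2)]] .
  qed
  have "solves_on n ?I v"
    unfolding solves_on_def
  proof (clarify, intro conjI)
    fix r t :: real assume rt: "r \<in> {0<..<r1}" "t \<in> {0<..<t1}"
    show "v r t > 0" "deriv (v r) t = F_op n (\<lambda>r'. v r' t) r"
      using sol rt by (auto simp: smooth_solution_def)
    show "regular_at v r t"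
      by (rule derivatives_of_barrier(1)[of "{0<..<r1}" r v t "\<lambda>r. vr (r, t)" "vrr (r, t)" "vt (r, t)"])
         (use rt D in auto)
  qed
  show ?thesis
  proof (rule that[of vr vt])
    show "continuous_on ?S (\<lambda>(r, t). v r t)" by (rule dc) (use sm in \<open>simp only: smooth2_on_def\<close>)
    show "continuous_on ?S vr" "continuous_on ?S vt" using c by (auto intro: dc simp del: Ck_on.simps)
    show "solves_on n ?I v" by fact
  qed (use D in \<open>auto intro: DERIV_imp_deriv\<close>)
qed

lemma smooth_solution_continuous:
  assumes "smooth_solution n vinit r1 t1 v"
  shows "continuous_on ({0<..r1} \<times> {0..<t1}) (\<lambda>(r, t). v r t)"
  by (rule smooth_solution_regularity[OF assms])

lemma smooth_solution_solves:
  assumes "smooth_solution n vinit r1 t1 v"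
  shows "solves_on n ({0<..<r1} \<times> {0<..<t1}) v"
proof (rule smooth_solution_regularity[OF assms])
  assume "solves_on n ({0<..<r1} \<times> {0<..<t1}) v"
  then show ?thesis .
qed

text \<open>For a solution this is $Q[v] \le Cv$, since the time derivative is $Q[v] + \Lambda[v]$. Unlike
  that inequality it involves only first derivatives. For a supersolution it implies that inequality.\<close>

definition rate_bound :: "nat \<Rightarrow> (real \<Rightarrow> real \<Rightarrow> real) \<Rightarrow> real \<Rightarrow> real \<Rightarrow> real \<Rightarrow> bool" where
  "rate_bound n v C r t \<longleftrightarrow>
     deriv (\<lambda>t'. v r t') t \<le> linear_part n r (v r t) (deriv (\<lambda>r'. v r' t) r) + C * v r t"

lemma rate_bound_away_from_pole:
  assumes sol: "smooth_solution n vinit r1 t1 v"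
    and ab: "0 < a" "b < r1" and T: "0 \<le> s" "T < t1"
    and pos: "\<And>r t. a \<le> r \<Longrightarrow> r \<le> b \<Longrightarrow> s \<le> t \<Longrightarrow> t \<le> T \<Longrightarrow> v r t > 0"
  shows "\<exists>C. \<forall>r\<in>{a..b}. \<forall>t\<in>{s..T}. 0 < t \<longrightarrow> rate_bound n v C r t"
proof -
  obtain vr vt where c: "continuous_on ({0<..r1} \<times> {0..<t1}) vr" "continuous_on ({0<..r1} \<times> {0..<t1}) vt"
    and d: "\<And>r t. 0 < r \<Longrightarrow> r < r1 \<Longrightarrow> 0 < t \<Longrightarrow> t < t1 \<Longrightarrow> deriv (\<lambda>r'. v r' t) r = vr (r, t)"
    "\<And>r t. 0 < r \<Longrightarrow> r < r1 \<Longrightarrow> 0 < t \<Longrightarrow> t < t1 \<Longrightarrow> deriv (\<lambda>t'. v r t') t = vt (r, t)"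
    by (rule smooth_solution_regularity[OF sol]) (rule that; assumption)
  note cv = smooth_solution_continuous[OF sol]
  let ?K = "{a..b} \<times> {s..T}"
  have sub: "?K \<subseteq> {0<..r1} \<times> {0..<t1}" using ab T by auto
  define g where "g = (\<lambda>p. (vt p - linear_part n (fst p) (v (fst p) (snd p)) (vr p)) / v (fst p) (snd p))"
  have "continuous_on ?K g"
    unfolding g_def linear_part_def
    using continuous_on_subset[OF cv sub] continuous_on_subset[OF c(1) sub] continuous_on_subset[OF c(2) sub] ab pos
    by (intro continuous_intros) (auto simp: case_prod_unfold less_imp_neq[THEN not_sym])
  moreover have "compact ?K" by (intro compact_Times compact_Icc)
  ultimately have "bounded (g ` ?K)" by (intro compact_imp_bounded compact_continuous_image)
  then obtain C where C: "\<And>p. p \<in> ?K \<Longrightarrow> \<bar>g p\<bar> \<le> C" by (auto simp: bounded_iff)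
  show ?thesis
  proof (intro exI[of _ C] ballI impI)
    fix r t :: real assume rt: "r \<in> {a..b}" "t \<in> {s..T}" "0 < t"
    then have v: "v r t > 0" using pos by auto
    have "(vt (r, t) - linear_part n r (v r t) (vr (r, t))) / v r t \<le> C"
      using abs_le_D1[OF C[of "(r, t)"]] rt by (simp add: g_def)
    then have "vt (r, t) - linear_part n r (v r t) (vr (r, t)) \<le> C * v r t" using v by (simp add: pos_divide_le_eq)
    then show "rate_bound n v C r t" using d[of r t] rt ab T by (simp add: rate_bound_def)
  qed
qed

text \<open>Here \<open>v r t = u (r\<^sup>2, t)\<close> with \<open>u\<close> smooth up to the axis, so that \<open>r\<close> times the radial derivative tends to
  \<open>0\<close> while \<open>v\<close> tends to \<open>1\<close>. Hence \<open>linear_part\<close> is nonnegative near the pole, and the rate bound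
  reduces to a bound for the time derivative.\<close>

lemma behaviour_at_pole:
  assumes sol: "smooth_solution n vinit r1 t1 v" and r1: "r1 > 0" and s: "0 < s" "T < t1"
  shows pole_limit: "\<And>\<kappa>. \<kappa> > 0 \<Longrightarrow> \<exists>a>0. a < r1 \<and> (\<forall>r\<in>{0..a}. \<forall>t\<in>{s..T}. \<bar>v r t - 1\<bar> < \<kappa>)"
    and pole_rate: "n \<ge> 1 \<Longrightarrow> \<exists>a>0. a < r1 \<and> (\<exists>C. \<forall>r\<in>{0<..a}. \<forall>t\<in>{s..T}. rate_bound n v C r t)"
proof -
  let ?U = "{0..r1\<^sup>2} \<times> {0<..<t1}" and ?K = "{0..r1\<^sup>2} \<times> {s..T}"
  obtain u where u: "smooth2_on ?U u" "\<And>r t. r \<in> {0..r1} \<Longrightarrow> t \<in> {0<..<t1} \<Longrightarrow> v r t = u (r\<^sup>2, t)"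
    using sol unfolding smooth_solution_def by blast
  then have "Ck_on (Suc 0) ?U u" by (simp only: smooth2_on_def)
  then obtain u1 u2 where
    d: "\<And>p. p \<in> ?U \<Longrightarrow> (u has_derivative (\<lambda>h. u1 p * fst h + u2 p * snd h)) (at p within ?U)"
    and c: "continuous_on ?U u1" "continuous_on ?U u2" by auto
  have cu: "continuous_on ?U u" using d by (rule has_derivative_continuous_on)
  have sub: "?K \<subseteq> ?U" using s by auto
  have K: "compact ?K" by (intro compact_Times compact_Icc)
  have u0: "u (0, t) = 1" if "t \<in> {s..T}" for t
    using sol u(2)[of 0 t] that s r1 by (auto simp: smooth_solution_def)
  have lim: "\<exists>a>0. a < r1 \<and> (\<forall>r\<in>{0..a}. \<forall>t\<in>{s..T}. \<bar>v r t - 1\<bar> < \<kappa>)" if "\<kappa> > 0" for \<kappa>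
  proof -
    have "uniformly_continuous_on ?K u"
      by (rule compact_uniformly_continuous[OF continuous_on_subset[OF cu sub] K])
    then obtain e where e: "e > 0" "\<And>p q. p \<in> ?K \<Longrightarrow> q \<in> ?K \<Longrightarrow> dist q p < e \<Longrightarrow> dist (u q) (u p) < \<kappa>"
      by (rule uniformly_continuous_onE[OF _ \<open>\<kappa> > 0\<close>]) (rule that)
    define a where "a = min (r1/2) (sqrt (e/2))"
    have a: "0 < a" "a < r1" "a\<^sup>2 < e"
    proof -
      show "0 < a" "a < r1" using r1 e by (auto simp: a_def)
      have "a\<^sup>2 \<le> (sqrt (e/2))\<^sup>2" using \<open>0 < a\<close> by (intro power_mono) (auto simp: a_def)
      then show "a\<^sup>2 < e" using e by simp
    qed
    have "\<bar>v r t - 1\<bar> < \<kappa>" if rt: "r \<in> {0..a}" "t \<in> {s..T}" for r t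
    proof -
      have r2: "r\<^sup>2 \<le> a\<^sup>2" "r\<^sup>2 \<le> r1\<^sup>2" using rt a by (auto intro!: power_mono)
      have "dist (u (r\<^sup>2, t)) (u (0, t)) < \<kappa>"
      proof (rule e(2))
        have "sqrt (r ^ 4) = r\<^sup>2" by (rule real_sqrt_unique) (simp_all flip: power_mult)
        then show "dist (r\<^sup>2, t) (0, t) < e" using r2 a by (simp add: dist_Pair_Pair)
      qed (use rt r2 in auto)
      then show ?thesis using u(2)[of r t] u0[of t] rt a s by (simp add: dist_real_def)
    qed
    then show ?thesis using a by blast
  qed
  then show "\<And>\<kappa>. \<kappa> > 0 \<Longrightarrow> \<exists>a>0. a < r1 \<and> (\<forall>r\<in>{0..a}. \<forall>t\<in>{s..T}. \<bar>v r t - 1\<bar> < \<kappa>)" .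
  have "bounded (u1 ` ?K)" "bounded (u2 ` ?K)"
    by (auto intro!: compact_imp_bounded compact_continuous_image K continuous_on_subset[OF _ sub] c)
  then obtain M1 M2 where "\<forall>x\<in>u1 ` ?K. norm x \<le> M1" "\<forall>x\<in>u2 ` ?K. norm x \<le> M2"
    unfolding bounded_iff by blast
  then have M: "\<And>p. p \<in> ?K \<Longrightarrow> \<bar>u1 p\<bar> \<le> M1" "\<And>p. p \<in> ?K \<Longrightarrow> \<bar>u2 p\<bar> \<le> M2"
    unfolding real_norm_def by blast+
  define M where "M = max 1 (max M1 M2)"
  obtain a0 where a0: "a0 > 0" "a0 < r1" "\<And>r t. r \<in> {0..a0} \<Longrightarrow> t \<in> {s..T} \<Longrightarrow> \<bar>v r t - 1\<bar> < 1/2"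
    using lim[of "1/2"] by auto
  define a where "a = min a0 (sqrt (1 / (4 * M)))"
  have Mp: "M \<ge> 1" by (simp add: M_def)
  have a: "0 < a" "a \<le> a0" "a < r1" using a0 Mp by (auto simp: a_def)
  show "\<exists>a>0. a < r1 \<and> (\<exists>C. \<forall>r\<in>{0<..a}. \<forall>t\<in>{s..T}. rate_bound n v C r t)" if n: "n \<ge> 1"
  proof (rule exI[of _ a], intro conjI a, rule exI[of _ "2*M"], intro ballI)
    fix r t :: real assume rt: "r \<in> {0<..a}" "t \<in> {s..T}"
    have p: "(r\<^sup>2, t) \<in> {0<..<r1\<^sup>2} \<times> {0<..<t1}" "(r\<^sup>2, t) \<in> ?K"
      using rt a s by (auto intro!: power_strict_mono power_mono)
    have "(u has_derivative (\<lambda>h. u1 (r\<^sup>2, t) * fst h + u2 (r\<^sup>2, t) * snd h)) (at (r\<^sup>2, t) within {0<..<r1\<^sup>2} \<times> {0<..<t1})"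
      by (rule has_derivative_subset[OF d]) (use p in auto)
    moreover have "open ({0<..<r1\<^sup>2} \<times> {0<..<t1})" by (intro open_Times open_greaterThanLessThan)
    note at_within_open[OF p(1) this]
    ultimately have "(u has_derivative (\<lambda>h. u1 (r\<^sup>2, t) * fst h + u2 (r\<^sup>2, t) * snd h)) (at (r\<^sup>2, t))"
      by (simp only:)
    note pd = partial_derivatives[OF this]
    have evr: "\<forall>\<^sub>F x in nhds r. v x t = u (x\<^sup>2, t)"
    proof (rule eventually_mono[OF eventually_nhds_in_open[of "{0<..<r1}" r]])
      show "r \<in> {0<..<r1}" using rt a by auto
      show "v x t = u (x\<^sup>2, t)" if "x \<in> {0<..<r1}" for x using u(2)[of x t] that rt s by auto
    qed auto
    have "((\<lambda>x. u (x\<^sup>2, t)) has_real_derivative u1 (r\<^sup>2, t) * (2 * r)) (at r)"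
      by (rule DERIV_chain2[where f="\<lambda>x. u (x, t)" and g="\<lambda>x. x\<^sup>2"], rule pd(1))
         (auto intro!: derivative_eq_intros)
    then have vr: "deriv (\<lambda>x. v x t) r = u1 (r\<^sup>2, t) * (2 * r)"
      by (intro DERIV_imp_deriv DERIV_cong_ev[THEN iffD2, OF refl evr refl])
    have evt: "\<forall>\<^sub>F x in nhds t. v r x = u (r\<^sup>2, x)"
    proof (rule eventually_mono[OF eventually_nhds_in_open[of "{0<..<t1}" t]])
      show "t \<in> {0<..<t1}" using rt s by auto
      show "v r x = u (r\<^sup>2, x)" if "x \<in> {0<..<t1}" for x using u(2)[of r x] that rt a by auto
    qed auto
    have vt: "deriv (\<lambda>x. v r x) t = u2 (r\<^sup>2, t)"
      by (intro DERIV_imp_deriv DERIV_cong_ev[THEN iffD2, OF refl evt refl] pd(2))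
    have "\<bar>v r t - 1\<bar> < 1/2" using a0(3)[of r t] rt a by simp
    then have v: "v r t \<ge> 1/2" by linarith
    have b: "- M \<le> u1 (r\<^sup>2, t)" "u2 (r\<^sup>2, t) \<le> M" using M(1,2)[OF p(2)] by (auto simp: M_def)
    have "r\<^sup>2 \<le> (sqrt (1 / (4 * M)))\<^sup>2" using rt by (intro power_mono) (auto simp: a_def)
    then have "r\<^sup>2 * M \<le> 1 / (4 * M) * M" using Mp by (intro mult_right_mono) auto
    then have "r\<^sup>2 * M \<le> 1/4" using Mp by simp
    moreover have "r\<^sup>2 * (- M) \<le> r\<^sup>2 * u1 (r\<^sup>2, t)" using b by (intro mult_left_mono) auto
    ultimately have nn: "r\<^sup>2 * u1 (r\<^sup>2, t) + v r t \<ge> 0" using v by (simp; linarith)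
    have "linear_part n r (v r t) (deriv (\<lambda>x. v x t) r) = 2 * (real n - 1) / r\<^sup>2 * (r\<^sup>2 * u1 (r\<^sup>2, t) + v r t)"
      using rt by (simp add: linear_part_def vr field_simps power2_eq_square)
    also have "\<dots> \<ge> 0" using nn n by simp
    finally have "linear_part n r (v r t) (deriv (\<lambda>x. v x t) r) \<ge> 0" .
    moreover have "M \<le> 2 * M * v r t" using Mp v mult_left_mono[OF v, of "2*M"] by simp
    ultimately show "rate_bound n v (2 * M) r t" using b by (simp add: rate_bound_def vt)
  qed
qed

lemma rate_bound_positive_time:
  assumes sol: "smooth_solution n vinit r1 t1 v" and r1: "r1 > 0" and s: "0 < s" "T < t1"
    and b: "b < r1" and n: "n \<ge> 1"
  shows "\<exists>C. \<forall>r\<in>{0<..b}. \<forall>t\<in>{s..T}. rate_bound n v C r t"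
proof -
  obtain a C1 where a: "0 < a" "a < r1" "\<And>r t. r \<in> {0<..a} \<Longrightarrow> t \<in> {s..T} \<Longrightarrow> rate_bound n v C1 r t"
    using pole_rate[OF sol r1 s n] by blast
  have pos: "v r t > 0" if "r \<in> {0..r1}" "t \<in> {0<..<t1}" for r t using sol that by (auto simp: smooth_solution_def)
  have "\<exists>C. \<forall>r\<in>{a..b}. \<forall>t\<in>{s..T}. 0 < t \<longrightarrow> rate_bound n v C r t"
    by (rule rate_bound_away_from_pole[OF sol a(1) b less_imp_le[OF s(1)] s(2)]) (rule pos; use s a b in simp)
  then obtain C2 where "\<forall>r\<in>{a..b}. \<forall>t\<in>{s..T}. 0 < t \<longrightarrow> rate_bound n v C2 r t" by (rule exE)
  then have C2: "\<And>r t. r \<in> {a..b} \<Longrightarrow> t \<in> {s..T} \<Longrightarrow> rate_bound n v C2 r t" using s(1) by simp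
  have "rate_bound n v (max C1 C2) r t" if rt: "r \<in> {0<..b}" "t \<in> {s..T}" for r t
  proof -
    have "rate_bound n v C1 r t \<or> rate_bound n v C2 r t" using a(3)[of r t] C2[of r t] rt by force
    moreover have "C1 * v r t \<le> max C1 C2 * v r t" "C2 * v r t \<le> max C1 C2 * v r t"
      using pos[of r t] rt b s by (auto intro!: mult_right_mono)
    ultimately show ?thesis by (auto simp: rate_bound_def)
  qed
  then show ?thesis by blast
qed


section \<open>The initial profile as a lower bound\<close>

lemma uniform_for_small_times:
  fixes g :: "real \<times> real \<Rightarrow> real"
  assumes g: "continuous_on ({a..b} \<times> {0..T}) g" and T: "0 < T"
    and lt: "\<And>r. r \<in> {a..b} \<Longrightarrow> g (r, 0) < M"
  shows "\<exists>c>0. c \<le> T \<and> (\<forall>r\<in>{a..b}. \<forall>t\<in>{0..c}. g (r, t) < M)"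
proof (cases "a \<le> b")
  case False
  with T show ?thesis by auto
next
  case True
  have "continuous_on {a..b} (\<lambda>r. g (r, 0))"
    by (rule continuous_on_compose2[OF g]) (use T in \<open>auto intro!: continuous_intros\<close>)
  then obtain r0 where r0: "r0 \<in> {a..b}" "\<And>r. r \<in> {a..b} \<Longrightarrow> g (r, 0) \<le> g (r0, 0)"
    using continuous_attains_sup[of "{a..b}" "\<lambda>r. g (r, 0)"] True by auto
  have "compact ({a..b} \<times> {0..T})" by (intro compact_Times compact_Icc)
  then have "uniformly_continuous_on ({a..b} \<times> {0..T}) g" by (rule compact_uniformly_continuous[OF g])
  moreover have "M - g (r0, 0) > 0" using lt[OF r0(1)] by simp
  ultimately obtain d where d: "d > 0" "\<And>p q. p \<in> {a..b} \<times> {0..T} \<Longrightarrow> q \<in> {a..b} \<times> {0..T} \<Longrightarrow>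
      dist q p < d \<Longrightarrow> dist (g q) (g p) < M - g (r0, 0)"
    by (rule uniformly_continuous_onE) (rule that)
  have "g (r, t) < M" if rt: "r \<in> {a..b}" "t \<in> {0..min T (d/2)}" for r t
  proof -
    have "dist (g (r, t)) (g (r, 0)) < M - g (r0, 0)"
      by (rule d(2)) (use rt T d(1) in \<open>auto simp: dist_Pair_Pair dist_real_def\<close>)
    then show ?thesis using r0(2)[OF rt(1)] by (simp add: dist_real_def)
  qed
  then show ?thesis using T d(1) by (intro exI[of _ "min T (d/2)"]) auto
qed

lemma bounded_on_rectangle:
  fixes g :: "real \<times> real \<Rightarrow> real"
  assumes "continuous_on ({a..b} \<times> {c..d}) g"
  obtains M where "\<And>r t. r \<in> {a..b} \<Longrightarrow> t \<in> {c..d} \<Longrightarrow> \<bar>g (r, t)\<bar> \<le> M"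
proof -
  have "bounded (g ` ({a..b} \<times> {c..d}))"
    by (intro compact_imp_bounded compact_continuous_image assms compact_Times compact_Icc)
  then obtain M where "\<forall>x\<in>g ` ({a..b} \<times> {c..d}). norm x \<le> M"
    unfolding bounded_iff by (rule exE)
  then show ?thesis by (intro that[of M]) auto
qed

lemma v0_derivatives:
  assumes "0 < r" "r < 1"
  shows "((\<lambda>r. c * v0 n r - \<eta>) has_real_derivative c * (real n - 1) / 4 / (r * (ln r)\<^sup>2)) (at r)"
    "((\<lambda>r. c * (real n - 1) / 4 / (r * (ln r)\<^sup>2)) has_real_derivative
        c * (real n - 1) / 4 * ((2 + ln r) / (r\<^sup>2 * (- ln r) ^ 3))) (at r)"
proof -
  have l: "ln r < 0" using assms by simp
  then have l0: "ln r \<noteq> 0" by simp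
  show "((\<lambda>r. c * v0 n r - \<eta>) has_real_derivative c * (real n - 1) / 4 / (r * (ln r)\<^sup>2)) (at r)"
    unfolding v0_def using assms l0
    by (auto intro!: derivative_eq_intros simp: field_simps power2_eq_square)
  have "((\<lambda>r. B / (r * (ln r)\<^sup>2)) has_real_derivative
        B * ((2 + ln r) / (r\<^sup>2 * (- ln r) ^ 3))) (at r)" for B
    using assms l0
    by (auto intro!: derivative_eq_intros simp: divide_simps) (simp add: algebra_simps eval_nat_numeral)
  then show "((\<lambda>r. c * (real n - 1) / 4 / (r * (ln r)\<^sup>2)) has_real_derivative
        c * (real n - 1) / 4 * ((2 + ln r) / (r\<^sup>2 * (- ln r) ^ 3))) (at r)" .
qed

lemma F_op_v0:
  assumes "0 < r" "r < 1"
  shows "F_op n (\<lambda>r. c * v0 n r - \<eta>) r = jet n r (c * v0 n r - \<eta>)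
      (c * (real n - 1) / 4 / (r * (ln r)\<^sup>2)) (c * (real n - 1) / 4 * ((2 + ln r) / (r\<^sup>2 * (- ln r) ^ 3)))"
    "regular_at (\<lambda>r t. c * v0 n r - \<eta>) r t" "deriv (\<lambda>t::real. c * v0 n r - \<eta>) t = 0"
  using derivatives_of_barrier[of "{0<..<1}" r "\<lambda>r t. c * v0 n r - \<eta>" t
      "\<lambda>r. c * (real n - 1) / 4 / (r * (ln r)\<^sup>2)"
      "c * (real n - 1) / 4 * ((2 + ln r) / (r\<^sup>2 * (- ln r) ^ 3))" 0] assms v0_derivatives
  by auto

lemma v0_pos: "n \<ge> 2 \<Longrightarrow> 0 < r \<Longrightarrow> r < 1 \<Longrightarrow> 0 < v0 n r"
  by (simp add: v0_def divide_pos_neg)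

text \<open>Up to lower order \<open>r\<^sup>2\<close> times the value is \<open>2 * (n - 1) * (c * v0 n r - \<eta>)\<close> plus a positive multiple of
  \<open>1 / (ln r)\<^sup>2\<close>. The bound on \<open>r\<close> makes the negative terms smaller.\<close>

lemma F_op_v0_pos:
  assumes n: "n \<ge> 2" and c: "0 < c" "c \<le> 2" and r: "0 < r" "- ln r \<ge> 2 * real n"
    and \<eta>: "\<eta> \<ge> 0" "c * v0 n r - \<eta> > 0"
  shows "F_op n (\<lambda>r. c * v0 n r - \<eta>) r > 0"
proof -
  define L where "L = - ln r"
  define b where "b = c * (real n - 1) / 4"
  define \<psi> where "\<psi> = c * v0 n r - \<eta>"
  have n': "real n - 1 \<ge> 1" using n by simp
  have L: "L \<ge> 4" "L \<ge> 2 * real n" using r n by (auto simp: L_def)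
  have "ln r < 0" using L by (simp add: L_def)
  then have r1: "r < 1" using r(1) by simp
  have b: "b > 0" "b \<le> L / 4"
  proof -
    show "b > 0" using c n' by (simp add: b_def)
    have "c * (real n - 1) \<le> 2 * (real n - 1)" using c n' by (intro mult_right_mono) auto
    then show "b \<le> L / 4" using L by (simp add: b_def)
  qed
  have \<psi>: "0 < \<psi>" "\<psi> \<le> b / L" using \<eta> by (auto simp: \<psi>_def v0_def b_def L_def)
  have "b / L \<le> 1 / 4" using b L by (simp add: divide_le_eq)
  then have \<psi>4: "\<psi> \<le> 1 / 4" using \<psi> by linarith
  have "F_op n (\<lambda>r. c * v0 n r - \<eta>) r = jet n r \<psi> (b / (r * L\<^sup>2)) (b * ((2 - L) / (r\<^sup>2 * L ^ 3)))"
    using F_op_v0(1)[OF r(1) r1, of n c \<eta>] by (simp add: \<psi>_def b_def L_def)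
  also have "\<dots> = (\<psi> * b * 2 / L ^ 3 + b / L\<^sup>2 * (real n - 1 - b / (2 * L\<^sup>2))
      + 2 * \<psi> * ((real n - 1) * (1 - \<psi>) - b / L\<^sup>2)) / r\<^sup>2"
    using r L unfolding jet_def by (simp add: divide_simps) (simp add: algebra_simps eval_nat_numeral)
  also have "\<dots> > 0"
  proof (rule divide_pos_pos, rule add_pos_nonneg[OF add_nonneg_pos])
    have L1: "L \<le> L\<^sup>2" using L by (simp add: power2_eq_square)
    have bL: "b / L\<^sup>2 \<le> 1 / 4" using b L1 L by (simp add: divide_le_eq)
    have "b / (2 * L\<^sup>2) = b / L\<^sup>2 / 2" by simp
    then have "0 < real n - 1 - b / (2 * L\<^sup>2)" using bL n' by linarith
    moreover have "0 < b / L\<^sup>2" using b L by simp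
    ultimately show "0 < b / L\<^sup>2 * (real n - 1 - b / (2 * L\<^sup>2))" by (intro mult_pos_pos)
    have "1 * (3/4) \<le> (real n - 1) * (1 - \<psi>)" using n' \<psi>4 by (intro mult_mono) auto
    then show "0 \<le> 2 * \<psi> * ((real n - 1) * (1 - \<psi>) - b / L\<^sup>2)" using bL \<psi> by (intro mult_nonneg_nonneg) linarith+
    show "0 \<le> \<psi> * b * 2 / L ^ 3" using \<psi> b L by simp
  qed (use r in auto)
  finally show ?thesis .
qed

lemma v0_continuous: "continuous_on {0<..<1} (v0 n)"
  unfolding v0_def by (intro continuous_intros) auto

text \<open>The stationary function \<open>(1 - \<delta>) * v0 n r - \<eta>\<close> is a strict subsolution where it is positive. It is
  negative for small \<open>r\<close>, where it lies below \<open>v\<close> whatever \<open>v\<close> does near the corner.\<close>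

lemma a_priori_lower_bound:
  assumes n: "n \<ge> 2" and sol: "smooth_solution n vinit r1 t1 v"
    and \<delta>: "0 < \<delta>" "\<delta> < 1" and b: "b < r1" "- ln b \<ge> 2 * real n" and T: "0 < T" "T < t1"
    and init: "\<And>r. 0 < r \<Longrightarrow> r \<le> b \<Longrightarrow> (1 - \<delta>) * v0 n r \<le> v r 0"
    and side: "\<And>t. 0 \<le> t \<Longrightarrow> t \<le> T \<Longrightarrow> (1 - \<delta>) * v0 n b \<le> v b t"
    and rt: "0 < r" "r \<le> b" "0 \<le> t" "t \<le> T"
  shows "(1 - \<delta>) * v0 n r \<le> v r t"
proof (rule field_le_epsilon)
  fix \<eta> :: real assume \<eta>: "\<eta> > 0"
  have n': "real n - 1 \<ge> 1" using n by simp
  define V :: "real \<Rightarrow> real \<Rightarrow> real" where "V = (\<lambda>r t. (1 - \<delta>) * v0 n r - \<eta>)"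
  define a where "a = min r (exp (- ((real n - 1) / \<eta>)))"
  have "ln b < 0" using b(2) n' by linarith
  moreover have "0 < b" using rt by linarith
  ultimately have b1: "b < 1" "0 < b" by auto
  have a: "0 < a" "a \<le> r" using rt by (auto simp: a_def)
  have "a \<le> exp (- ((real n - 1) / \<eta>))" by (simp add: a_def)
  then have "ln a \<le> - ((real n - 1) / \<eta>)" using a(1) by (metis exp_gt_zero ln_exp ln_le_cancel_iff)
  then have "(real n - 1) / \<eta> \<le> - ln a" by simp
  moreover have "0 < (real n - 1) / \<eta>" using n' \<eta> by simp
  ultimately have lna: "real n - 1 \<le> \<eta> * (- ln a)" "- 4 * ln a > 0"
    using \<eta> by (simp add: divide_le_eq mult.commute, linarith)
  have "real n - 1 < \<eta> * (- 4 * ln a)" using lna(1) n' by (simp add: algebra_simps)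
  then have "v0 n a < \<eta>"
    unfolding v0_def using lna(2) by (simp only: pos_divide_less_eq)
  moreover have "v0 n a > 0" using v0_pos[OF n, of a] a rt b1 by auto
  moreover have "(1 - \<delta>) * v0 n a \<le> 1 * v0 n a" using \<delta> \<open>v0 n a > 0\<close> by (intro mult_right_mono) auto
  ultimately have "(1 - \<delta>) * v0 n a < \<eta>" by linarith
  then have Va: "V a t < 0" for t by (simp add: V_def)
  have pos: "v r t > 0" if "r \<in> {0<..b}" "t \<in> {0..T}" for r t
  proof (cases "t = 0")
    case True
    have "0 < (1 - \<delta>) * v0 n r" using that \<delta> b1 v0_pos[OF n, of r] by auto
    then show ?thesis using True init[of r] that by auto
  next
    case False
    then show ?thesis using sol that b T by (auto simp: smooth_solution_def)
  qed
  note c = smooth_solution_continuous[OF sol] and S = smooth_solution_solves[OF sol]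
  have "V r t < v r t"
  proof (rule strict_subsolution_below[where v=v and V=V and a=a and b=b and c=0 and d=T and n=n])
    show "solves_on n ({a<..<b} \<times> {0<..T}) v"
      using S a b T by (auto simp: solves_on_def)
    show "continuous_on ({a..b} \<times> {0..T}) (\<lambda>(r, t). v r t)"
      by (rule continuous_on_subset[OF c]) (use a b T in auto)
    have "continuous_on ({a..b} \<times> {0..T}) (\<lambda>p. v0 n (fst p))"
      by (rule continuous_on_compose2[OF v0_continuous]) (use a b1 in \<open>auto intro!: continuous_intros\<close>)
    then show "continuous_on ({a..b} \<times> {0..T}) (\<lambda>(r, t). V r t)"
      unfolding V_def case_prod_unfold by (intro continuous_intros)
    show "regular_at V r t" if "a < r" "r < b" for r t
      unfolding V_def using that a b1 by (intro F_op_v0(2)) auto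
    show "V a t < v a t \<and> V b t < v b t" if "0 \<le> t" "t \<le> T" for t
      using Va[of t] pos[of a t] side[of t] \<eta> that a rt by (auto simp: V_def)
    show "V r 0 < v r 0" if "a \<le> r" "r \<le> b" for r
      using init[of r] \<eta> that a by (auto simp: V_def)
    show "deriv (V r) t < F_op n (\<lambda>r'. V r' t) r"
      if "a < r" "r < b" "0 < t" "t \<le> T" "V r t = v r t" for r t
    proof -
      have "deriv (V r) t = 0" unfolding V_def by simp
      moreover have "F_op n (\<lambda>r'. V r' t) r > 0"
        unfolding V_def
      proof (rule F_op_v0_pos[OF n])
        have "ln r \<le> ln b" using that a by simp
        then show "- ln r \<ge> 2 * real n" using b by simp
        show "0 < (1 - \<delta>) * v0 n r - \<eta>" using pos[of r t] that a by (simp add: V_def)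
      qed (use \<delta> \<eta> that a in auto)
      ultimately show ?thesis by simp
    qed
  qed (use rt a in auto)
  then show "(1 - \<delta>) * v0 n r \<le> v r t + \<eta>" by (simp add: V_def)
qed

section \<open>An upper bound near the corner\<close>

lemma jet_quadratic:
  "r > 0 \<Longrightarrow> jet n r (A + B * r\<^sup>2) (B * (2 * r)) (2 * B) =
    4 * B * (real n - 1) * (1 - A) - 2 * real n * B\<^sup>2 * r\<^sup>2 - 2 * (real n - 1) * A * (A - 1) / r\<^sup>2"
  unfolding jet_def by (simp add: divide_simps) (simp add: algebra_simps eval_nat_numeral)

text \<open>The comparison function \<open>1 + s + r\<^sup>2 / (t - s)\<close> is infinite at time \<open>s > 0\<close> away from the pole and exceeds
  \<open>1\<close> at the pole, and \<open>v\<close> is smooth at time \<open>s\<close>.\<close>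

lemma universal_upper_bound:
  assumes n: "n \<ge> 2" and sol: "smooth_solution n vinit r1 t1 v" and r1: "r1 > 0"
    and b: "b < r1" and T: "T < t1"
    and side: "\<And>t. 0 \<le> t \<Longrightarrow> t \<le> T \<Longrightarrow> v b t \<le> 1"
    and rt: "0 < r" "r \<le> b" "0 < t" "t \<le> T"
  shows "v r t \<le> 1 + r\<^sup>2 / t"
proof -
  note c = smooth_solution_continuous[OF sol] and S = smooth_solution_solves[OF sol]
  have key: "v r t \<le> 1 + s + r\<^sup>2 / (t - s)" if s: "0 < s" "s < t" for s
  proof -
    obtain a0 where a0: "a0 > 0" "a0 < r1" "\<And>r t. r \<in> {0..a0} \<Longrightarrow> t \<in> {s..T} \<Longrightarrow> \<bar>v r t - 1\<bar> < s"
      using pole_limit[OF sol r1 s(1) T s(1)] by blast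
    define a where "a = min a0 r"
    have a: "0 < a" "a \<le> r" "a \<le> a0" using a0 rt by (auto simp: a_def)
    have sub: "{a..b} \<times> {s..T} \<subseteq> {0<..r1} \<times> {0..<t1}" using a b s T by auto
    obtain M0 where M0: "\<And>r t. r \<in> {a..b} \<Longrightarrow> t \<in> {s..T} \<Longrightarrow> \<bar>v r t\<bar> \<le> M0"
      using bounded_on_rectangle[OF continuous_on_subset[OF c sub]] by auto
    define M where "M = max 1 M0"
    have M: "M > 0" "\<And>r t. r \<in> {a..b} \<Longrightarrow> t \<in> {s..T} \<Longrightarrow> v r t \<le> M"
      using abs_le_D1[OF M0] by (auto simp: M_def intro: max.coboundedI2)
    \<comment> \<open>at this time, shortly after the blow-up time of the barrier, the barrier exceeds \<open>M\<close> for \<open>r \<ge> a\<close>\<close>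
    define s' where "s' = s + min ((t - s) / 2) (a\<^sup>2 / M)"
    have s': "s < s'" "s' < t" "s' - s \<le> a\<^sup>2 / M"
    proof -
      have m: "min ((t - s) / 2) (a\<^sup>2 / M) \<le> (t - s) / 2" "min ((t - s) / 2) (a\<^sup>2 / M) \<le> a\<^sup>2 / M"
        by (rule min.cobounded1, rule min.cobounded2)
      have "0 < min ((t - s) / 2) (a\<^sup>2 / M)" using s a M by simp
      then show "s < s'" "s' < t" "s' - s \<le> a\<^sup>2 / M" using m s by (simp_all add: s'_def)
    qed
    define V where "V = (\<lambda>r t. (1 + s) + 1 / (t - s) * r\<^sup>2)"
    have "v r t < V r t"
    proof (rule strict_supersolution_above[where v=v and V=V and a=a and b=b and c=s' and d=T and n=n])
      show "solves_on n ({a<..<b} \<times> {s'<..T}) v"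
        using S a b T s s' by (auto simp: solves_on_def)
      show "continuous_on ({a..b} \<times> {s'..T}) (\<lambda>(r, t). v r t)"
        by (rule continuous_on_subset[OF c]) (use a b T s s' in auto)
      show "continuous_on ({a..b} \<times> {s'..T}) (\<lambda>(r, t). V r t)"
        unfolding V_def case_prod_unfold by (intro continuous_intros) (use s' in auto)
      have d: "regular_at V r t" "F_op n (\<lambda>r'. V r' t) r < deriv (V r) t"
        if rt': "a < r" "r < b" "s' < t" "t \<le> T" for r t
      proof -
        note dd = derivatives_of_barrier[of UNIV r V t "\<lambda>r. 1 / (t - s) * (2 * r)" "2 * (1 / (t - s))" "- (1 / (t - s))\<^sup>2 * r\<^sup>2"]
        have ts: "t - s > 0" using rt' s' by simp
        have p: "regular_at V r t" "deriv (V r) t = - (1 / (t - s))\<^sup>2 * r\<^sup>2"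
          "F_op n (\<lambda>r'. V r' t) r = jet n r (V r t) (1 / (t - s) * (2 * r)) (2 * (1 / (t - s)))"
        proof -
          have q: "((\<lambda>r. A + B * r\<^sup>2) has_real_derivative B * (2 * x)) (at x)"
            "((\<lambda>r. B * (2 * r)) has_real_derivative 2 * B) (at x)" for A B x :: real
            by (auto intro!: derivative_eq_intros)
          have 1: "((\<lambda>r'. V r' t) has_real_derivative 1 / (t - s) * (2 * x)) (at x)" for x
            using q(1)[of "1 + s" "1 / (t - s)" x] unfolding V_def .
          have 2: "((\<lambda>r. 1 / (t - s) * (2 * r)) has_real_derivative 2 * (1 / (t - s))) (at r)"
            by (rule q(2))
          have 3: "(V r has_real_derivative - (1 / (t - s))\<^sup>2 * r\<^sup>2) (at t)"
            unfolding V_def using ts by (auto intro!: derivative_eq_intros simp: power2_eq_square)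
          show "regular_at V r t" "deriv (V r) t = - (1 / (t - s))\<^sup>2 * r\<^sup>2"
            "F_op n (\<lambda>r'. V r' t) r = jet n r (V r t) (1 / (t - s) * (2 * r)) (2 * (1 / (t - s)))"
            using dd[OF _ _ 1 2 3] by auto
        qed
        show "regular_at V r t" by fact
        have r0: "r > 0" using rt' a by simp
        define B where "B = 1 / (t - s)"
        have B: "B > 0" using ts by (simp add: B_def)
        have "F_op n (\<lambda>r'. V r' t) r = jet n r ((1 + s) + B * r\<^sup>2) (B * (2 * r)) (2 * B)"
          unfolding p(3) by (simp add: V_def B_def)
        also have "\<dots> = 4 * B * (real n - 1) * (1 - (1 + s)) - 2 * real n * B\<^sup>2 * r\<^sup>2
             - 2 * (real n - 1) * (1 + s) * ((1 + s) - 1) / r\<^sup>2"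
          by (rule jet_quadratic[OF r0])
        also have "\<dots> < - B\<^sup>2 * r\<^sup>2"
        proof -
          have "4 * B * (real n - 1) * (1 - (1 + s)) \<le> 0" using B s n by (simp add: mult_nonneg_nonpos)
          moreover have "0 \<le> 2 * (real n - 1) * (1 + s) * ((1 + s) - 1) / r\<^sup>2" using s n r0 by simp
          moreover have "1 * (B\<^sup>2 * r\<^sup>2) < 2 * real n * (B\<^sup>2 * r\<^sup>2)"
            using n B r0 by (intro mult_strict_right_mono) auto
          ultimately show ?thesis by linarith
        qed
        finally show "F_op n (\<lambda>r'. V r' t) r < deriv (V r) t" by (simp add: p(2) B_def)
      qed
      show "regular_at V r t" if "a < r" "r < b" "s' < t" "t \<le> T" for r t by (rule d) fact+
      show "F_op n (\<lambda>r'. V r' t) r < deriv (V r) t" if "a < r" "r < b" "s' < t" "t \<le> T" for r t by (rule d) fact+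
      show "v a t < V a t \<and> v b t < V b t" if "s' \<le> t" "t \<le> T" for t
      proof -
        have "0 < 1 / (t - s) * a\<^sup>2" "0 < 1 / (t - s) * b\<^sup>2" using that s' a rt by auto
        moreover have "\<bar>v a t - 1\<bar> < s" using a0(3)[of a t] a s' that by auto
        ultimately show ?thesis using side[of t] s that s' unfolding V_def by auto
      qed
      show "v r s' < V r s'" if "a \<le> r" "r \<le> b" for r
      proof -
        have "M * (s' - s) \<le> a\<^sup>2" using s' M by (simp add: pos_le_divide_eq mult.commute)
        also have "\<dots> \<le> r\<^sup>2" using that a by (intro power_mono) auto
        finally have "M \<le> r\<^sup>2 / (s' - s)" using s' by (simp add: pos_le_divide_eq)
        then show ?thesis using M(2)[of r s'] that s' rt s by (simp add: V_def)
      qed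
    qed (use a rt s' in auto)
    then show ?thesis by (simp add: V_def)
  qed
  have "((\<lambda>s. 1 + s + r\<^sup>2 / (t - s)) \<longlongrightarrow> 1 + 0 + r\<^sup>2 / (t - 0)) (at_right 0)"
    using rt by (intro tendsto_intros) auto
  moreover have "\<forall>\<^sub>F s in at_right 0. v r t \<le> 1 + s + r\<^sup>2 / (t - s)"
    using eventually_at_right_real[OF rt(3)] by eventually_elim (rule key, auto)
  ultimately show ?thesis by (auto dest: tendsto_lowerbound)
qed


text \<open>In the variables \<open>z = sqrt v\<close> and \<open>x = r\<^sup>2\<close> the first order terms with coefficient $v$ cancel. What remains
  of the quadratic part is $4xz^2z_{xx}$ and an absorption term of favourable sign, so that functions
  linear in $x$ see no diffusion.\<close>

lemma jet_square:
  assumes "r > 0"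
  shows "jet n r (Z\<^sup>2) (4 * r * Z * Zx) (4 * Z * Zx + 8 * r\<^sup>2 * Zx\<^sup>2 + 8 * r\<^sup>2 * Z * Zxx) =
    2 * Z * (4 * r\<^sup>2 * Z\<^sup>2 * Zxx + 2 * (real n - 1) * Zx + (real n - 1) / r\<^sup>2 * Z * (1 - Z\<^sup>2))"
  using assms unfolding jet_def
  by (simp add: divide_simps) (simp add: algebra_simps eval_nat_numeral)

text \<open>A smooth convex ramp, with limit \<open>0\<close> at the left and asymptotic to \<open>2 * y\<close> at the right. It is the
  positive solution \<open>u\<close> of \<open>u - 1 / u = 2 * y\<close>. Its second derivative is so small compared with the first that
  \<open>(1 + ramp y)\<^sup>2\<close> times it is at most four times the first: the diffusion $z^2z_{xx}$ then
  costs only a bounded speed.\<close>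

definition ramp :: "real \<Rightarrow> real" where
  "ramp y = y + sqrt (1 + y\<^sup>2)"

lemma ramp_facts:
  shows ramp_pos: "ramp y > 0" and ramp_ge: "2 * y \<le> ramp y" and ramp_le_1: "y \<le> 0 \<Longrightarrow> ramp y \<le> 1"
    and ramp_identity: "(1 + ramp y)\<^sup>2 = ramp y * (2 * sqrt (1 + y\<^sup>2) + 2)"
proof -
  let ?w = "sqrt (1 + y\<^sup>2)"
  have w: "?w > \<bar>y\<bar>" "?w \<ge> 1" by (auto intro: real_less_rsqrt)
  then show "ramp y > 0" "2 * y \<le> ramp y" by (auto simp: ramp_def)
  have w2: "?w\<^sup>2 = 1 + y\<^sup>2" by simp
  show "ramp y \<le> 1" if "y \<le> 0"
  proof -
    have "1 + y\<^sup>2 \<le> (1 - y)\<^sup>2" using that by (simp add: power2_eq_square algebra_simps)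
    then have "?w \<le> 1 - y" by (rule real_le_lsqrt[rotated]) (use that in auto)
    then show ?thesis by (simp add: ramp_def)
  qed
  show "(1 + ramp y)\<^sup>2 = ramp y * (2 * ?w + 2)"
    using w2 unfolding ramp_def by (simp add: power2_eq_square algebra_simps)
qed

lemma ramp_derivatives:
  "(ramp has_real_derivative ramp y / sqrt (1 + y\<^sup>2)) (at y)"
  "((\<lambda>y. ramp y / sqrt (1 + y\<^sup>2)) has_real_derivative 1 / sqrt (1 + y\<^sup>2) ^ 3) (at y)"
proof -
  have pos: "1 + x\<^sup>2 > 0" for x :: real by (rule add_pos_nonneg) auto
  have w: "((\<lambda>y. sqrt (1 + y\<^sup>2)) has_real_derivative y / sqrt (1 + y\<^sup>2)) (at y)" for y :: real
    using pos[of y] by (auto intro!: derivative_eq_intros simp: field_simps)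
  have w0: "sqrt (1 + y\<^sup>2) > 0" using pos[of y] by simp
  show d: "(ramp has_real_derivative ramp y / sqrt (1 + y\<^sup>2)) (at y)" for y
    unfolding ramp_def using pos[of y] by (auto intro!: derivative_eq_intros w simp: field_simps)
  have s: "sqrt (1 + y\<^sup>2) * sqrt (1 + y\<^sup>2) = 1 + y\<^sup>2" using pos[of y] by simp
  show "((\<lambda>y. ramp y / sqrt (1 + y\<^sup>2)) has_real_derivative 1 / sqrt (1 + y\<^sup>2) ^ 3) (at y)"
  proof (rule DERIV_cong[OF DERIV_divide[OF d w]])
    let ?w = "sqrt (1 + y\<^sup>2)"
    have "ramp y * (?w - y) = 1" using s by (simp add: ramp_def algebra_simps power2_eq_square)
    then have "ramp y / ?w * ?w - ramp y * (y / ?w) = 1 / ?w"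
      using w0 by (simp add: divide_simps algebra_simps)
    then show "(ramp y / ?w * ?w - ramp y * (y / ?w)) / (?w * ?w) = 1 / ?w ^ 3"
      by (simp add: power3_eq_cube)
  qed (use w0 in auto)
qed

text \<open>The barrier on \<open>x = r\<^sup>2 \<ge> l\<close>, written in terms of \<open>p = (t / l) powr (1 / 4)\<close>. Its foot is at
  \<open>x = l * (3/2 + 80 * p)\<close> and its slope is of order $1/(lp^3)$, that is $t^{-3/4}$. With this slope the ramp
  reaches \<open>1 / p\<^sup>2\<close>, the size of the universal bound, at a distance of order \<open>l * p\<close>, and the foot has to
  move with speed of order $1/p^3$, which is integrable. The exponential factor absorbs the linear
  growth term on \<open>x \<ge> l\<close>.\<close>

definition front_p :: "real \<Rightarrow> real \<Rightarrow> real" where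
  "front_p l t = sqrt (sqrt (t / l))"

definition front_y :: "real \<Rightarrow> real \<Rightarrow> real \<Rightarrow> real" where
  "front_y l x t = 8 * (l * (3/2 + 80 * front_p l t) - x) / (l * front_p l t ^ 3)"

definition front_Z :: "nat \<Rightarrow> real \<Rightarrow> real \<Rightarrow> real \<Rightarrow> real" where
  "front_Z n l x t = exp ((real n - 1) / l * t) / 8 * (1 + ramp (front_y l x t))"

lemma front_p_derivative:
  assumes "l > 0" "t > 0"
  shows "front_p l t > 0" "front_p l t ^ 4 = t / l"
    "(front_p l has_real_derivative 1 / (4 * l * front_p l t ^ 3)) (at t)"
proof -
  show p: "front_p l t > 0" using assms by (simp add: front_p_def)
  have "front_p l t ^ 4 = ((front_p l t)\<^sup>2)\<^sup>2" by (simp flip: power_mult)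
  then show "front_p l t ^ 4 = t / l" using assms by (simp add: front_p_def)
  have D: "(front_p l has_real_derivative (1 / l * (inverse (sqrt (t / l)) / 2)) * (inverse (sqrt (sqrt (t / l))) / 2)) (at t)"
    unfolding front_p_def using assms
    by (auto intro!: derivative_eq_intros simp: field_simps)
  have q: "sqrt (t / l) = (front_p l t)\<^sup>2" "sqrt ((front_p l t)\<^sup>2) = front_p l t"
    using assms p by (simp_all add: front_p_def)
  show "(front_p l has_real_derivative 1 / (4 * l * front_p l t ^ 3)) (at t)"
    by (rule DERIV_cong[OF D]) (use p assms in \<open>simp only: q, simp add: field_simps eval_nat_numeral\<close>)
qed

lemma front_barrier_derivatives:
  fixes l t r :: real and n :: nat
  assumes l: "l > 0" and t: "t > 0" and r: "r > 0"
  defines "p \<equiv> front_p l t" and "y \<equiv> front_y l (r\<^sup>2) t" and "e \<equiv> exp ((real n - 1) / l * t)"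
    and "Z \<equiv> front_Z n l (r\<^sup>2) t"
  defines "w \<equiv> sqrt (1 + y\<^sup>2)" and "\<sigma> \<equiv> 8 / (l * p ^ 3)"
  defines "Zx \<equiv> - (e / 8 * \<sigma> * (ramp y / w))" and "Zxx \<equiv> e / 8 * \<sigma>\<^sup>2 * (1 / w ^ 3)"
    and "Zt \<equiv> (real n - 1) / l * Z + e / 8 * (ramp y / w) * (20 * \<sigma> / p ^ 3 - 3 * y / (4 * t))"
  shows "regular_at (\<lambda>r t. (front_Z n l (r\<^sup>2) t)\<^sup>2) r t"
    "deriv (\<lambda>t. (front_Z n l (r\<^sup>2) t)\<^sup>2) t = 2 * Z * Zt"
    "F_op n (\<lambda>r. (front_Z n l (r\<^sup>2) t)\<^sup>2) r =
      2 * Z * (4 * r\<^sup>2 * Z\<^sup>2 * Zxx + 2 * (real n - 1) * Zx + (real n - 1) / r\<^sup>2 * Z * (1 - Z\<^sup>2))"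
proof -
  have p: "p > 0" "p ^ 4 = t / l" "(front_p l has_real_derivative 1 / (4 * l * p ^ 3)) (at t)"
    using front_p_derivative[OF l t] by (simp_all add: p_def)
  have \<sigma>: "\<sigma> > 0" using l p by (simp add: \<sigma>_def)
  have yx: "((\<lambda>r. front_y l (r\<^sup>2) t) has_real_derivative - \<sigma> * (2 * x)) (at x)" for x
    unfolding front_y_def \<sigma>_def p_def[symmetric] using l p
    by (auto intro!: derivative_eq_intros simp: field_simps)
  define Z' where "Z' = (\<lambda>x. - (e / 8 * \<sigma> * (ramp (front_y l (x\<^sup>2) t) / sqrt (1 + (front_y l (x\<^sup>2) t)\<^sup>2))))"
  have Zr: "((\<lambda>r. front_Z n l (r\<^sup>2) t) has_real_derivative Z' x * (2 * x)) (at x)" for x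
  proof -
    have "((\<lambda>r. ramp (front_y l (r\<^sup>2) t)) has_real_derivative
        ramp (front_y l (x\<^sup>2) t) / sqrt (1 + (front_y l (x\<^sup>2) t)\<^sup>2) * (- \<sigma> * (2 * x))) (at x)"
      by (rule DERIV_chain2[OF ramp_derivatives(1) yx])
    then show ?thesis unfolding front_Z_def e_def[symmetric] Z'_def
      by (rule DERIV_cong[OF DERIV_cmult[OF DERIV_add[OF DERIV_const]]]) (simp add: field_simps)
  qed
  have Z'r: "(Z' has_real_derivative Zxx * (2 * r)) (at r)"
  proof -
    have "((\<lambda>r. ramp (front_y l (r\<^sup>2) t) / sqrt (1 + (front_y l (r\<^sup>2) t)\<^sup>2)) has_real_derivative
        1 / w ^ 3 * (- \<sigma> * (2 * r))) (at r)"
      unfolding w_def y_def by (rule DERIV_chain2[OF ramp_derivatives(2) yx])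
    then show ?thesis unfolding Z'_def Zxx_def
      by (rule DERIV_cong[OF DERIV_minus[OF DERIV_cmult]]) (simp add: field_simps power2_eq_square)
  qed
  have Z'r0: "Z' r = Zx" by (simp add: Z'_def Zx_def y_def w_def)
  have 1: "((\<lambda>r. (front_Z n l (r\<^sup>2) t)\<^sup>2) has_real_derivative 4 * x * front_Z n l (x\<^sup>2) t * Z' x) (at x)" for x
    by (rule DERIV_cong[OF DERIV_power[OF Zr]]) simp
  have 2: "((\<lambda>x. 4 * x * front_Z n l (x\<^sup>2) t * Z' x) has_real_derivative
      4 * Z * Zx + 8 * r\<^sup>2 * Zx\<^sup>2 + 8 * r\<^sup>2 * Z * Zxx) (at r)"
    by (rule DERIV_cong[OF DERIV_mult[OF DERIV_mult[OF DERIV_cmult[OF DERIV_ident] Zr] Z'r]])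
       (simp add: Z'r0 Z_def algebra_simps power2_eq_square)
  have Yt: "((\<lambda>t. front_y l (r\<^sup>2) t) has_real_derivative 20 * \<sigma> / p ^ 3 - 3 * y / (4 * t)) (at t)"
  proof -
    define a where "a = 8 * l * 80"
    define c where "c = 8 * (l * (3/2) - r\<^sup>2)"
    have "front_y l (r\<^sup>2) = (\<lambda>t. (c + a * front_p l t) / (l * front_p l t ^ 3))"
      by (simp add: front_y_def a_def c_def fun_eq_iff algebra_simps)
    moreover have "((\<lambda>t. (c + a * front_p l t) / (l * front_p l t ^ 3)) has_real_derivative
       (a * (1 / (4 * l * p ^ 3)) * (l * p ^ 3) - (c + a * p) * (l * (3 * p\<^sup>2 * (1 / (4 * l * p ^ 3))))) / (l * p ^ 3 * (l * p ^ 3))) (at t)"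
      using l p(1) unfolding p_def
      by (auto intro!: derivative_eq_intros p(3)[unfolded p_def] simp: power2_eq_square)
    moreover have "(a * (1 / (4 * l * p ^ 3)) * (l * p ^ 3) - (c + a * p) * (l * (3 * p\<^sup>2 * (1 / (4 * l * p ^ 3))))) / (l * p ^ 3 * (l * p ^ 3))
       = 20 * \<sigma> / p ^ 3 - 3 * y / (4 * t)"
    proof -
      have t4: "t = l * p ^ 4" using p(2) l by simp
      have y': "y = (c + a * p) / (l * p ^ 3)"
        by (simp add: y_def front_y_def p_def[symmetric] a_def c_def algebra_simps)
      show ?thesis unfolding y' \<sigma>_def t4 a_def using l p(1)
        by (simp add: divide_simps) (simp add: algebra_simps eval_nat_numeral)
    qed
    ultimately show ?thesis by simp
  qed
  have Zt: "((\<lambda>t. front_Z n l (r\<^sup>2) t) has_real_derivative Zt) (at t)"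
  proof -
    have ramp_t: "((\<lambda>t. 1 + ramp (front_y l (r\<^sup>2) t)) has_real_derivative
        0 + ramp y / w * (20 * \<sigma> / p ^ 3 - 3 * y / (4 * t))) (at t)"
      unfolding w_def y_def
      by (rule DERIV_add[OF DERIV_const DERIV_chain2[OF ramp_derivatives(1) Yt[unfolded y_def]]])
    have "((\<lambda>t. exp ((real n - 1) / l * t) / 8) has_real_derivative e * ((real n - 1) / l) / 8) (at t)"
      unfolding e_def by (rule DERIV_cdivide, rule DERIV_chain2[OF DERIV_exp], rule DERIV_cmult_Id)
    from DERIV_mult[OF this ramp_t] show ?thesis unfolding front_Z_def
      by (rule DERIV_cong)
         (simp only: Zt_def Z_def front_Z_def e_def[symmetric] y_def[symmetric],
          simp add: algebra_simps add_divide_distrib diff_divide_distrib)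
  qed
  have 3: "((\<lambda>t. (front_Z n l (r\<^sup>2) t)\<^sup>2) has_real_derivative 2 * Z * Zt) (at t)"
    unfolding Z_def by (rule DERIV_cong[OF DERIV_power[OF Zt]]) simp
  note d = derivatives_of_barrier[of UNIV r "\<lambda>r t. (front_Z n l (r\<^sup>2) t)\<^sup>2" t, OF _ _ 1 2 3]
  show "regular_at (\<lambda>r t. (front_Z n l (r\<^sup>2) t)\<^sup>2) r t"
    "deriv (\<lambda>t. (front_Z n l (r\<^sup>2) t)\<^sup>2) t = 2 * Z * Zt"
    using d by simp_all
  show "F_op n (\<lambda>r. (front_Z n l (r\<^sup>2) t)\<^sup>2) r =
      2 * Z * (4 * r\<^sup>2 * Z\<^sup>2 * Zxx + 2 * (real n - 1) * Zx + (real n - 1) / r\<^sup>2 * Z * (1 - Z\<^sup>2))"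
    using d(5) jet_square[OF r, of n Z Zx Zxx] by (simp add: Z'r0 Z_def)
qed

lemma front_Z_lower:
  assumes l: "l > 0" and t: "t > 0" and n: "n \<ge> 1"
  shows "front_Z n l x t > 1/8" "front_Z n l x t \<ge> front_y l x t / 4"
proof -
  have e: "exp ((real n - 1) / l * t) \<ge> 1" using assms by simp
  have u: "ramp (front_y l x t) > 0" "2 * front_y l x t \<le> ramp (front_y l x t)" by (rule ramp_pos, rule ramp_ge)
  have "1 * (1 + ramp (front_y l x t)) \<le> exp ((real n - 1) / l * t) * (1 + ramp (front_y l x t))"
    using e u by (intro mult_right_mono) auto
  then have "front_Z n l x t \<ge> (1 + ramp (front_y l x t)) / 8" by (simp add: front_Z_def)
  then have Z: "1 + ramp (front_y l x t) \<le> 8 * front_Z n l x t" by simp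
  show "front_Z n l x t > 1/8" using Z u(1) by simp
  show "front_Z n l x t \<ge> front_y l x t / 4" using Z u(2) by simp
qed

text \<open>The moving foot contributes \<open>20 * \<sigma> / p ^ 3\<close> to the time derivative of \<open>y\<close>. This beats the flattening of
  the ramp, which costs \<open>\<sigma> / p ^ 3\<close> because \<open>y \<le> 8 / p\<^sup>2\<close> wherever the universal bound holds, and
  the diffusion, which costs \<open>17 * \<sigma> / p ^ 3\<close>.\<close>

lemma front_barrier_super:
  fixes l t r :: real and n :: nat
  assumes n: "n \<ge> 2" and l: "l > 0" and t: "0 < t" "front_p l t \<le> 1/320" "(real n - 1) / l * t \<le> 1/2"
    and r: "r > 0" "r\<^sup>2 \<ge> l"
    and universal: "(front_Z n l (r\<^sup>2) t)\<^sup>2 \<le> 1 + r\<^sup>2 / t"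
  shows "F_op n (\<lambda>r. (front_Z n l (r\<^sup>2) t)\<^sup>2) r < deriv (\<lambda>t. (front_Z n l (r\<^sup>2) t)\<^sup>2) t"
proof -
  define p where "p = front_p l t"
  define y where "y = front_y l (r\<^sup>2) t"
  define e where "e = exp ((real n - 1) / l * t)"
  define Z where "Z = front_Z n l (r\<^sup>2) t"
  define w where "w = sqrt (1 + y\<^sup>2)"
  define \<sigma> where "\<sigma> = 8 / (l * p ^ 3)"
  define u where "u = ramp y"
  note d = front_barrier_derivatives(2,3)[OF l t(1) r(1), of n, folded p_def y_def e_def Z_def, folded w_def \<sigma>_def u_def]
  have p: "p > 0" "p ^ 4 = t / l" "p \<le> 1/320" using front_p_derivative[OF l t(1)] t(2) by (simp_all add: p_def)
  have n': "real n - 1 \<ge> 1" using n by simp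
  have e: "1 \<le> e" "e \<le> 2"
  proof -
    show "1 \<le> e" using n' l t by (simp add: e_def)
    have "(exp (1/2::real))\<^sup>2 = exp 1" by (simp add: power2_eq_square flip: exp_add)
    also have "\<dots> \<le> 2\<^sup>2" using e_less_272 by simp
    finally have "exp (1/2::real) \<le> 2" by (rule power2_le_imp_le) simp
    moreover have "e \<le> exp (1/2)" using t(3) by (simp add: e_def)
    ultimately show "e \<le> 2" by simp
  qed
  have \<sigma>: "\<sigma> > 0" using l p by (simp add: \<sigma>_def)
  have u: "u > 0" "2 * y \<le> u" "(1 + u)\<^sup>2 = u * (2 * w + 2)"
    using ramp_pos ramp_ge ramp_identity by (simp_all add: u_def w_def)
  have w: "w \<ge> 1" "\<bar>y\<bar> \<le> w"
    by (auto simp: w_def intro: real_le_rsqrt)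
  have Z: "Z = e / 8 * (1 + u)" by (simp add: Z_def front_Z_def e_def u_def y_def)
  have Zpos: "Z > 0" unfolding Z using e u by (intro mult_pos_pos divide_pos_pos) auto
  have Zy: "y / 4 \<le> Z" unfolding y_def Z_def by (rule front_Z_lower) (use l t n in auto)
  define X where "X = l * (3/2 + 80 * p)"
  have X: "X \<le> 2 * l" using l p by (simp add: X_def)
  have yX: "r\<^sup>2 = X - y / \<sigma>"
    unfolding y_def front_y_def \<sigma>_def X_def p_def[symmetric] using l p by (simp add: field_simps)
  \<comment> \<open>the height of the ramp is limited by the universal bound\<close>
  have A: "y \<le> 8 / p\<^sup>2"
  proof (cases "y \<le> 0")
    case True
    then show ?thesis using p by (smt (verit) divide_pos_pos zero_less_power)
  next
    case False
    have "r\<^sup>2 \<le> 2 * l" using yX X False \<sigma> by (smt (verit) divide_pos_pos)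
    then have "r\<^sup>2 / t \<le> 2 * l / t" using t by (intro divide_right_mono) auto
    also have "\<dots> = 2 / p ^ 4" using p l t by simp
    finally have "Z\<^sup>2 \<le> 1 + 2 / p ^ 4" using universal by (simp add: Z_def)
    also have "\<dots> \<le> 4 / p ^ 4"
    proof -
      have "p ^ 4 \<le> 1" using p by (intro power_le_one) auto
      then show ?thesis using p(1) by (simp add: divide_simps)
    qed
    finally have "Z\<^sup>2 \<le> (2 / p\<^sup>2)\<^sup>2" by (simp add: power_divide flip: power_mult)
    then have "Z \<le> 2 / p\<^sup>2" by (rule power2_le_imp_le) (use p in auto)
    then show ?thesis using Zy by (simp; linarith)
  qed
  have p3: "1 \<le> 1 / p ^ 3"
  proof -
    have "p ^ 3 \<le> 1" using p by (intro power_le_one) auto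
    then show ?thesis using p by simp
  qed
  have main: "4 * r\<^sup>2 * Z\<^sup>2 * (e / 8 * \<sigma>\<^sup>2 * (1 / w ^ 3)) < e / 8 * (u / w) * (20 * \<sigma> / p ^ 3 - 3 * y / (4 * t))"
  proof -
    have "3 * y / (4 * t) \<le> \<sigma> * (1 / p ^ 3)"
    proof -
      have "3 * y / (4 * t) \<le> 3 * (8 / p\<^sup>2) / (4 * t)" using A t by (intro divide_right_mono) auto
      also have "\<dots> = 6 / p\<^sup>2 / (l * p ^ 4)" using p l by simp
      also have "\<dots> \<le> 8 / p\<^sup>2 / (l * p ^ 4)" using p(1) l by (intro divide_right_mono) auto
      also have "\<dots> = \<sigma> * (1 / p ^ 3)" using p l by (simp add: \<sigma>_def eval_nat_numeral)
      finally show ?thesis .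
    qed
    then have lhs: "\<sigma> * (19 / p ^ 3) \<le> 20 * \<sigma> / p ^ 3 - 3 * y / (4 * t)" by (simp add: field_simps)
    \<comment> \<open>the coefficient \<open>r\<^sup>2\<close> of the diffusion is unbounded, but the convexity of the ramp decays with the
      distance from the foot\<close>
    have "r\<^sup>2 * \<sigma> / w = X * \<sigma> / w - y / w" using \<sigma> w by (simp add: yX field_simps)
    also have "X * \<sigma> / w \<le> X * \<sigma> / 1" using w \<sigma> l p by (intro divide_left_mono) (auto simp: X_def)
    also have "X * \<sigma> / 1 \<le> 2 * l * \<sigma>" using X \<sigma> by simp
    also have "2 * l * \<sigma> = 16 / p ^ 3" using l by (simp add: \<sigma>_def)
    finally have "r\<^sup>2 * \<sigma> / w \<le> 16 / p ^ 3 - y / w" by simp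
    moreover have "(- 1) * w \<le> y" using w by linarith
    then have "- 1 \<le> y / w" using w by (simp only: pos_le_divide_eq)
    ultimately have xs: "r\<^sup>2 * \<sigma> / w \<le> 17 / p ^ 3" using p3 by simp
    have "4 * r\<^sup>2 * Z\<^sup>2 * (e / 8 * \<sigma>\<^sup>2 * (1 / w ^ 3))
        = e / 8 * (u / w) * \<sigma> * (e\<^sup>2 * (r\<^sup>2 * \<sigma> / w) * ((2 * w + 2) / w) / 16)"
    proof -
      have Z2: "Z\<^sup>2 = e\<^sup>2 / 64 * (u * (2 * w + 2))" by (simp add: Z power_mult_distrib u(3) power_divide)
      have "4 * r\<^sup>2 * (e\<^sup>2 / 64 * (u * k)) * (e / 8 * \<sigma>\<^sup>2 * (1 / w ^ 3))
        = e / 8 * (u / w) * \<sigma> * (e\<^sup>2 * (r\<^sup>2 * \<sigma> / w) * (k / w) / 16)" for k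
        using w by (simp add: field_simps eval_nat_numeral)
      then show ?thesis by (simp only: Z2)
    qed
    also have "\<dots> \<le> e / 8 * (u / w) * \<sigma> * (4 * (17 / p ^ 3) * 4 / 16)"
    proof (intro mult_left_mono divide_right_mono mult_mono)
      show "e\<^sup>2 \<le> 4" using power_mono[OF e(2), of 2] e(1) by simp
      show "(2 * w + 2) / w \<le> 4" using w by (simp add: divide_le_eq)
    qed (use e u w \<sigma> xs p in auto)
    also have "\<dots> < e / 8 * (u / w) * \<sigma> * (19 / p ^ 3)"
      using e u w \<sigma> p by (intro mult_strict_left_mono divide_strict_right_mono) (auto simp: divide_strict_right_mono)
    also have "\<dots> \<le> e / 8 * (u / w) * (20 * \<sigma> / p ^ 3 - 3 * y / (4 * t))"
      using mult_left_mono[OF lhs, of "e / 8 * (u / w)"] e u w by simp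
    finally show ?thesis .
  qed
  have "(real n - 1) / r\<^sup>2 * Z * (1 - Z\<^sup>2) \<le> (real n - 1) / l * Z"
  proof -
    have "(real n - 1) / r\<^sup>2 * Z * (1 - Z\<^sup>2) \<le> (real n - 1) / r\<^sup>2 * Z * 1"
      using n' Zpos by (intro mult_left_mono) auto
    also have "\<dots> \<le> (real n - 1) / l * Z"
      using n' Zpos r l by (auto intro!: mult_right_mono divide_left_mono mult_pos_pos)
    finally show ?thesis .
  qed
  moreover have "2 * (real n - 1) * - (e / 8 * \<sigma> * (u / w)) \<le> 0"
    using n' e \<sigma> u w by (intro mult_nonneg_nonpos) auto
  ultimately have "4 * r\<^sup>2 * Z\<^sup>2 * (e / 8 * \<sigma>\<^sup>2 * (1 / w ^ 3)) + 2 * (real n - 1) * - (e / 8 * \<sigma> * (u / w))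
       + (real n - 1) / r\<^sup>2 * Z * (1 - Z\<^sup>2)
      < (real n - 1) / l * Z + e / 8 * (u / w) * (20 * \<sigma> / p ^ 3 - 3 * y / (4 * t))"
    using main by linarith
  then show ?thesis unfolding d Z_def[symmetric] using Zpos by (intro mult_strict_left_mono) auto
qed

lemma less_one_plus_scaled_limit:
  fixes x :: real
  assumes "k > 0" "t > 0" and le: "\<And>s. 0 < s \<Longrightarrow> s < t \<Longrightarrow> x \<le> 1 + C * (s / t) powr k"
  shows "x \<le> 1"
proof -
  have "((\<lambda>s. s / t) \<longlongrightarrow> 0 / t) (at_right 0)" by (intro tendsto_intros) (use assms in auto)
  then have "((\<lambda>s. (s / t) powr k) \<longlongrightarrow> 0 powr k) (at_right 0)"
    by (intro tendsto_powr' tendsto_const)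
       (use assms in \<open>auto simp: eventually_at_right_less intro!: eventually_mono[OF eventually_at_right_less]\<close>)
  then have "((\<lambda>s. 1 + C * (s / t) powr k) \<longlongrightarrow> 1 + C * 0) (at_right 0)"
    by (intro tendsto_intros) (use assms in auto)
  moreover have "\<forall>\<^sub>F s in at_right 0. x \<le> 1 + C * (s / t) powr k"
    using eventually_at_right_real[OF \<open>t > 0\<close>] by eventually_elim (rule le, auto)
  ultimately have "x \<le> 1 + C * 0" by (rule tendsto_lowerbound) simp
  then show ?thesis by simp
qed

text \<open>The time, in units of \<open>l\<close>, up to which the front barrier keeps its foot below \<open>2 * l\<close> and its
  exponential factor below \<open>2\<close>.\<close>

definition parabola_scale :: "nat \<Rightarrow> real" where
  "parabola_scale n = min ((1/320) ^ 4) (1 / (2 * real n))"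

text \<open>The point \<open>(r, t)\<close> is reached by the front barrier with \<open>l = t / parabola_scale n\<close>. Since the barrier
  exceeds the universal bound at \<open>r\<^sup>2 = l\<close>, no information about \<open>v\<close> nearer to the corner enters.\<close>

lemma le_one_outside_parabola:
  fixes n :: nat
  assumes n: "n \<ge> 2" and sol: "smooth_solution n vinit r1 t1 v" and r1: "r1 > 0" and b: "b < r1" and T: "T < t1"
    and side: "\<And>t. 0 \<le> t \<Longrightarrow> t \<le> T \<Longrightarrow> v b t < 1/64" and init: "\<And>r. 0 < r \<Longrightarrow> r \<le> b \<Longrightarrow> v r 0 < 1/64"
    and rt: "0 < r" "r \<le> b" "0 < t" "t \<le> T" and Kr: "sqrt (2 / parabola_scale n) * sqrt t \<le> r"
  shows "v r t \<le> 1"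
proof -
  define \<eta> where "\<eta> = parabola_scale n"
  have \<eta>: "\<eta> > 0" "\<eta> \<le> (1/320) ^ 4" "\<eta> \<le> 1 / (2 * real n)" using n by (auto simp: \<eta>_def parabola_scale_def)
  define l where "l = t / \<eta>"
  have l: "l > 0" using rt \<eta> by (simp add: l_def)
  have r2l: "r\<^sup>2 \<ge> 2 * l"
  proof -
    have "(sqrt (2 / \<eta>) * sqrt t)\<^sup>2 \<le> r\<^sup>2" using Kr \<eta> rt unfolding \<eta>_def by (intro power_mono) auto
    then show ?thesis using rt \<eta> by (simp add: power_mult_distrib l_def)
  qed
  define a where "a = sqrt l"
  have a: "a > 0" "a\<^sup>2 = l" "a \<le> r"
    using l r2l rt by (auto simp: a_def intro!: real_le_lsqrt)
  have side1: "v b t \<le> 1" if "0 \<le> t" "t \<le> T" for t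
  proof -
    have "v b t < 1/64" using side that by blast
    then show ?thesis by linarith
  qed
  have universal: "v r t \<le> 1 + r\<^sup>2 / t" if "0 < r" "r \<le> b" "0 < t" "t \<le> T" for r t
    by (rule universal_upper_bound[OF n sol r1 b T side1 that])
  note c = smooth_solution_continuous[OF sol] and S = smooth_solution_solves[OF sol]
  have "continuous_on ({a..b} \<times> {0..t}) (\<lambda>(r, t). v r t)"
    by (rule continuous_on_subset[OF c]) (use a b T rt in auto)
  from uniform_for_small_times[OF this rt(3), of "1/64"] init a
  obtain c0 where c0: "c0 > 0" "c0 \<le> t" "\<And>r t. r \<in> {a..b} \<Longrightarrow> t \<in> {0..c0} \<Longrightarrow> v r t < 1/64"
    by auto
  define V where "V = (\<lambda>r t. (front_Z n l (r\<^sup>2) t)\<^sup>2)"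
  have small: "front_p l t' \<le> 1/320" "(real n - 1) / l * t' \<le> 1/2" if t': "0 < t'" "t' \<le> t" for t'
  proof -
    have "front_p l t' ^ 4 = t' / l" by (rule front_p_derivative[OF l t'(1)])
    also have "\<dots> \<le> t / l" using t' l by (intro divide_right_mono) auto
    also have "t / l = \<eta>" using rt \<eta> by (simp add: l_def)
    finally have p4: "front_p l t' ^ 4 \<le> \<eta>" .
    then have "front_p l t' ^ 4 \<le> (1/320) ^ 4" using \<eta>(2) by linarith
    then show "front_p l t' \<le> 1/320" by (rule power_le_imp_le_base[of _ 3, simplified]) simp
    have "t' / l \<le> \<eta>" using \<open>t' / l \<le> t / l\<close> \<open>t / l = \<eta>\<close> by simp
    then have "(real n - 1) * (t' / l) \<le> (real n - 1) * (1 / (2 * real n))"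
      using n \<eta>(3) by (intro mult_left_mono) auto
    also have "\<dots> \<le> 1/2" using n by (simp add: field_simps)
    finally show "(real n - 1) / l * t' \<le> 1/2" by simp
  qed
  have V_ge: "V r t > 1/64" if "t > 0" for r t
  proof -
    have "(1/8)\<^sup>2 < (front_Z n l (r\<^sup>2) t)\<^sup>2"
      using front_Z_lower(1)[OF l that, of n "r\<^sup>2"] n by (intro power_strict_mono) auto
    then show ?thesis by (simp add: V_def power2_eq_square)
  qed
  have "v r t < V r t"
  proof (rule strict_supersolution_above[where v=v and V=V and a=a and b=b and c=c0 and d=t and n=n])
    show "solves_on n ({a<..<b} \<times> {c0<..t}) v" using S a b T rt c0 by (auto simp: solves_on_def)
    show "continuous_on ({a..b} \<times> {c0..t}) (\<lambda>(r, t). v r t)"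
      by (rule continuous_on_subset[OF c]) (use a b T rt c0 in auto)
    have pc: "front_p l (snd p) > 0" if "p \<in> {a..b} \<times> {c0..t}" for p
      using front_p_derivative(1)[OF l, of "snd p"] that c0 by auto
    have cp: "continuous_on ({a..b} \<times> {c0..t}) (\<lambda>p. front_p l (snd p))"
      unfolding front_p_def by (intro continuous_intros) (use l in auto)
    have nz: "\<forall>p\<in>{a..b} \<times> {c0..t}. l * front_p l (snd p) ^ 3 \<noteq> 0"
    proof
      fix p assume "p \<in> {a..b} \<times> {c0..t}"
      from pc[OF this] l show "l * front_p l (snd p) ^ 3 \<noteq> 0" by simp
    qed
    have "continuous_on ({a..b} \<times> {c0..t}) (\<lambda>p. front_y l ((fst p)\<^sup>2) (snd p))"
      unfolding front_y_def by (intro continuous_intros cp nz)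
    then show "continuous_on ({a..b} \<times> {c0..t}) (\<lambda>(r, t). V r t)"
      unfolding V_def front_Z_def ramp_def case_prod_unfold by (intro continuous_intros) (use l in auto)
    show "regular_at V r' t'" if "a < r'" "r' < b" "c0 < t'" "t' \<le> t" for r' t'
      unfolding V_def by (rule front_barrier_derivatives(1)[OF l]) (use that a c0 in auto)
    show "F_op n (\<lambda>r'. V r' t') r' < deriv (V r') t'"
      if "a < r'" "r' < b" "c0 < t'" "t' \<le> t" "V r' t' = v r' t'" for r' t'
      unfolding V_def
    proof (rule front_barrier_super[OF n l])
      show "0 < t'" using that c0 by simp
      then show "front_p l t' \<le> 1/320" "(real n - 1) / l * t' \<le> 1/2" using small that by auto
      show "0 < r'" using that a by simp
      show "l \<le> r'\<^sup>2" using power_mono[of a r' 2] that a by auto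
      have "v r' t' \<le> 1 + r'\<^sup>2 / t'" using universal that a c0 rt by auto
      then show "(front_Z n l (r'\<^sup>2) t')\<^sup>2 \<le> 1 + r'\<^sup>2 / t'" using that by (simp add: V_def)
    qed
    show "v a t' < V a t' \<and> v b t' < V b t'" if t': "c0 \<le> t'" "t' \<le> t" for t'
    proof
      have t'0: "t' > 0" using t' c0 by simp
      have "v b t' < 1/64" using side t' t'0 rt by auto
      with V_ge[OF t'0, of b] show "v b t' < V b t'" by linarith
      define p where "p = front_p l t'"
      have p: "p > 0" "p ^ 4 = t' / l" "p \<le> 1/320"
        using front_p_derivative[OF l t'0] small[OF t'0] t' by (auto simp: p_def)
      have "front_y l (a\<^sup>2) t' = (4 + 640 * p) / p ^ 3"
        unfolding front_y_def a p_def[symmetric] using l p(1) by (simp add: field_simps)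
      also have "\<dots> \<ge> 4 / p ^ 3" using p(1) by (intro divide_right_mono) auto
      finally have "1 / p ^ 3 \<le> front_Z n l (a\<^sup>2) t'"
        using front_Z_lower(2)[OF l t'0, of n "a\<^sup>2"] n by simp
      then have "(1 / p ^ 3)\<^sup>2 \<le> V a t'" unfolding V_def using p(1) by (intro power_mono) auto
      moreover have "v a t' \<le> 1 + 1 / p ^ 4"
        using universal[of a t'] a rt t' t'0 l by (simp add: p(2))
      moreover have "1 + 1 / p ^ 4 < (1 / p ^ 3)\<^sup>2"
      proof -
        have "p\<^sup>2 \<le> (1/320)\<^sup>2" using p by (intro power_mono) auto
        also have "(1/320)\<^sup>2 \<le> (1/4::real)" by (simp add: power2_eq_square)
        finally have "p\<^sup>2 \<le> 1/4" .
        moreover have "p ^ 6 \<le> p\<^sup>2" using p(1,3) by (intro power_decreasing) auto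
        ultimately have "p ^ 6 + p\<^sup>2 < 1" by linarith
        then have "(p ^ 6 + p\<^sup>2) / p ^ 6 < 1 / p ^ 6" using p(1) by (intro divide_strict_right_mono) auto
        moreover have "(p ^ 6 + p\<^sup>2) / p ^ 6 = 1 + 1 / p ^ 4" using p(1) by (simp add: field_simps eval_nat_numeral)
        moreover have "(1 / p ^ 3)\<^sup>2 = 1 / p ^ 6" by (simp add: power_divide flip: power_mult)
        ultimately show ?thesis by simp
      qed
      ultimately show "v a t' < V a t'" by linarith
    qed
    show "v r c0 < V r c0" if "a \<le> r" "r \<le> b" for r
      using c0(3)[of r c0] V_ge[of c0 r] c0(1) that by auto
  qed (use rt a c0 in auto)
  also have "V r t \<le> 1"
  proof -
    define p where "p = front_p l t"
    have p: "p > 0" "p \<le> 1/320" using front_p_derivative[OF l rt(3)] small[of t] rt by (auto simp: p_def)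
    have "l * (3/2 + 80 * p) \<le> l * 2" using p l by (intro mult_left_mono) auto
    then have "l * (3/2 + 80 * p) - r\<^sup>2 \<le> 0" using r2l by simp
    then have "front_y l (r\<^sup>2) t \<le> 0"
      unfolding front_y_def p_def[symmetric] using l p(1) by (intro divide_nonpos_pos) auto
    then have "ramp (front_y l (r\<^sup>2) t) \<le> 1" by (rule ramp_le_1)
    moreover have "exp ((real n - 1) / l * t) \<le> 4"
    proof -
      have "(real n - 1) / l * t \<le> 1" using small(2)[OF rt(3) order_refl] by linarith
      then have "exp ((real n - 1) / l * t) \<le> exp 1" by (simp only: exp_le_cancel_iff)
      then show ?thesis using e_less_272 by linarith
    qed
    ultimately have "front_Z n l (r\<^sup>2) t \<le> 4 / 8 * (1 + 1)"
      unfolding front_Z_def using ramp_pos[of "front_y l (r\<^sup>2) t"] by (intro mult_mono divide_right_mono) auto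
    moreover have "front_Z n l (r\<^sup>2) t \<ge> 0" using front_Z_lower(1)[OF l rt(3), of n "r\<^sup>2"] n by simp
    ultimately show ?thesis by (simp add: V_def power_le_one)
  qed
  finally show "v r t \<le> 1" by simp
qed

text \<open>Outside a parabola this is the preceding lemma, and inside it \<open>v\<close> is at most \<open>1 + K\<^sup>2\<close>. There the
  absorption has coefficient at least \<open>2 / (K\<^sup>2 * t)\<close>, whose integral diverges at \<open>t = 0\<close>: the
  function \<open>1 + C * (s / t) powr k\<close> is a supersolution which dominates at time \<open>s\<close>, and \<open>s\<close> is arbitrary.\<close>

lemma solution_le_one:
  fixes n :: nat
  assumes n: "n \<ge> 2" and sol: "smooth_solution n vinit r1 t1 v" and r1: "r1 > 0" and b: "b < r1" and T: "T < t1"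
    and side: "\<And>t. 0 \<le> t \<Longrightarrow> t \<le> T \<Longrightarrow> v b t < 1/64" and init: "\<And>r. 0 < r \<Longrightarrow> r \<le> b \<Longrightarrow> v r 0 < 1/64"
    and rt: "0 < r" "r \<le> b" "0 < t" "t \<le> T"
  shows "v r t \<le> 1"
proof -
  define K where "K = sqrt (2 / parabola_scale n)"
  have K: "K > 0" using n by (simp add: K_def parabola_scale_def)
  have outer: "v r t \<le> 1" if "0 < r" "r \<le> b" "0 < t" "t \<le> T" "K * sqrt t \<le> r" for r t
    using le_one_outside_parabola[OF n sol r1 b T side init] that by (simp add: K_def)
  have side1: "v b t \<le> 1" if "0 \<le> t" "t \<le> T" for t
    using side[OF that] by linarith
  have universal: "v r t \<le> 1 + r\<^sup>2 / t" if "0 < r" "r \<le> b" "0 < t" "t \<le> T" for r t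
    by (rule universal_upper_bound[OF n sol r1 b T side1 that])
  define k where "k = 1 / K\<^sup>2"
  define C where "C = 1 + K\<^sup>2"
  have kC: "k > 0" "C > 0" using K by (auto simp: k_def C_def intro: add_pos_nonneg)
  have inner: "K * sqrt t > r \<Longrightarrow> r\<^sup>2 < K\<^sup>2 * t" if "r > 0" "t > 0" for r t
    using power_strict_mono[of r "K * sqrt t" 2] that K by (simp add: power_mult_distrib)
  note c = smooth_solution_continuous[OF sol] and S = smooth_solution_solves[OF sol]
  show ?thesis
  proof (rule less_one_plus_scaled_limit[OF kC(1) rt(3)])
    fix s assume s: "0 < s" "s < t"
    define V :: "real \<Rightarrow> real \<Rightarrow> real" where "V = (\<lambda>r t. 1 + C * (s / t) powr k)"
    have V1: "V r t > 1" if "t > 0" for r t using that s kC by (simp add: V_def)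
    have "C * (s / T) powr k > 0" using s rt kC by simp
    from pole_limit[OF sol r1 s(1) T this]
    obtain a0 where a0: "a0 > 0" "a0 < r1" "\<And>r t. r \<in> {0..a0} \<Longrightarrow> t \<in> {s..T} \<Longrightarrow> \<bar>v r t - 1\<bar> < C * (s / T) powr k"
      by blast
    define a where "a = min a0 r"
    have a: "0 < a" "a \<le> r" "a \<le> a0" using a0 rt by (auto simp: a_def)
    have dV: "((\<lambda>t. V r t) has_real_derivative - (k * (V r t - 1) / t)) (at t)" if "t > 0" for r t
      unfolding V_def using that s
      by (auto intro!: derivative_eq_intros simp: powr_divide powr_diff field_simps)
    have rg: "regular_at V r t" "F_op n (\<lambda>r. V r t) r = 2 * (real n - 1) / r\<^sup>2 * V r t * (1 - V r t)"
      "deriv (V r) t = - (k * (V r t - 1) / t)" if "t > 0" for r t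
    proof -
      have 1: "((\<lambda>r. V r t) has_real_derivative 0) (at x)" for x unfolding V_def by simp
      have 2: "((\<lambda>x. 0) has_real_derivative 0) (at r)" by simp
      note d = derivatives_of_barrier[of UNIV r V t "\<lambda>_. 0" 0, OF _ _ 1 2 dV[OF that]]
      show "regular_at V r t" "F_op n (\<lambda>r. V r t) r = 2 * (real n - 1) / r\<^sup>2 * V r t * (1 - V r t)"
        "deriv (V r) t = - (k * (V r t - 1) / t)" using d by (simp_all add: jet_def)
    qed
    have "v r t < V r t"
    proof (rule strict_supersolution_above[where v=v and V=V and a=a and b=b and c=s and d=T and n=n])
      show "solves_on n ({a<..<b} \<times> {s<..T}) v" using S a b T rt s by (auto simp: solves_on_def)
      show "continuous_on ({a..b} \<times> {s..T}) (\<lambda>(r, t). v r t)"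
        by (rule continuous_on_subset[OF c]) (use a b T rt s in auto)
      show "continuous_on ({a..b} \<times> {s..T}) (\<lambda>(r, t). V r t)"
        unfolding V_def case_prod_unfold by (intro continuous_intros) (use s in auto)
      show "regular_at V r t" if "s < t" for r t by (rule rg) (use that s in auto)
      show "v a t < V a t \<and> v b t < V b t" if t: "s \<le> t" "t \<le> T" for t
      proof
        have "v a t < 1 + C * (s / T) powr k" using a0(3)[of a t] a t by auto
        also have "\<dots> \<le> V a t"
          unfolding V_def using t s kC by (intro add_left_mono mult_left_mono powr_mono2 divide_left_mono) auto
        finally show "v a t < V a t" .
        show "v b t < V b t" using side[of t] V1[of t b] t s by auto
      qed
      show "v r s < V r s" if r: "a \<le> r" "r \<le> b" for r
      proof -
        have "v r s \<le> 1 + K\<^sup>2"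
        proof (cases "K * sqrt s \<le> r")
          case True
          then show ?thesis using outer[of r s] r a s rt by (auto intro: order.trans)
        next
          case False
          then have "r\<^sup>2 < K\<^sup>2 * s" using inner[of r s] r a s by auto
          then have "r\<^sup>2 / s \<le> K\<^sup>2" using s by (simp add: pos_divide_le_eq)
          then show ?thesis using universal[of r s] r a s rt by auto
        qed
        then show ?thesis using s by (simp add: V_def C_def)
      qed
      show "F_op n (\<lambda>r'. V r' t) r < deriv (V r) t"
        if r: "a < r" "r < b" "s < t" "t \<le> T" "V r t = v r t" for r t
      proof -
        have pos: "r > 0" "t > 0" using r a s by auto
        define x where "x = V r t"
        have x: "x > 1" using V1[OF pos(2)] by (simp add: x_def)
        have "\<not> K * sqrt t \<le> r" using outer[of r t] r pos x by (auto simp: x_def)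
        then have "r\<^sup>2 < K\<^sup>2 * t" using inner pos by auto
        then have "k / t < 1 / r\<^sup>2" using pos K by (simp add: k_def divide_simps mult.commute)
        also have "\<dots> \<le> 2 * (real n - 1) / r\<^sup>2 * x"
        proof -
          have "1 * 1 \<le> 2 * (real n - 1) * x" using n x by (intro mult_mono) auto
          then show ?thesis using pos by (simp add: divide_right_mono)
        qed
        finally have lt: "k / t * (x - 1) < 2 * (real n - 1) / r\<^sup>2 * x * (x - 1)"
          using x by (intro mult_strict_right_mono) auto
        have e1: "2 * (real n - 1) / r\<^sup>2 * x * (1 - x) = - (2 * (real n - 1) / r\<^sup>2 * x * (x - 1))"
          by (simp only: minus_mult_right minus_diff_eq)
        have e2: "k * (x - 1) / t = k / t * (x - 1)" by simp
        show ?thesis unfolding rg(2,3)[OF pos(2)] x_def[symmetric] e1 e2 neg_less_iff_less by (rule lt)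
      qed
    qed (use rt a s in auto)
    then show "v r t \<le> 1 + C * (s / t) powr k" by (simp add: V_def)
  qed
qed


section \<open>The special functions near the pole\<close>

text \<open>If the slope at \<open>x\<close> were very negative, the one-sided bound for the second derivative would keep it very
  negative on \<open>{x / 2..x}\<close>, and \<open>f\<close> would drop by more than \<open>c\<close>. That bound is assumed
  only where the slope is not positive, the form in which it holds for the corrector.\<close>

lemma scaled_derivative_lower_bound:
  fixes f :: "real \<Rightarrow> real"
  assumes x: "x > 0" and K: "K > 0"
    and f: "\<And>y. x / 2 \<le> y \<Longrightarrow> y \<le> x \<Longrightarrow> twice_diff_at f y"
    and f2: "\<And>y. x / 2 \<le> y \<Longrightarrow> y \<le> x \<Longrightarrow> deriv f y \<le> 0 \<Longrightarrow> - (K / x\<^sup>2) \<le> deriv (deriv f) y"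
    and osc: "f (x / 2) - f x \<le> c" "c \<ge> 0"
  shows "- (2 * c + K) \<le> x * deriv f x"
proof (rule ccontr)
  assume neg: "\<not> - (2 * c + K) \<le> x * deriv f x"
  have D1: "(f has_real_derivative deriv f y) (at y)" if "x / 2 \<le> y" "y \<le> x" for y
    using f[OF that] eventually_nhds_x_imp_x
    by (auto simp: twice_diff_at_def DERIV_deriv_iff_real_differentiable)
  have D2: "(deriv f has_real_derivative deriv (deriv f) y) (at y)" if "x / 2 \<le> y" "y \<le> x" for y
    using f[OF that] by (simp add: twice_diff_at_def DERIV_deriv_iff_real_differentiable)
  have "\<exists>z. x / 2 < z \<and> z < x \<and> f x - f (x / 2) = (x - x / 2) * deriv f z"
    by (rule MVT2) (use x D1 in auto)
  then obtain z where z: "x / 2 < z" "z < x" "f x - f (x / 2) = x / 2 * deriv f z" by auto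
  define q where "q = deriv f x + K / x"
  define S where "S = {y \<in> {x / 2..x}. q \<le> deriv f y}"
  have fz: "deriv f z \<ge> - (2 * c / x)"
  proof -
    have "- c \<le> x / 2 * deriv f z" using z(3) osc by simp
    then show ?thesis using x by (simp add: field_simps)
  qed
  have xq: "deriv f x + K / x < - (2 * c / x)"
  proof -
    have "x * (deriv f x + K / x) = x * deriv f x + K" using x by (simp add: field_simps)
    then have "x * (deriv f x + K / x) < - (2 * c)" using neg by linarith
    then show ?thesis using x by (simp add: field_simps)
  qed
  moreover have "2 * c / x \<ge> 0" using osc x by simp
  ultimately have q0: "q < 0" by (simp add: q_def)
  show False
  proof (cases "S = {}")
    case True
    moreover have "z \<in> {x / 2..x}" using z by auto
    ultimately have "\<not> q \<le> deriv f z" unfolding S_def by blast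
    then show False using fz xq by (auto simp: q_def)
  next
    case False
    have cont: "continuous_on {x / 2..x} (deriv f)"
      by (rule DERIV_continuous_on[OF has_field_derivative_at_within[OF D2]]) auto
    have "compact S"
    proof -
      have "closedin (top_of_set {x / 2..x}) ({x / 2..x} \<inter> deriv f -` {q..})"
        by (rule continuous_closedin_preimage[OF cont]) auto
      then have "compact ({x / 2..x} \<inter> deriv f -` {q..})" by (rule closedin_compact[rotated]) auto
      moreover have "{x / 2..x} \<inter> deriv f -` {q..} = S" by (auto simp: S_def)
      ultimately show ?thesis by simp
    qed
    then obtain y where y: "y \<in> S" "\<And>w. w \<in> S \<Longrightarrow> w \<le> y"
      using compact_attains_sup[OF _ False] by blast
    show False
    proof (cases "y = x")
      case True
      then have "q \<le> deriv f x" using y by (simp add: S_def)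
      moreover have "0 < K / x" using x K by simp
      ultimately show False by (simp add: q_def)
    next
      case False
      then have yx: "x / 2 \<le> y" "y < x" "q \<le> deriv f y" using y by (auto simp: S_def)
      have "\<exists>w. y < w \<and> w < x \<and> deriv f x - deriv f y = (x - y) * deriv (deriv f) w"
        by (rule MVT2) (use yx D2 in auto)
      then obtain w where w: "y < w" "w < x" "deriv f x - deriv f y = (x - y) * deriv (deriv f) w" by auto
      have wq: "deriv f w < q" using y(2)[of w] w yx by (force simp: S_def)
      have "- (K / x\<^sup>2) \<le> deriv (deriv f) w" by (rule f2) (use w yx wq q0 in auto)
      then have "(x - y) * - (K / x\<^sup>2) \<le> deriv f x - deriv f y"
        unfolding w(3) using yx by (intro mult_left_mono) auto
      then have "deriv f y - deriv f x \<le> (x - y) * (K / x\<^sup>2)" by simp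
      also have "(x - y) * (K / x\<^sup>2) \<le> (x / 2) * (K / x\<^sup>2)" using yx K by (intro mult_right_mono) auto
      also have "(x / 2) * (K / x\<^sup>2) = 1/2 * (K / x)" using x by (simp add: power2_eq_square)
      finally have "deriv f y - deriv f x \<le> 1/2 * (K / x)" .
      moreover have "0 < K / x" using x K by simp
      ultimately show False using yx(3) unfolding q_def by linarith
    qed
  qed
qed

lemma bryant_slope:
  assumes "is_bryant n \<BB>" "x > 0"
  shows "deriv \<BB> x \<le> 0" "(\<BB> has_real_derivative deriv \<BB> x) (at x)"
proof -
  have tw: "twice_diff_at \<BB> x" and an: "strict_antimono_on {0<..} \<BB>" using assms by (auto simp: is_bryant_def)
  show D: "(\<BB> has_real_derivative deriv \<BB> x) (at x)"
    using tw eventually_nhds_x_imp_x by (auto simp: twice_diff_at_def DERIV_deriv_iff_real_differentiable)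
  show "deriv \<BB> x \<le> 0"
  proof (rule ccontr)
    assume "\<not> deriv \<BB> x \<le> 0"
    then obtain d where d: "d > 0" "\<And>h. 0 < h \<Longrightarrow> h < d \<Longrightarrow> \<BB> x < \<BB> (x + h)"
      using DERIV_pos_inc_right[OF D] by auto
    have "\<BB> (x + d/2) < \<BB> x" using an assms(2) d(1) by (auto simp: monotone_on_def)
    then show False using d(2)[of "d/2"] d(1) by simp
  qed
qed

lemma corrector_has_derivative:
  assumes "is_corrector n \<BB> \<CC>" "x > 0"
  shows "(\<CC> has_real_derivative deriv \<CC> x) (at x)"
  using assms eventually_nhds_x_imp_x
  by (auto simp: is_corrector_def twice_diff_at_def DERIV_deriv_iff_real_differentiable)

text \<open>In the equation \<open>F_op n \<BB> x = 0\<close> the slope terms have a sign, because \<open>\<BB>\<close> decreases and \<open>\<BB> x < 1 \<le> n - 1\<close>.\<close>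

lemma bryant_second_derivative:
  assumes n: "n \<ge> 2" and B: "is_bryant n \<BB>" and x: "x > 0"
  shows "- (2 * real n * (1 - \<BB> x) / x\<^sup>2) \<le> deriv (deriv \<BB>) x"
    "\<BB> x \<ge> 1/2 \<Longrightarrow> - 1 \<le> x * deriv \<BB> x \<Longrightarrow> deriv (deriv \<BB>) x \<le> (2 * real n + 1) / x\<^sup>2"
proof -
  define b p q where "b = \<BB> x" and "p = - deriv \<BB> x" and "q = deriv (deriv \<BB>) x"
  have b: "0 < b" "b < 1" and F: "F_op n \<BB> x = 0" using B x by (auto simp: is_bryant_def b_def)
  have p: "p \<ge> 0" using bryant_slope(1)[OF B x] by (simp add: p_def)
  have n': "real n - 1 \<ge> 1" using n by simp
  have e: "b * q = p\<^sup>2 / 2 + (real n - 1 - b) / x * p - 2 * (real n - 1) / x\<^sup>2 * b * (1 - b)"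
    using F by (simp add: F_op_def b_def p_def q_def)
  have "0 \<le> (real n - 1 - b) / x * p" using b n' x p by (intro mult_nonneg_nonneg divide_nonneg_pos) auto
  then have "b * (- (2 * (real n - 1) / x\<^sup>2 * (1 - b))) \<le> b * q"
    unfolding e using p by (simp add: algebra_simps)
  then have q1: "- (2 * (real n - 1) / x\<^sup>2 * (1 - b)) \<le> q" using b by (simp only: mult_le_cancel_left_pos)
  have "2 * (real n - 1) / x\<^sup>2 * (1 - b) \<le> 2 * real n / x\<^sup>2 * (1 - b)"
    using b x by (intro mult_right_mono divide_right_mono) auto
  then have "- (2 * real n / x\<^sup>2 * (1 - b)) \<le> q" using q1 by linarith
  then show "- (2 * real n * (1 - \<BB> x) / x\<^sup>2) \<le> deriv (deriv \<BB>) x" by (simp add: b_def q_def)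
  assume h: "\<BB> x \<ge> 1/2" "- 1 \<le> x * deriv \<BB> x"
  have px: "p \<le> 1 / x" using h(2) x by (simp add: p_def field_simps)
  have "p\<^sup>2 \<le> (1 / x)\<^sup>2" using px p by (rule power_mono)
  moreover have "(real n - 1 - b) / x * p \<le> real n / x * (1 / x)"
    using px p x b n' by (intro mult_mono divide_right_mono) auto
  moreover have "0 \<le> 2 * (real n - 1) / x\<^sup>2 * b * (1 - b)" using b n' by simp
  ultimately have "b * q \<le> (1 / x)\<^sup>2 / 2 + real n / x * (1 / x)" unfolding e by linarith
  also have "\<dots> = 1/2 * ((2 * real n + 1) / x\<^sup>2)" using x by (simp add: field_simps power2_eq_square)
  also have "\<dots> \<le> b * ((2 * real n + 1) / x\<^sup>2)" using h(1) by (intro mult_right_mono) (auto simp: b_def)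
  finally have "q \<le> (2 * real n + 1) / x\<^sup>2" using b by (simp only: mult_le_cancel_left_pos)
  then show "deriv (deriv \<BB>) x \<le> (2 * real n + 1) / x\<^sup>2" by (simp add: q_def)
qed

lemma corrector_second_derivative:
  assumes n: "n \<ge> 2" and B: "is_bryant n \<BB>" and C: "is_corrector n \<BB> \<CC>" and x: "x > 0"
    and near: "\<BB> x \<ge> 1/2" "- 1 \<le> x * deriv \<BB> x" and neg: "deriv \<CC> x \<le> 0"
  shows "- (8 * real n * \<CC> x / x\<^sup>2) \<le> deriv (deriv \<CC>) x"
proof -
  define b p q where "b = \<BB> x" and "p = deriv \<BB> x" and "q = deriv (deriv \<BB>) x"
  define c c1 c2 where "c = \<CC> x" and "c1 = deriv \<CC> x" and "c2 = deriv (deriv \<CC>) x"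
  have b: "1/2 \<le> b" "b < 1" using B x near by (auto simp: is_bryant_def b_def)
  have c: "c > 0" using C x by (simp add: is_corrector_def c_def)
  have p: "p \<le> 0" using bryant_slope(1)[OF B x] by (simp add: p_def)
  have n': "real n - 1 \<ge> 1" using n by simp
  have "dF_op n \<BB> \<CC> x = - x * deriv \<BB> x" using C x by (simp add: is_corrector_def)
  then have e: "b * c2 = - x * p - ((real n - 1 - b) / x - p) * c1
      - (q - p / x + 2 * (real n - 1) / x\<^sup>2 * (1 - 2 * b)) * c"
    by (simp add: dF_op_def b_def p_def q_def c_def c1_def c2_def algebra_simps)
  have q: "q \<le> (2 * real n + 1) / x\<^sup>2"
    unfolding q_def by (rule bryant_second_derivative(2)[OF n B x near])
  have "- p / x \<le> 1 / x\<^sup>2" using near(2) x by (simp add: p_def field_simps power2_eq_square)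
  moreover have "2 * (real n - 1) / x\<^sup>2 * (1 - 2 * b) \<le> 0"
    using n' b by (intro mult_nonneg_nonpos) auto
  moreover have "(2 * real n + 1) / x\<^sup>2 + 1 / x\<^sup>2 \<le> 4 * real n / x\<^sup>2"
    using n' by (simp add: add_divide_distrib[symmetric] divide_right_mono)
  ultimately have "q - p / x + 2 * (real n - 1) / x\<^sup>2 * (1 - 2 * b) \<le> 4 * real n / x\<^sup>2" using q by simp
  then have "(q - p / x + 2 * (real n - 1) / x\<^sup>2 * (1 - 2 * b)) * c \<le> 4 * real n / x\<^sup>2 * c"
    using c by (intro mult_right_mono) auto
  moreover have "((real n - 1 - b) / x - p) * c1 \<le> 0"
    using neg p b n' x by (intro mult_nonneg_nonpos) (auto simp: c1_def intro!: order.trans[OF p] divide_nonneg_pos)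
  moreover have "0 \<le> - x * p" using x p by (simp add: mult_nonneg_nonpos)
  ultimately have "- (4 * real n / x\<^sup>2 * c) \<le> b * c2" unfolding e by linarith
  moreover have "b * - (8 * real n * c / x\<^sup>2) \<le> 1/2 * - (8 * real n * c / x\<^sup>2)"
    using b c by (intro mult_right_mono_neg) auto
  moreover have "4 * real n / x\<^sup>2 * c = 1/2 * (8 * real n * c / x\<^sup>2)" by simp
  ultimately have "b * - (8 * real n * c / x\<^sup>2) \<le> b * c2" by linarith
  then have "- (8 * real n * c / x\<^sup>2) \<le> c2" using b by (simp only: mult_le_cancel_left_pos)
  then show ?thesis by (simp add: c_def c2_def)
qed

text \<open>By assumption only the values of \<open>\<BB>\<close> and \<open>\<CC>\<close> are controlled at \<open>0\<close>. The one-sided bounds for their second derivatives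
  are small multiples of \<open>1 / x\<^sup>2\<close>, which makes the scaled slopes small from below.\<close>

lemma pole_profile_estimates:
  assumes n: "n \<ge> 2" and B: "is_bryant n \<BB>" and C: "is_corrector n \<BB> \<CC>" and \<kappa>: "\<kappa> > 0"
  shows "\<exists>x0>0. \<forall>x. 0 < x \<and> x < x0 \<longrightarrow>
    1 - \<kappa> < \<BB> x \<and> \<CC> x < \<kappa> \<and> - \<kappa> \<le> x * deriv \<BB> x \<and> - \<kappa> \<le> x * deriv \<CC> x"
proof -
  define \<mu> where "\<mu> = min (1/2) (min 1 \<kappa> / (2 + 64 * real n))"
  have \<mu>: "\<mu> > 0" "\<mu> \<le> 1/2" "(2 + 64 * real n) * \<mu> \<le> 1" "(2 + 64 * real n) * \<mu> \<le> \<kappa>" "\<mu> \<le> \<kappa>"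
  proof -
    have d: "2 + 64 * real n > 0" by (simp add: add_pos_nonneg)
    show "\<mu> > 0" "\<mu> \<le> 1/2" using \<kappa> d by (auto simp: \<mu>_def)
    have "\<mu> \<le> min 1 \<kappa> / (2 + 64 * real n)" by (simp add: \<mu>_def)
    then have m: "(2 + 64 * real n) * \<mu> \<le> min 1 \<kappa>" using d by (simp add: pos_le_divide_eq mult.commute)
    then show "(2 + 64 * real n) * \<mu> \<le> 1" "(2 + 64 * real n) * \<mu> \<le> \<kappa>" by auto
    have "1 * \<mu> \<le> (2 + 64 * real n) * \<mu>" using \<open>\<mu> > 0\<close> by (intro mult_right_mono) auto
    then show "\<mu> \<le> \<kappa>" using m by simp
  qed
  have "(\<BB> \<longlongrightarrow> 1) (at_right 0)" using B by (simp add: is_bryant_def)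
  then have e1: "\<forall>\<^sub>F x in at_right 0. 1 - \<mu> < \<BB> x" using \<mu> by (intro order_tendstoD) auto
  obtain M where M: "M > 0" "(\<lambda>x. \<CC> x - M * x\<^sup>2) \<in> o[at_right 0](\<lambda>x. x\<^sup>2)" using C by (auto simp: is_corrector_def)
  have e2: "\<forall>\<^sub>F x in at_right 0. norm (\<CC> x - M * x\<^sup>2) \<le> 1 * norm (x\<^sup>2)"
    using landau_o.smallD[OF M(2), of 1] by simp
  have "((\<lambda>x::real. (M + 1) * x\<^sup>2) \<longlongrightarrow> (M + 1) * 0\<^sup>2) (at_right 0)" by (intro tendsto_intros)
  then have e3: "\<forall>\<^sub>F x in at_right 0. (M + 1) * x\<^sup>2 < \<mu>" using \<mu> by (intro order_tendstoD) auto
  from e1 e2 e3 have "\<forall>\<^sub>F x in at_right 0. 1 - \<mu> < \<BB> x \<and> \<CC> x < \<mu>"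
    by eventually_elim (auto simp: algebra_simps abs_le_iff)
  then obtain x0 where x0: "x0 > 0" "\<And>x. 0 < x \<Longrightarrow> x < x0 \<Longrightarrow> 1 - \<mu> < \<BB> x \<and> \<CC> x < \<mu>"
    by (auto simp: eventually_at_right_field)
  show ?thesis
  proof (intro exI[of _ x0] conjI allI impI x0(1))
    fix x assume x: "0 < x \<and> x < x0"
    show "1 - \<kappa> < \<BB> x" "\<CC> x < \<kappa>" using x0(2)[of x] x \<mu> by auto
    have scale: "K * a / y\<^sup>2 \<le> 4 * K * \<mu> / x\<^sup>2" if "x / 2 \<le> y" "y \<le> x" "a \<le> \<mu>" "K \<ge> 0" for y a K
    proof -
      have "(x / 2)\<^sup>2 \<le> y\<^sup>2" using that x by (intro power_mono) auto
      then have "K * a / y\<^sup>2 \<le> K * \<mu> / (x / 2)\<^sup>2"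
        using that \<mu> x by (intro frac_le mult_left_mono) auto
      then show ?thesis by (simp add: power_divide mult_ac)
    qed
    have Bslope: "- (2 * \<mu> + 8 * real n * \<mu>) \<le> y * deriv \<BB> y" if y: "0 < y" "y \<le> x" for y
    proof (rule scaled_derivative_lower_bound)
      show "twice_diff_at \<BB> z" if "y / 2 \<le> z" for z using B that y by (auto simp: is_bryant_def)
      show "- (8 * real n * \<mu> / y\<^sup>2) \<le> deriv (deriv \<BB>) z" if z: "y / 2 \<le> z" "z \<le> y" for z
      proof -
        have "2 * real n * (1 - \<BB> z) / z\<^sup>2 \<le> 4 * (2 * real n) * \<mu> / y\<^sup>2"
        proof -
          have "(y / 2)\<^sup>2 \<le> z\<^sup>2" using z y by (intro power_mono) auto
          moreover have "1 - \<BB> z \<le> \<mu>" using x0(2)[of z] z y x by auto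
          ultimately have "2 * real n * (1 - \<BB> z) / z\<^sup>2 \<le> 2 * real n * \<mu> / (y / 2)\<^sup>2"
            using \<mu> y by (intro frac_le mult_left_mono) auto
          then show ?thesis by (simp add: power_divide)
        qed
        then show ?thesis using bryant_second_derivative(1)[OF n B, of z] z y by simp
      qed
      have "\<BB> (y / 2) < 1" using B y by (auto simp: is_bryant_def)
      then show "\<BB> (y / 2) - \<BB> y \<le> \<mu>" using x0(2)[of y] y x by auto
    qed (use y n \<mu> in auto)
    have "2 * \<mu> + 8 * real n * \<mu> \<le> (2 + 64 * real n) * \<mu>" using \<mu> by (simp add: algebra_simps)
    then have m1: "2 * \<mu> + 8 * real n * \<mu> \<le> 1" "2 * \<mu> + 8 * real n * \<mu> \<le> \<kappa>" using \<mu> by linarith+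
    show "- \<kappa> \<le> x * deriv \<BB> x" using Bslope[of x] x m1 by auto
    have "- (2 * \<mu> + 32 * real n * \<mu>) \<le> x * deriv \<CC> x"
    proof (rule scaled_derivative_lower_bound)
      show "twice_diff_at \<CC> z" if "x / 2 \<le> z" for z using C that x by (auto simp: is_corrector_def)
      show "- (32 * real n * \<mu> / x\<^sup>2) \<le> deriv (deriv \<CC>) z" if z: "x / 2 \<le> z" "z \<le> x" and neg: "deriv \<CC> z \<le> 0" for z
      proof -
        have z0: "z > 0" using z x by auto
        have "- (8 * real n * \<CC> z / z\<^sup>2) \<le> deriv (deriv \<CC>) z"
          using x0(2)[of z] z x \<mu> m1 Bslope[of z] z0 by (intro corrector_second_derivative[OF n B C z0 _ _ neg]) auto
        moreover have "8 * real n * \<CC> z / z\<^sup>2 \<le> 4 * (8 * real n) * \<mu> / x\<^sup>2"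
          using x0(2)[of z] z x by (intro scale) auto
        ultimately show ?thesis by simp
      qed
      have "\<CC> x > 0" using C x by (auto simp: is_corrector_def)
      then show "\<CC> (x / 2) - \<CC> x \<le> \<mu>" using x0(2)[of "x/2"] x by auto
    qed (use x n \<mu> in auto)
    moreover have "2 * \<mu> + 32 * real n * \<mu> \<le> (2 + 64 * real n) * \<mu>" using \<mu> by (simp add: algebra_simps)
    ultimately show "- \<kappa> \<le> x * deriv \<CC> x" using \<mu> by linarith
  qed
qed


section \<open>The three pieces of the barriers\<close>

text \<open>The product of \<open>\<theta>\<close> and its derivative, the factor of the corrector in the inner piece.\<close>

definition theta_rate :: "real \<Rightarrow> real" where
  "theta_rate t = (1 / (- ln t) + 1 / (ln t)\<^sup>2) / 2"

lemma theta_facts: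
  assumes "0 < t" "t < 1"
  shows theta_pos: "\<theta> t > 0" and theta_derivative: "(\<theta> has_real_derivative theta_rate t / \<theta> t) (at t)"
    and theta_times_derivative: "\<theta> t * deriv \<theta> t = theta_rate t" and theta_rate_pos: "theta_rate t > 0"
    and theta_square: "(\<theta> t)\<^sup>2 = t / (- ln t)"
proof -
  have l: "ln t < 0" using assms by simp
  then have q: "t / (- ln t) > 0" using assms by (intro divide_pos_pos) auto
  then show p: "\<theta> t > 0" by (simp add: \<theta>_def)
  show "(\<theta> t)\<^sup>2 = t / (- ln t)" using q by (simp add: \<theta>_def)
  have "((\<lambda>t. t / (- ln t)) has_real_derivative (2 * theta_rate t)) (at t)"
    unfolding theta_rate_def using assms l
    by (auto intro!: derivative_eq_intros simp: field_simps power2_eq_square)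
  from DERIV_real_sqrt_generic[OF less_imp_neq[OF q, THEN not_sym], of "inverse (\<theta> t) / 2"] q
  have "(sqrt has_real_derivative inverse (\<theta> t) / 2) (at (t / (- ln t)))"
    using DERIV_real_sqrt[OF q] by (simp add: \<theta>_def)
  from DERIV_chain2[OF this \<open>((\<lambda>t. t / (- ln t)) has_real_derivative (2 * theta_rate t)) (at t)\<close>]
  show d: "(\<theta> has_real_derivative theta_rate t / \<theta> t) (at t)"
    unfolding \<theta>_def[abs_def] by (rule DERIV_cong) (simp add: \<theta>_def field_simps)
  show "\<theta> t * deriv \<theta> t = theta_rate t" using DERIV_imp_deriv[OF d] p by simp
  show "theta_rate t > 0" unfolding theta_rate_def using l by (intro divide_pos_pos add_pos_pos) auto
qed

lemma theta_mono: "0 < s \<Longrightarrow> s \<le> t \<Longrightarrow> t < 1 \<Longrightarrow> \<theta> s \<le> \<theta> t"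
  unfolding \<theta>_def by (intro real_sqrt_le_mono frac_le) auto

lemma theta_le_sqrt: "0 < t \<Longrightarrow> - ln t \<ge> 1 \<Longrightarrow> \<theta> t \<le> sqrt t"
proof -
  assume t: "0 < t" "- ln t \<ge> 1"
  have "0 < - ln t" "t * 1 \<le> t * (- ln t)" using t by (linarith, intro mult_left_mono) auto
  then have "t / (- ln t) \<le> t" by (simp only: pos_divide_le_eq)
  then show ?thesis unfolding \<theta>_def by (intro real_sqrt_le_mono) simp
qed

lemma theta_continuous: "continuous_on {0<..<1} \<theta>"
  unfolding \<theta>_def[abs_def] by (intro continuous_intros) auto

lemma theta_rate_continuous: "continuous_on {0<..<1} theta_rate"
  unfolding theta_rate_def[abs_def] by (intro continuous_intros) auto

lemma theta_rate_mono: "0 < s \<Longrightarrow> s \<le> t \<Longrightarrow> t < 1 \<Longrightarrow> theta_rate s \<le> theta_rate t"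
proof -
  assume st: "0 < s" "s \<le> t" "t < 1"
  have "(- ln t)\<^sup>2 \<le> (- ln s)\<^sup>2" using st by (intro power_mono) auto
  then show ?thesis unfolding theta_rate_def using st
    by (intro divide_right_mono add_mono frac_le) auto
qed

lemma theta_rate_small:
  assumes "e > 0"
  shows "\<exists>T>0. T < 1 \<and> (\<forall>t. 0 < t \<and> t \<le> T \<longrightarrow> theta_rate t \<le> e)"
proof -
  define L where "L = max 1 (1 / e)"
  have L: "L \<ge> 1" "1 / L \<le> e" using assms by (auto simp: L_def max_def field_simps)
  have "theta_rate (exp (- L)) = (1 / L + 1 / L\<^sup>2) / 2" by (simp add: theta_rate_def)
  also have "1 / L\<^sup>2 \<le> 1 / L" using L by (intro frac_le) (auto simp: power2_eq_square)
  finally have "theta_rate (exp (- L)) \<le> e" using L by simp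
  then show ?thesis
    using L theta_rate_mono[of _ "exp (- L)"] by (intro exI[of _ "exp (- L)"]) (auto intro: order.trans)
qed

lemma gam_bounds:
  assumes "n \<ge> 2" "A > 0" "0 < \<epsilon>" "\<epsilon> < 1/4" "0 < \<delta>" "\<delta> < 1/4" "s = 1 \<or> s = - 1"
  shows gam_ge: "\<delta> \<le> gam n A \<epsilon> \<delta> s" and gam_minus_le: "gam n A \<epsilon> \<delta> (- 1) \<le> 1/2"
    and kk_pos: "kk n A \<epsilon> \<delta> s > 0"
proof -
  have n': "real n - 1 \<ge> 1" using assms by simp
  define q where "q = \<epsilon>\<^sup>2 / (\<epsilon> + 2 * A\<^sup>2 / (real n - 1))"
  have d: "2 * A\<^sup>2 / (real n - 1) > 0" using assms n' by simp
  have "q \<le> \<epsilon>\<^sup>2 / \<epsilon>" unfolding q_def using assms d by (intro divide_left_mono mult_pos_pos add_pos_pos) auto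
  then have q: "0 \<le> q" "q \<le> \<epsilon>" using assms d by (auto simp: q_def power2_eq_square)
  have g: "gam n A \<epsilon> \<delta> s' = \<delta> + (1 + s' * \<delta>) * q" for s' by (simp add: gam_def q_def)
  show ge: "\<delta> \<le> gam n A \<epsilon> \<delta> s" using q assms by (auto simp: g)
  have "(1 - \<delta>) * q \<le> 1 * \<epsilon>" using q assms by (intro mult_mono) auto
  then show le: "gam n A \<epsilon> \<delta> (- 1) \<le> 1/2" using assms by (simp add: g)
  have "1 * 1 \<le> (real n - 1)\<^sup>2" using n' unfolding power2_eq_square by (intro mult_mono) auto
  then have "\<epsilon> / (2 * (real n - 1)\<^sup>2) \<le> \<epsilon> / 2" using assms by (intro divide_left_mono) auto
  moreover have "0 < \<epsilon> / (2 * (real n - 1)\<^sup>2)" using assms n' by simp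
  ultimately have e: "0 < \<epsilon> / (2 * (real n - 1)\<^sup>2)" "\<epsilon> / (2 * (real n - 1)\<^sup>2) \<le> \<epsilon> / 2" by blast+
  have "1 + s * gam n A \<epsilon> \<delta> s + s * (\<epsilon> / (2 * (real n - 1)\<^sup>2)) > 0"
  proof (cases "s = 1")
    case True
    have "0 < 1 + gam n A \<epsilon> \<delta> 1 + \<epsilon> / (2 * (real n - 1)\<^sup>2)" using ge e(1) assms(5) True by simp
    then show ?thesis by (simp add: True)
  next
    case False
    then have s: "s = - 1" using assms(7) by simp
    show ?thesis unfolding s using le e(2) assms(4) by linarith
  qed
  then have "1 + s * gam n A \<epsilon> \<delta> s + s * \<epsilon> / (2 * (real n - 1)\<^sup>2) > 0" by simp
  then show "kk n A \<epsilon> \<delta> s > 0" unfolding kk_def using n' by (intro mult_pos_pos) auto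
qed

lemma v_in_explicit:
  assumes "0 < t" "t < 1"
  shows "v_in n \<BB> \<CC> A \<epsilon> \<delta> s r t = \<BB> (kk n A \<epsilon> \<delta> s * (r / \<theta> t))
     + (1 - s * \<epsilon>) / (kk n A \<epsilon> \<delta> s)\<^sup>2 * theta_rate t * \<CC> (kk n A \<epsilon> \<delta> s * (r / \<theta> t))"
  using theta_times_derivative[OF assms] by (simp add: v_in_def Let_def mult_ac)

lemma v_in_continuous:
  assumes B: "is_bryant n \<BB>" and C: "is_corrector n \<BB> \<CC>" and k: "kk n A \<epsilon> \<delta> s > 0"
  shows "continuous_on ({0<..} \<times> {0<..<1}) (\<lambda>(r, t). v_in n \<BB> \<CC> A \<epsilon> \<delta> s r t)"
proof -
  let ?S = "{0<..} \<times> {0<..<1} :: (real \<times> real) set" and ?k = "kk n A \<epsilon> \<delta> s"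
  have cB: "continuous_on {0<..} \<BB>" "continuous_on {0<..} \<CC>"
    by (rule DERIV_continuous_on[OF has_field_derivative_at_within[OF bryant_slope(2)[OF B]]], simp)
       (rule DERIV_continuous_on[OF has_field_derivative_at_within[OF corrector_has_derivative[OF C]]], simp)
  have th: "continuous_on ?S (\<lambda>p. \<theta> (snd p))" "continuous_on ?S (\<lambda>p. theta_rate (snd p))"
    by (rule continuous_on_compose2[OF theta_continuous], auto intro!: continuous_intros)
       (rule continuous_on_compose2[OF theta_rate_continuous], auto intro!: continuous_intros)
  have nz: "\<forall>p\<in>?S. \<theta> (snd p) \<noteq> 0"
  proof
    fix p :: "real \<times> real" assume "p \<in> ?S"
    then show "\<theta> (snd p) \<noteq> 0" using theta_pos[of "snd p"] by auto
  qed
  have x: "continuous_on ?S (\<lambda>p. ?k * (fst p / \<theta> (snd p)))" by (intro continuous_intros th nz)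
  have im: "?k * (fst p / \<theta> (snd p)) \<in> {0<..}" if "p \<in> ?S" for p
    using that k theta_pos[of "snd p"] by auto
  have "continuous_on ?S (\<lambda>p. \<BB> (?k * (fst p / \<theta> (snd p))))" "continuous_on ?S (\<lambda>p. \<CC> (?k * (fst p / \<theta> (snd p))))"
    by (rule continuous_on_compose2[OF cB(1) x], use im in blast)
       (rule continuous_on_compose2[OF cB(2) x], use im in blast)
  then have "continuous_on ?S (\<lambda>p. \<BB> (?k * (fst p / \<theta> (snd p)))
     + (1 - s * \<epsilon>) / ?k\<^sup>2 * theta_rate (snd p) * \<CC> (?k * (fst p / \<theta> (snd p))))"
    by (intro continuous_intros th)
  then show ?thesis
    by (rule continuous_on_cong[THEN iffD1, OF refl, rotated]) (auto simp: v_in_explicit)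
qed

lemma corrector_bounded:
  assumes n: "n \<ge> 2" and B: "is_bryant n \<BB>" and C: "is_corrector n \<BB> \<CC>"
  shows "\<exists>Cb>0. \<forall>x. 0 < x \<and> x \<le> X \<longrightarrow> \<CC> x \<le> Cb"
proof -
  obtain x0 where x0: "x0 > 0" "\<And>x. 0 < x \<Longrightarrow> x < x0 \<Longrightarrow> \<CC> x < 1"
    using pole_profile_estimates[OF n B C, of 1] by auto
  have "continuous_on {x0 / 2..X} \<CC>"
    by (rule DERIV_continuous_on[OF has_field_derivative_at_within[OF corrector_has_derivative[OF C]]]) (use x0(1) in auto)
  then have "bounded (\<CC> ` {x0 / 2..X})" by (intro compact_imp_bounded compact_continuous_image compact_Icc)
  then obtain M where M: "\<forall>y\<in>\<CC> ` {x0 / 2..X}. norm y \<le> M" unfolding bounded_iff by (rule exE)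
  have "\<CC> x \<le> max 1 M" if x: "0 < x" "x \<le> X" for x
  proof (cases "x < x0")
    case True
    then show ?thesis using x0(2)[of x] x by auto
  next
    case False
    then have "norm (\<CC> x) \<le> M" using M x x0(1) by auto
    then show ?thesis by auto
  qed
  then show ?thesis by (intro exI[of _ "max 1 M"]) auto
qed

text \<open>Uniformly up to \<open>t = 0\<close>: for small \<open>t\<close> the factor \<open>theta_rate t\<close> is small and \<open>\<CC>\<close> is bounded on the
  inner zone, and for the other \<open>t\<close> the argument of \<open>\<CC>\<close> is small.\<close>

lemma v_in_near_pole_upper:
  assumes n: "n \<ge> 2" and B: "is_bryant n \<BB>" and C: "is_corrector n \<BB> \<CC>"
    and k: "kk n A \<epsilon> \<delta> (- 1) > 0" and e: "\<epsilon> > 0" and T: "0 < T" "T < 1" and \<kappa>: "\<kappa> > 0"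
  shows "\<exists>a>0. \<forall>r t. 0 < r \<and> r < a \<and> 0 < t \<and> t \<le> T \<and> r \<le> X * \<theta> t \<longrightarrow> v_in n \<BB> \<CC> A \<epsilon> \<delta> (- 1) r t \<le> 1 + \<kappa>"
proof -
  define k where "k = kk n A \<epsilon> \<delta> (- 1)"
  have k0: "k > 0" using k by (simp add: k_def)
  define c where "c = (1 + \<epsilon>) / k\<^sup>2"
  have c: "c > 0" using k0 e by (simp add: c_def add_pos_pos)
  obtain Cb where Cb: "Cb > 0" "\<And>x. 0 < x \<Longrightarrow> x \<le> k * X \<Longrightarrow> \<CC> x \<le> Cb"
    using corrector_bounded[OF n B C, of "k * X"] by blast
  obtain T1 where T1: "T1 > 0" "T1 < 1" "\<And>t. 0 < t \<Longrightarrow> t \<le> T1 \<Longrightarrow> theta_rate t \<le> \<kappa> / (c * Cb)"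
    using theta_rate_small[of "\<kappa> / (c * Cb)"] \<kappa> c Cb by auto
  have m: "c * theta_rate T > 0" using c theta_rate_pos[OF T] by simp
  obtain x0 where x0: "x0 > 0" "\<And>x. 0 < x \<Longrightarrow> x < x0 \<Longrightarrow> \<CC> x < \<kappa> / (c * theta_rate T)"
    using pole_profile_estimates[OF n B C, of "\<kappa> / (c * theta_rate T)"] \<kappa> m by (auto simp del: divide_const_simps)
  define a where "a = \<theta> T1 * x0 / k"
  have "a > 0" using theta_pos[of T1] T1 x0 k0 by (simp add: a_def)
  moreover have "v_in n \<BB> \<CC> A \<epsilon> \<delta> (- 1) r t \<le> 1 + \<kappa>" if r: "0 < r" "r < a" "0 < t" "t \<le> T" "r \<le> X * \<theta> t" for r t
  proof -
    have t1: "t < 1" using r T by simp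
    note th = theta_pos[OF r(3) t1] and tr = theta_rate_pos[OF r(3) t1]
    define x where "x = k * (r / \<theta> t)"
    have x: "x > 0" using k0 r th by (simp add: x_def)
    have Cx: "\<CC> x \<ge> 0" using C x by (simp add: is_corrector_def less_imp_le)
    have "\<BB> x < 1" using B x by (simp add: is_bryant_def)
    moreover have "c * theta_rate t * \<CC> x \<le> \<kappa>"
    proof (cases "t \<le> T1")
      case True
      have "r / \<theta> t \<le> X" using r(5) th by (simp add: pos_divide_le_eq)
      then have "x \<le> k * X" unfolding x_def using k0 by (intro mult_left_mono) auto
      then have "c * theta_rate t * \<CC> x \<le> c * (\<kappa> / (c * Cb)) * Cb"
        using Cb T1(3)[OF r(3) True] c tr x Cx \<kappa> by (intro mult_mono) auto
      also have "\<dots> = \<kappa>" using c Cb by simp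
      finally show ?thesis .
    next
      case False
      have "r / \<theta> t \<le> r / \<theta> T1" using theta_mono[of T1 t] False T1 t1 r th theta_pos[of T1] by (intro divide_left_mono) auto
      also have "\<dots> < a / \<theta> T1" using r theta_pos[of T1] T1 by (intro divide_strict_right_mono) auto
      also have "\<dots> = x0 / k" using theta_pos[of T1] T1 by (simp add: a_def)
      finally have "k * (r / \<theta> t) < k * (x0 / k)" using k0 by (intro mult_strict_left_mono) auto
      then have "x < x0" using k0 by (simp add: x_def)
      then have "c * theta_rate t * \<CC> x \<le> c * theta_rate T * (\<kappa> / (c * theta_rate T))"
        using x0(2)[OF x] c tr theta_rate_mono[OF r(3,4) T(2)] theta_rate_pos[OF T] Cx
        by (intro mult_mono) (auto intro: less_imp_le)
      also have "\<dots> = \<kappa>" using c theta_rate_pos[OF T] by simp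
      finally show ?thesis .
    qed
    ultimately show ?thesis
      using v_in_explicit[OF r(3) t1, of n \<BB> \<CC> A \<epsilon> \<delta> "- 1" r] by (simp add: x_def k_def c_def)
  qed
  ultimately show ?thesis by blast
qed

lemma v_in_ge_bryant:
  assumes C: "is_corrector n \<BB> \<CC>" and k: "kk n A \<epsilon> \<delta> 1 > 0" and e: "\<epsilon> < 1"
    and t: "0 < t" "t < 1" and r: "r > 0"
  shows "\<BB> (kk n A \<epsilon> \<delta> 1 * (r / \<theta> t)) \<le> v_in n \<BB> \<CC> A \<epsilon> \<delta> 1 r t"
proof -
  have "\<CC> (kk n A \<epsilon> \<delta> 1 * (r / \<theta> t)) > 0" using C k r theta_pos[OF t] by (simp add: is_corrector_def)
  then show ?thesis using v_in_explicit[OF t, of n \<BB> \<CC> A \<epsilon> \<delta> 1 r] e theta_rate_pos[OF t] by simp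
qed

lemma v_in_near_pole_lower:
  assumes n: "n \<ge> 2" and B: "is_bryant n \<BB>" and C: "is_corrector n \<BB> \<CC>"
    and k: "kk n A \<epsilon> \<delta> 1 > 0" and e: "\<epsilon> < 1" and s: "0 < s" and T: "T < 1" and \<kappa>: "\<kappa> > 0"
  shows "\<exists>a>0. \<forall>r t. 0 < r \<and> r < a \<and> s \<le> t \<and> t \<le> T \<longrightarrow> 1 - \<kappa> \<le> v_in n \<BB> \<CC> A \<epsilon> \<delta> 1 r t"
proof (cases "s \<le> T")
  case False
  then show ?thesis by (intro exI[of _ 1]) auto
next
  case True
  define k where "k = kk n A \<epsilon> \<delta> 1"
  have k0: "k > 0" using k by (simp add: k_def)
  have ths: "\<theta> s > 0" using theta_pos[of s] s T True by simp
  obtain x0 where x0: "x0 > 0" "\<And>x. 0 < x \<Longrightarrow> x < x0 \<Longrightarrow> 1 - \<kappa> < \<BB> x"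
    using pole_profile_estimates[OF n B C \<kappa>] by auto
  define a where "a = \<theta> s * x0 / k"
  have "a > 0" using ths x0 k0 by (simp add: a_def)
  moreover have "1 - \<kappa> \<le> v_in n \<BB> \<CC> A \<epsilon> \<delta> 1 r t" if r: "0 < r" "r < a" "s \<le> t" "t \<le> T" for r t
  proof -
    have t: "0 < t" "t < 1" using r s T by auto
    have "r / \<theta> t \<le> r / \<theta> s" using theta_mono[OF s r(3) t(2)] r ths by (intro divide_left_mono) auto
    also have "\<dots> < a / \<theta> s" using r ths by (intro divide_strict_right_mono) auto
    also have "\<dots> = x0 / k" using ths by (simp add: a_def)
    finally have "k * (r / \<theta> t) < k * (x0 / k)" using k0 by (intro mult_strict_left_mono) auto
    then have "1 - \<kappa> < \<BB> (k * (r / \<theta> t))" using x0(2)[of "k * (r / \<theta> t)"] k0 r theta_pos[OF t] by simp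
    then show ?thesis using v_in_ge_bryant[OF C k e t r(1)] by (simp add: k_def)
  qed
  ultimately show ?thesis by blast
qed

text \<open>Near the pole \<open>linear_part\<close> is at least \<open>1 / r\<^sup>2\<close> by the lower bounds for the scaled slopes of \<open>\<BB>\<close> and
  \<open>\<CC>\<close>, while the time derivative is bounded on \<open>{s..T}\<close> from above by the same bounds.\<close>

lemma v_in_rate_near_pole:
  assumes n: "n \<ge> 2" and B: "is_bryant n \<BB>" and C: "is_corrector n \<BB> \<CC>"
    and k: "kk n A \<epsilon> \<delta> 1 > 0" and e: "\<epsilon> < 1" and s: "0 < s" and T: "T < 1"
  shows "\<exists>a>0. \<forall>r t. 0 < r \<and> r < a \<and> s \<le> t \<and> t \<le> T \<longrightarrow>
     rate_bound n (v_in n \<BB> \<CC> A \<epsilon> \<delta> 1) 0 r t"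
proof (cases "s \<le> T")
  case False
  then show ?thesis by (intro exI[of _ 1]) auto
next
  case True
  define k where "k = kk n A \<epsilon> \<delta> 1"
  have k0: "k > 0" using k by (simp add: k_def)
  define c where "c = (1 - 1 * \<epsilon>) / k\<^sup>2"
  have c: "c > 0" using k0 e by (simp add: c_def)
  have ths: "\<theta> s > 0" using theta_pos[of s] s T True by simp
  have T0: "0 < T" using s True by simp
  define m where "m = c * theta_rate T"
  have m: "m > 0" using c theta_rate_pos[OF T0 T] by (simp add: m_def)
  define \<mu> where "\<mu> = min (1/4) (1 / (4 * m))"
  have \<mu>: "\<mu> > 0" "\<mu> \<le> 1/4" "m * \<mu> \<le> 1/4" using m by (auto simp: \<mu>_def min_def field_simps)
  obtain x0 where x0: "x0 > 0" "\<And>x. 0 < x \<Longrightarrow> x < x0 \<Longrightarrow>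
      1 - \<mu> < \<BB> x \<and> \<CC> x < \<mu> \<and> - \<mu> \<le> x * deriv \<BB> x \<and> - \<mu> \<le> x * deriv \<CC> x"
    using pole_profile_estimates[OF n B C \<mu>(1)] by auto
  define rate' where "rate' = (\<lambda>t::real. (1 / (t * (ln t)\<^sup>2) - 2 / (t * ln t ^ 3)) / 2)"
  have rate': "(theta_rate has_real_derivative rate' t) (at t)" if "0 < t" "t < 1" for t
  proof -
    have l0: "ln t \<noteq> 0" using that by simp
    have "((\<lambda>t. 1 / (- ln t)) has_real_derivative 1 / (t * (ln t)\<^sup>2)) (at t)"
      using that l0 by (auto intro!: derivative_eq_intros simp: field_simps power2_eq_square)
    moreover have "((\<lambda>t. 1 / (ln t)\<^sup>2) has_real_derivative - (2 / (t * ln t ^ 3))) (at t)"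
    proof (rule DERIV_cong)
      show "((\<lambda>t. 1 / (ln t)\<^sup>2) has_real_derivative
          (0 * (ln t)\<^sup>2 - 1 * (2 * (1 / t) * ln t)) / ((ln t)\<^sup>2 * (ln t)\<^sup>2)) (at t)"
        using that l0 by (auto intro!: derivative_eq_intros)
    qed (use that l0 in \<open>simp add: field_simps eval_nat_numeral\<close>)
    ultimately have "((\<lambda>t. (1 / (- ln t) + 1 / (ln t)\<^sup>2) / 2) has_real_derivative
        (1 / (t * (ln t)\<^sup>2) + - (2 / (t * ln t ^ 3))) / 2) (at t)"
      by (intro DERIV_cdivide DERIV_add)
    then show ?thesis unfolding theta_rate_def[abs_def] rate'_def by simp
  qed
  define G where "G = (\<lambda>p::real\<times>real. c * \<bar>rate' (snd p)\<bar> + theta_rate (snd p) / (\<theta> (snd p))\<^sup>2)"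
  have "continuous_on ({0..0} \<times> {s..T}) G"
  proof -
    have th: "continuous_on ({0..0::real} \<times> {s..T}) (\<lambda>p. \<theta> (snd p))"
      "continuous_on ({0..0::real} \<times> {s..T}) (\<lambda>p. theta_rate (snd p))"
      by (rule continuous_on_compose2[OF theta_continuous], insert s T, auto intro!: continuous_intros)
         (rule continuous_on_compose2[OF theta_rate_continuous], auto intro!: continuous_intros)
    have nz: "\<forall>p\<in>{0..0::real} \<times> {s..T}. (\<theta> (snd p))\<^sup>2 \<noteq> 0"
    proof
      fix p :: "real \<times> real" assume "p \<in> {0..0} \<times> {s..T}"
      then show "(\<theta> (snd p))\<^sup>2 \<noteq> 0" using theta_pos[of "snd p"] s T by auto
    qed
    show ?thesis unfolding G_def rate'_def by (intro continuous_intros th nz) (use s T in auto)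
  qed
  then obtain G0 where "\<And>r t. r \<in> {0..0} \<Longrightarrow> t \<in> {s..T} \<Longrightarrow> \<bar>G (r, t)\<bar> \<le> G0"
    by (rule bounded_on_rectangle) (rule that)
  then have G0: "c * \<bar>rate' t\<bar> + theta_rate t / (\<theta> t)\<^sup>2 \<le> G0" if "t \<in> {s..T}" for t
    using abs_le_D1[of "G (0, t)" G0] that by (auto simp: G_def)
  define M where "M = max 1 G0"
  define a where "a = min (\<theta> s * x0 / k) (sqrt (1 / M))"
  have M: "M \<ge> 1" "M \<ge> G0" by (auto simp: M_def)
  have "a > 0" using ths x0 k0 M by (simp add: a_def)
  moreover have "rate_bound n (v_in n \<BB> \<CC> A \<epsilon> \<delta> 1) 0 r t" if r: "0 < r" "r < a" "s \<le> t" "t \<le> T" for r t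
  proof -
    have t: "0 < t" "t < 1" using r s T by auto
    note th = theta_pos[OF t] and tr = theta_rate_pos[OF t]
    define x where "x = k * (r / \<theta> t)"
    have xp: "x > 0" using k0 r th by (simp add: x_def)
    have "r / \<theta> t \<le> r / \<theta> s" using theta_mono[OF s r(3) t(2)] r ths by (intro divide_left_mono) auto
    also have "\<dots> < (\<theta> s * x0 / k) / \<theta> s" using r ths by (intro divide_strict_right_mono) (auto simp: a_def)
    also have "\<dots> = x0 / k" using ths by simp
    finally have "k * (r / \<theta> t) < k * (x0 / k)" using k0 by (intro mult_strict_left_mono) auto
    then have x: "x < x0" using k0 by (simp add: x_def)
    define b b1 g g1 where "b = \<BB> x" and "b1 = deriv \<BB> x" and "g = \<CC> x" and "g1 = deriv \<CC> x"
    define h where "h = c * theta_rate t"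
    have h: "0 < h" "h \<le> m" using c tr theta_rate_mono[OF t(1) r(4) T] by (auto simp: h_def m_def)
    have est: "b \<ge> 3/4" "g > 0" "g \<le> 1" "x * b1 \<ge> - (1/4)" "h * (x * g1) \<ge> - (1/4)"
    proof -
      have e: "1 - \<mu> < b" "g < \<mu>" "- \<mu> \<le> x * b1" "- \<mu> \<le> x * g1"
        using x0(2)[OF xp x] by (auto simp: b_def b1_def g_def g1_def)
      show "b \<ge> 3/4" "g \<le> 1" "x * b1 \<ge> - (1/4)" using e \<mu> by auto
      show "g > 0" using C xp by (simp add: is_corrector_def g_def)
      have "h * (- \<mu>) \<le> h * (x * g1)" using e h by (intro mult_left_mono) auto
      moreover have "h * \<mu> \<le> m * \<mu>" using h \<mu> by (intro mult_right_mono) auto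
      ultimately show "h * (x * g1) \<ge> - (1/4)" using \<mu>(3) by linarith
    qed
    let ?V = "v_in n \<BB> \<CC> A \<epsilon> \<delta> 1"
    have Vt: "\<And>r' t'. 0 < t' \<Longrightarrow> t' < 1 \<Longrightarrow> ?V r' t' = \<BB> (k * (r' / \<theta> t')) + c * theta_rate t' * \<CC> (k * (r' / \<theta> t'))"
      using v_in_explicit by (simp add: k_def c_def)
    have DB: "(\<BB> has_real_derivative b1) (at x)" unfolding b1_def by (rule bryant_slope(2)[OF B xp])
    have DC: "(\<CC> has_real_derivative g1) (at x)" unfolding g1_def by (rule corrector_has_derivative[OF C xp])
    have Dxr: "((\<lambda>r'. k * (r' / \<theta> t)) has_real_derivative k / \<theta> t) (at r)"
      using th by (auto intro!: derivative_eq_intros)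
    have Dxt: "((\<lambda>t'. k * (r / \<theta> t')) has_real_derivative - (x * (theta_rate t / (\<theta> t)\<^sup>2))) (at t)"
      using th by (auto intro!: derivative_eq_intros theta_derivative[OF t] simp: x_def field_simps power2_eq_square)
    have "((\<lambda>r'. \<BB> (k * (r' / \<theta> t)) + c * theta_rate t * \<CC> (k * (r' / \<theta> t))) has_real_derivative
        b1 * (k / \<theta> t) + h * (g1 * (k / \<theta> t))) (at r)"
      unfolding h_def
      by (intro DERIV_add DERIV_cmult DERIV_chain2[OF _ Dxr] DB[unfolded x_def] DC[unfolded x_def])
    moreover have "?V r' t = \<BB> (k * (r' / \<theta> t)) + c * theta_rate t * \<CC> (k * (r' / \<theta> t))" for r' by (rule Vt[OF t])
    ultimately have Vr: "deriv (\<lambda>r'. ?V r' t) r = b1 * (k / \<theta> t) + h * (g1 * (k / \<theta> t))"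
      by (simp add: DERIV_imp_deriv)
    have D: "((\<lambda>t'. \<BB> (k * (r / \<theta> t')) + c * theta_rate t' * \<CC> (k * (r / \<theta> t'))) has_real_derivative
        b1 * - (x * (theta_rate t / (\<theta> t)\<^sup>2)) + (c * rate' t * g + g1 * - (x * (theta_rate t / (\<theta> t)\<^sup>2)) * (c * theta_rate t))) (at t)"
      unfolding g_def x_def
      by (intro DERIV_add DERIV_mult DERIV_cmult rate'[OF t] DERIV_chain2[OF _ Dxt[unfolded x_def]] DB[unfolded x_def] DC[unfolded x_def])
    have E: "\<forall>\<^sub>F t' in nhds t. ?V r t' = \<BB> (k * (r / \<theta> t')) + c * theta_rate t' * \<CC> (k * (r / \<theta> t'))"
      by (rule eventually_mono[OF eventually_nhds_in_open[of "{0<..<1}" t]]) (use t Vt in auto)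
    have "(?V r has_real_derivative
        b1 * - (x * (theta_rate t / (\<theta> t)\<^sup>2)) + (c * rate' t * g + g1 * - (x * (theta_rate t / (\<theta> t)\<^sup>2)) * (c * theta_rate t))) (at t)"
      by (rule DERIV_cong_ev[THEN iffD2, OF refl E refl D])
    then have "deriv (?V r) t = b1 * - (x * (theta_rate t / (\<theta> t)\<^sup>2)) + (c * rate' t * g + g1 * - (x * (theta_rate t / (\<theta> t)\<^sup>2)) * (c * theta_rate t))"
      by (rule DERIV_imp_deriv)
    also have "\<dots> = - (theta_rate t / (\<theta> t)\<^sup>2) * (x * b1 + h * (x * g1)) + c * rate' t * g"
      by (simp add: h_def algebra_simps)
    also have "\<dots> \<le> theta_rate t / (\<theta> t)\<^sup>2 * 1 + c * \<bar>rate' t\<bar> * 1"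
    proof (rule add_mono)
      have "theta_rate t / (\<theta> t)\<^sup>2 * (- (x * b1 + h * (x * g1))) \<le> theta_rate t / (\<theta> t)\<^sup>2 * 1"
        using est tr th by (intro mult_left_mono) auto
      then show "- (theta_rate t / (\<theta> t)\<^sup>2) * (x * b1 + h * (x * g1)) \<le> theta_rate t / (\<theta> t)\<^sup>2 * 1"
        by (simp only: mult_minus_left mult_minus_right)
      have "c * rate' t * g \<le> c * \<bar>rate' t\<bar> * g" using c est by (intro mult_right_mono mult_left_mono) auto
      also have "\<dots> \<le> c * \<bar>rate' t\<bar> * 1" using c est by (intro mult_left_mono) auto
      finally show "c * rate' t * g \<le> c * \<bar>rate' t\<bar> * 1" .
    qed
    also have "\<dots> \<le> M" using G0[of t] M r by simp
    also have "M \<le> 1 / r\<^sup>2"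
    proof -
      have "r\<^sup>2 \<le> (sqrt (1 / M))\<^sup>2" using r by (intro power_mono) (auto simp: a_def)
      then show ?thesis using M r by (simp add: field_simps)
    qed
    also have "\<dots> \<le> linear_part n r (?V r t) (deriv (\<lambda>r'. ?V r' t) r)"
    proof -
      have "?V r t = b + h * g" using Vt[OF t, of r] by (simp only: x_def h_def b_def g_def)
      moreover have "0 \<le> h * g" using h est by simp
      ultimately have V0: "?V r t \<ge> 3/4" using est by simp
      have "r * deriv (\<lambda>r'. ?V r' t) r = x * b1 + h * (x * g1)" by (simp add: Vr x_def algebra_simps)
      then have "1 \<le> r * deriv (\<lambda>r'. ?V r' t) r + 2 * ?V r t" using est V0 by simp
      then have "1 * 1 \<le> (real n - 1) * (r * deriv (\<lambda>r'. ?V r' t) r + 2 * ?V r t)" using n by (intro mult_mono) auto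
      then have "1 / r\<^sup>2 \<le> (real n - 1) * (r * deriv (\<lambda>r'. ?V r' t) r + 2 * ?V r t) / r\<^sup>2" by (intro divide_right_mono) auto
      also have "\<dots> = linear_part n r (?V r t) (deriv (\<lambda>r'. ?V r' t) r)"
        using r by (simp add: linear_part_def field_simps power2_eq_square)
      finally show ?thesis .
    qed
    finally show ?thesis by (simp add: rate_bound_def)
  qed
  ultimately show ?thesis by blast
qed

lemma v0_small:
  assumes "n \<ge> 2" "e > 0"
  shows "\<exists>b>0. b < 1 \<and> (\<forall>r. 0 < r \<and> r \<le> b \<longrightarrow> v0 n r \<le> e)"
proof -
  define L where "L = max 1 ((real n - 1) / (4 * e))"
  have L: "L \<ge> 1" "(real n - 1) / (4 * e) \<le> L" by (auto simp: L_def)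
  have "v0 n r \<le> e" if r: "0 < r" "r \<le> exp (- L)" for r
  proof -
    have "ln r \<le> - L" using r by (metis ln_exp ln_le_cancel_iff exp_gt_zero)
    then have "(real n - 1) / (- 4 * ln r) \<le> (real n - 1) / (4 * L)" using assms L by (intro frac_le) auto
    also have "\<dots> \<le> e" using L assms by (simp add: field_simps)
    finally show ?thesis by (simp add: v0_def)
  qed
  then show ?thesis using L by (intro exI[of _ "exp (- L)"]) auto
qed

text \<open>On the inner zone the inner piece is bounded below by a positive constant, while \<open>v0\<close> tends to \<open>0\<close> there.\<close>

lemma v_in_above_v0:
  assumes n: "n \<ge> 2" and B: "is_bryant n \<BB>" and C: "is_corrector n \<BB> \<CC>"
    and k: "kk n A \<epsilon> \<delta> 1 > 0" and e: "\<epsilon> < 1" and X: "X > 0" and D: "0 < D"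
  shows "\<exists>T>0. T < 1 \<and> (\<forall>r t. 0 < r \<and> 0 < t \<and> t \<le> T \<and> r \<le> X * \<theta> t \<longrightarrow> D * v0 n r \<le> v_in n \<BB> \<CC> A \<epsilon> \<delta> 1 r t)"
proof -
  define k where "k = kk n A \<epsilon> \<delta> 1"
  have k0: "k > 0" using k by (simp add: k_def)
  define m where "m = \<BB> (k * X)"
  have m: "m > 0" using B k0 X by (simp add: m_def is_bryant_def)
  obtain b where b: "b > 0" "b < 1" "\<And>r. 0 < r \<Longrightarrow> r \<le> b \<Longrightarrow> v0 n r \<le> m / D"
    using v0_small[OF n, of "m / D"] m D by auto
  define T where "T = min (exp (- 1)) ((b / X)\<^sup>2)"
  have T: "T > 0" "T < 1" using b X by (auto simp: T_def min_less_iff_disj)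
  have "D * v0 n r \<le> v_in n \<BB> \<CC> A \<epsilon> \<delta> 1 r t" if r: "0 < r" "0 < t" "t \<le> T" "r \<le> X * \<theta> t" for r t
  proof -
    have t: "t < 1" using r T by simp
    have "t \<le> exp (- 1)" using r by (simp add: T_def)
    then have "- ln t \<ge> 1" using r(2) by (metis ln_exp ln_le_cancel_iff exp_gt_zero le_minus_iff)
    then have "\<theta> t \<le> sqrt t" by (rule theta_le_sqrt[OF r(2)])
    also have "\<dots> \<le> sqrt ((b / X)\<^sup>2)" using r by (intro real_sqrt_le_mono) (simp add: T_def)
    also have "\<dots> = b / X" using b X by simp
    finally have "X * \<theta> t \<le> b" using X by (simp add: field_simps)
    then have "D * v0 n r \<le> D * (m / D)" using b(3)[of r] r D by (intro mult_left_mono) auto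
    also have "\<dots> = m" using D by simp
    also have "m \<le> \<BB> (k * (r / \<theta> t))"
    proof -
      have "r / \<theta> t \<le> X" using r theta_pos[OF r(2) t] by (simp add: pos_divide_le_eq)
      then have le: "k * (r / \<theta> t) \<le> k * X" using k0 by (intro mult_left_mono) auto
      have "0 < k * (r / \<theta> t)" using k0 r theta_pos[OF r(2) t] by simp
      moreover have "strict_antimono_on {0<..} \<BB>" using B by (simp add: is_bryant_def)
      ultimately show ?thesis unfolding m_def using le k0 X
        by (cases "k * (r / \<theta> t) = k * X") (auto simp: monotone_on_def less_imp_le)
    qed
    also have "\<dots> \<le> v_in n \<BB> \<CC> A \<epsilon> \<delta> 1 r t" using v_in_ge_bryant[OF C k e r(2) t r(1)] by (simp add: k_def)
    finally show ?thesis .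
  qed
  then show ?thesis using T by blast
qed


lemma v_par_explicit:
  assumes "0 < t" "t < 1" "0 < r"
  shows "v_par n A B \<epsilon> \<delta> s r t = 1 / (- ln t) * ((1 + s * gam n A \<epsilon> \<delta> s) *
     ((real n - 1) / 2 * (1 + 2 * (real n - 1) * t / r\<^sup>2)) + s * (B\<^sup>2 * t\<^sup>2 / (- ln t * r ^ 4)))"
proof -
  have "(r / sqrt t)\<^sup>2 = r\<^sup>2 / t" using assms by (simp add: power_divide)
  moreover have "(r / sqrt t) ^ 4 = r ^ 4 / t\<^sup>2"
  proof -
    have "(r / sqrt t) ^ 4 = ((r / sqrt t)\<^sup>2)\<^sup>2" by (simp flip: power_mult)
    also have "\<dots> = r ^ 4 / t\<^sup>2" using assms by (simp add: power_divide flip: power_mult)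
    finally show ?thesis .
  qed
  ultimately show ?thesis by (simp add: v_par_def W0_def Let_def)
qed

lemma v_par_continuous: "continuous_on ({0<..} \<times> {0<..<1}) (\<lambda>(r, t). v_par n A B \<epsilon> \<delta> s r t)"
proof -
  have "continuous_on ({0<..} \<times> {0<..<1::real}) (\<lambda>p. 1 / (- ln (snd p)) * ((1 + s * gam n A \<epsilon> \<delta> s) *
     ((real n - 1) / 2 * (1 + 2 * (real n - 1) * snd p / (fst p)\<^sup>2)) + s * (B\<^sup>2 * (snd p)\<^sup>2 / (- ln (snd p) * fst p ^ 4))))"
    by (intro continuous_intros) auto
  then show ?thesis
    by (rule continuous_on_cong[THEN iffD1, OF refl, rotated]) (auto simp: v_par_explicit)
qed

text \<open>The choice of \<open>\<sigma>_star\<close> gives \<open>t / (r\<^sup>2 * (- ln t)) \<le> \<epsilon>\<close> on the intermediate zone, so that the dominant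
  term is at most \<open>(n - 1)\<^sup>2 * \<epsilon>\<close>. This is where \<open>\<epsilon>\<close> has to be small compared with \<open>1 / n\<^sup>2\<close>.\<close>

lemma v_par_le_one:
  assumes n: "n \<ge> 2" and g: "0 \<le> gam n A \<epsilon> \<delta> (- 1)" "gam n A \<epsilon> \<delta> (- 1) \<le> 1"
    and B: "B \<ge> 1" and e: "0 < \<epsilon>" "\<epsilon> \<le> 1 / (4 * (real n)\<^sup>2)"
    and t: "0 < t" "- ln t \<ge> real n" and r: "\<sigma>_star B \<epsilon> * \<theta> t \<le> r"
  shows "v_par n A B \<epsilon> \<delta> (- 1) r t \<le> 1"
proof -
  define L where "L = - ln t"
  have n': "real n - 1 \<ge> 1" using n by simp
  have L: "L \<ge> real n" "L > 0" using t(2) n' unfolding L_def by linarith+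
  then have "ln t < 0" by (simp add: L_def)
  then have t1: "t < 1" using t by simp
  have s0: "\<sigma>_star B \<epsilon> > 0" using B e by (simp add: \<sigma>_star_def)
  have r0: "r > 0" using r s0 theta_pos[OF t(1) t1] by (smt (verit) mult_pos_pos)
  have "(\<sigma>_star B \<epsilon> * \<theta> t)\<^sup>2 \<le> r\<^sup>2" using r s0 theta_pos[OF t(1) t1] by (intro power_mono) auto
  moreover have "(\<sigma>_star B \<epsilon> * \<theta> t)\<^sup>2 = B\<^sup>2 / \<epsilon> * (t / L)"
    using e by (simp add: power_mult_distrib theta_square[OF t(1) t1] \<sigma>_star_def power_divide L_def)
  moreover have "1 / \<epsilon> * (t / L) \<le> B\<^sup>2 / \<epsilon> * (t / L)"
  proof (intro mult_right_mono divide_right_mono)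
    show "1 \<le> B\<^sup>2" using B by (simp add: one_le_power)
  qed (use e t L in auto)
  ultimately have "1 / \<epsilon> * (t / L) \<le> r\<^sup>2" by linarith
  then have q: "t / (L * r\<^sup>2) \<le> \<epsilon>" using e L r0 by (simp add: field_simps)
  have "v_par n A B \<epsilon> \<delta> (- 1) r t = 1 / L * ((1 - gam n A \<epsilon> \<delta> (- 1)) *
     ((real n - 1) / 2 * (1 + 2 * (real n - 1) * t / r\<^sup>2)) - B\<^sup>2 * t\<^sup>2 / (L * r ^ 4))"
    using v_par_explicit[OF t(1) t1 r0, of n A B \<epsilon> \<delta> "- 1"] by (simp add: L_def)
  also have "\<dots> \<le> 1 / L * (1 * ((real n - 1) / 2 * (1 + 2 * (real n - 1) * t / r\<^sup>2)) - 0)"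
  proof (intro mult_left_mono diff_mono mult_right_mono)
    show "0 \<le> (real n - 1) / 2 * (1 + 2 * (real n - 1) * t / r\<^sup>2)" using n' t by simp
    show "0 \<le> B\<^sup>2 * t\<^sup>2 / (L * r ^ 4)" using L by simp
  qed (use g L in auto)
  also have "\<dots> = (real n - 1) / (2 * L) + (real n - 1)\<^sup>2 * (t / (L * r\<^sup>2))"
    using L r0 by (simp add: field_simps power2_eq_square)
  also have "\<dots> \<le> 1 / 2 + (real n)\<^sup>2 * (1 / (4 * (real n)\<^sup>2))"
  proof (rule add_mono)
    show "(real n - 1) / (2 * L) \<le> 1 / 2" using L n' by (simp add: field_simps)
    show "(real n - 1)\<^sup>2 * (t / (L * r\<^sup>2)) \<le> (real n)\<^sup>2 * (1 / (4 * (real n)\<^sup>2))"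
      using q e n' t L by (intro mult_mono power_mono) auto
  qed
  also have "\<dots> \<le> 1" using n by simp
  finally show ?thesis .
qed

text \<open>For \<open>r \<le> R * sqrt t\<close> the logarithm of \<open>r\<^sup>2\<close> exceeds that of \<open>t\<close> by at most a constant, so \<open>v0 n r\<close> is at most
  \<open>(n - 1) / (2 * (- ln t))\<close> up to a factor close to \<open>1\<close>.\<close>

lemma v_par_above_v0:
  assumes n: "n \<ge> 2" and g: "\<delta> \<le> gam n A \<epsilon> \<delta> 1" and \<delta>: "0 < \<delta>" "\<delta> < 1" and R: "R > 0"
  shows "\<exists>T>0. T < 1 \<and> (\<forall>r t. 0 < r \<and> 0 < t \<and> t \<le> T \<and> r \<le> R * sqrt t \<longrightarrow>
    (1 + \<delta> / 2) * v0 n r \<le> v_par n A B \<epsilon> \<delta> 1 r t)"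
proof -
  define L0 where "L0 = max 1 (8 * \<bar>ln R\<bar> / \<delta>)"
  have L0: "L0 \<ge> 1" "8 * \<bar>ln R\<bar> / \<delta> \<le> L0" by (auto simp: L0_def)
  have n': "real n - 1 \<ge> 1" using n by simp
  have "(1 + \<delta> / 2) * v0 n r \<le> v_par n A B \<epsilon> \<delta> 1 r t"
    if r: "0 < r" "0 < t" "t \<le> exp (- L0)" "r \<le> R * sqrt t" for r t
  proof -
    define L where "L = - ln t"
    have "ln t \<le> - L0" using r by (metis ln_exp ln_le_cancel_iff exp_gt_zero)
    then have L: "L \<ge> 1" "L \<ge> L0" using L0 by (auto simp: L_def)
    have "8 * \<bar>ln R\<bar> \<le> \<delta> * L0" using L0(2) \<delta> by (simp add: pos_divide_le_eq mult.commute)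
    also have "\<dots> \<le> \<delta> * L" using L \<delta> by (intro mult_left_mono) auto
    finally have lR: "8 * \<bar>ln R\<bar> \<le> \<delta> * L" .
    have "\<delta> * L \<le> L" using \<delta> L by (simp add: mult_left_le_one_le)
    moreover have "ln R \<le> \<bar>ln R\<bar>" by simp
    ultimately have pos: "L - 2 * ln R > 0" using lR L by linarith
    have "ln t < 0" using L by (simp add: L_def)
    then have t1: "t < 1" using r by simp
    have "ln r \<le> ln (R * sqrt t)" using r R by simp
    also have "\<dots> = ln R - L / 2" using r R by (simp add: ln_mult ln_sqrt L_def)
    finally have lnr: "2 * (L - 2 * ln R) \<le> - 4 * ln r" by simp
    have v0: "v0 n r \<le> (real n - 1) / (2 * (L - 2 * ln R))"
      unfolding v0_def by (rule frac_le) (use lnr pos n' in auto)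
    have "(1 + \<delta>) * (2 * ln R) \<le> (1 + \<delta>) * (2 * \<bar>ln R\<bar>)" using \<delta> by (intro mult_left_mono) auto
    also have "\<dots> \<le> 2 * (2 * \<bar>ln R\<bar>)" using \<delta> by (intro mult_right_mono) auto
    also have "\<dots> \<le> \<delta> / 2 * L" using lR by simp
    finally have k: "(1 + \<delta> / 2) * L \<le> (1 + \<delta>) * (L - 2 * ln R)" by (simp add: algebra_simps)
    have "(1 + \<delta> / 2) * v0 n r \<le> (1 + \<delta> / 2) * ((real n - 1) / (2 * (L - 2 * ln R)))"
      using v0 \<delta> by (intro mult_left_mono) auto
    also have "\<dots> = (real n - 1) / 2 * ((1 + \<delta> / 2) / (L - 2 * ln R))" by simp
    also have "\<dots> \<le> (real n - 1) / 2 * ((1 + \<delta>) / L)"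
    proof (intro mult_left_mono)
      show "(1 + \<delta> / 2) / (L - 2 * ln R) \<le> (1 + \<delta>) / L"
        using k pos L by (simp add: pos_divide_le_eq pos_le_divide_eq)
    qed (use n' in auto)
    also have "\<dots> = 1 / L * ((1 + \<delta>) * ((real n - 1) / 2 * (1 + 0)) + 0)" by (simp add: mult_ac)
    also have "\<dots> \<le> 1 / L * ((1 + gam n A \<epsilon> \<delta> 1) * ((real n - 1) / 2 * (1 + 2 * (real n - 1) * t / r\<^sup>2)) + B\<^sup>2 * t\<^sup>2 / (L * r ^ 4))"
      using n' r L g \<delta> by (intro mult_left_mono add_mono mult_mono) auto
    also have "\<dots> = v_par n A B \<epsilon> \<delta> 1 r t"
      using v_par_explicit[OF r(2) t1 r(1), of n A B \<epsilon> \<delta> 1] by (simp add: L_def)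
    finally show ?thesis .
  qed
  then show ?thesis using L0 by (intro exI[of _ "exp (- L0)"]) auto
qed

lemma F_op_v0_le:
  assumes n: "n \<ge> 2" and c: "0 < c" "c \<le> 2" and r: "0 < r" "- ln r \<ge> 2 * real n"
  shows "F_op n (\<lambda>r. c * v0 n r) r \<le> 4 * real n * (c * v0 n r) / r\<^sup>2"
proof -
  define L where "L = - ln r"
  define b where "b = c * (real n - 1) / 4"
  define \<psi> where "\<psi> = c * v0 n r"
  have n': "real n - 1 \<ge> 1" using n by simp
  have L: "L \<ge> 4" "L \<ge> 2 * real n" using r n by (auto simp: L_def)
  have "ln r < 0" using L by (simp add: L_def)
  then have r1: "r < 1" using r(1) by simp
  have b: "b > 0" "b \<le> L / 4"
  proof -
    show "b > 0" using c n' by (simp add: b_def)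
    have "c * (real n - 1) \<le> 2 * (real n - 1)" using c n' by (intro mult_right_mono) auto
    then show "b \<le> L / 4" using L by (simp add: b_def)
  qed
  have \<psi>: "\<psi> = b / L" by (simp add: \<psi>_def v0_def b_def L_def)
  have "F_op n (\<lambda>r. c * v0 n r - 0) r = jet n r (b / L) (b / (r * L\<^sup>2)) (b * ((2 - L) / (r\<^sup>2 * L ^ 3)))"
    using F_op_v0(1)[OF r(1) r1, of n c 0] \<psi> by (simp add: \<psi>_def b_def L_def)
  also have "\<dots> = (b / L * (2 * b / L ^ 3 + (real n - 1) / L + 2 * (real n - 1))
      - (b\<^sup>2 / (2 * L ^ 4) + 2 * (b / L) * ((real n - 1) * (b / L) + b / L\<^sup>2))) / r\<^sup>2"
    using r L unfolding jet_def by (simp add: divide_simps) (simp add: algebra_simps eval_nat_numeral)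
  also have "\<dots> \<le> (b / L * (1 + 1 + 2 * (real n - 1)) - 0) / r\<^sup>2"
  proof (intro divide_right_mono diff_mono mult_left_mono add_mono)
    have "2 * b \<le> L" using b by simp
    also have "L \<le> L ^ 3" using L self_le_power[of L 3] by simp
    finally show "2 * b / L ^ 3 \<le> 1" using L by simp
    show "(real n - 1) / L \<le> 1" using L n' by simp
    show "0 \<le> b\<^sup>2 / (2 * L ^ 4) + 2 * (b / L) * ((real n - 1) * (b / L) + b / L\<^sup>2)" using b L n' by simp
  qed (use b L n' in auto)
  also have "\<dots> \<le> (b / L * (4 * real n)) / r\<^sup>2"
  proof -
    have "b / L * (1 + 1 + 2 * (real n - 1)) \<le> b / L * (4 * real n)" using b L by (intro mult_left_mono) auto
    then show ?thesis by (simp only: diff_zero) (intro divide_right_mono, auto)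
  qed
  also have "\<dots> = 4 * real n * (c * v0 n r) / r\<^sup>2" using \<psi> by (simp add: \<psi>_def)
  finally show ?thesis by simp
qed

lemma v_out_continuous: "continuous_on ({0<..<1} \<times> UNIV) (\<lambda>(r, t). v_out n \<epsilon> \<delta> s r t)"
proof -
  let ?S = "{0<..<1} \<times> UNIV :: (real \<times> real) set"
  have v: "continuous_on ?S (\<lambda>p. v0 n (fst p))"
    by (rule continuous_on_compose2[OF v0_continuous]) (auto intro!: continuous_intros)
  let ?c = "1 + s * \<delta>"
  have C: "continuous_on ?S (\<lambda>p. ?c * v0 n (fst p) + (1 + s * \<epsilon>) * snd p * jet n (fst p) (?c * v0 n (fst p))
      (?c * (real n - 1) / 4 / (fst p * (ln (fst p))\<^sup>2)) (?c * (real n - 1) / 4 * ((2 + ln (fst p)) / ((fst p)\<^sup>2 * (- ln (fst p)) ^ 3))))"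
    unfolding jet_def by (intro continuous_intros v) auto
  have E: "F_op n (\<lambda>r. ?c * v0 n r) r = jet n r (?c * v0 n r)
      (?c * (real n - 1) / 4 / (r * (ln r)\<^sup>2)) (?c * (real n - 1) / 4 * ((2 + ln r) / (r\<^sup>2 * (- ln r) ^ 3)))"
    if "0 < r" "r < 1" for r using F_op_v0(1)[OF that, of n ?c 0] by simp
  show ?thesis
  proof (rule continuous_on_eq[OF C])
    fix p :: "real \<times> real" assume "p \<in> ?S"
    then have p: "0 < fst p" "fst p < 1" by auto
    show "?c * v0 n (fst p) + (1 + s * \<epsilon>) * snd p * jet n (fst p) (?c * v0 n (fst p))
        (?c * (real n - 1) / 4 / (fst p * (ln (fst p))\<^sup>2)) (?c * (real n - 1) / 4 * ((2 + ln (fst p)) / ((fst p)\<^sup>2 * (- ln (fst p)) ^ 3)))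
      = (case p of (r, t) \<Rightarrow> v_out n \<epsilon> \<delta> s r t)"
      by (simp only: v_out_def case_prod_unfold E[OF p])
  qed
qed

lemma v_out_ge_v0:
  assumes n: "n \<ge> 2" and c: "0 < 1 + s * \<delta>" "1 + s * \<delta> \<le> 2" "0 \<le> 1 + s * \<epsilon>" "0 \<le> t"
    and r: "0 < r" "- ln r \<ge> 2 * real n"
  shows "(1 + s * \<delta>) * v0 n r \<le> v_out n \<epsilon> \<delta> s r t"
proof -
  have "real n \<ge> 2" using n by simp
  then have "ln r < 0" using r(2) by linarith
  then have "r < 1" using r by simp
  then have "0 < F_op n (\<lambda>r. (1 + s * \<delta>) * v0 n r) r"
    using F_op_v0_pos[OF n c(1,2) r, of 0] v0_pos[OF n r(1)] c by simp
  then show ?thesis using c by (simp add: v_out_def)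
qed

text \<open>On the outer zone \<open>t / r\<^sup>2\<close> is bounded, hence the correction term is at most a multiple of \<open>v0 n r\<close>.\<close>

lemma v_out_le_one:
  assumes n: "n \<ge> 2" and e: "0 < \<epsilon>" "\<epsilon> < 1" and \<delta>: "0 < \<delta>" "\<delta> < 1" and A: "A > 0"
  shows "\<exists>a>0. \<forall>r t. 0 < r \<and> r < a \<and> 0 < t \<and> \<rho>_star A \<epsilon> * sqrt t \<le> r \<longrightarrow> v_out n \<epsilon> \<delta> (- 1) r t \<le> 1"
proof -
  define N where "N = 1 + 4 * real n * \<epsilon> / A\<^sup>2"
  have N: "N > 0" using e A by (simp add: N_def add_pos_nonneg)
  obtain b where b: "b > 0" "b < 1" "\<And>r. 0 < r \<Longrightarrow> r \<le> b \<Longrightarrow> v0 n r \<le> 1 / N"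
    using v0_small[OF n, of "1 / N"] N by auto
  define a where "a = min b (exp (- 2 * real n))"
  have "v_out n \<epsilon> \<delta> (- 1) r t \<le> 1" if r: "0 < r" "r < a" "0 < t" "\<rho>_star A \<epsilon> * sqrt t \<le> r" for r t
  proof -
    have "r \<le> exp (- 2 * real n)" using r by (simp add: a_def)
    then have "ln r \<le> - 2 * real n" using r(1) by (metis ln_exp ln_le_cancel_iff exp_gt_zero)
    then have lr: "- ln r \<ge> 2 * real n" by simp
    have v0: "0 < v0 n r" "v0 n r \<le> 1 / N" using b r v0_pos[OF n, of r] by (auto simp: a_def)
    have "(\<rho>_star A \<epsilon> * sqrt t)\<^sup>2 \<le> r\<^sup>2" using r e A by (intro power_mono) (auto simp: \<rho>_star_def)
    then have "A\<^sup>2 / \<epsilon> * t \<le> r\<^sup>2" using r e by (simp add: power_mult_distrib \<rho>_star_def power_divide)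
    then have tr: "t / r\<^sup>2 \<le> \<epsilon> / A\<^sup>2" using e A r by (simp add: field_simps)
    have F: "F_op n (\<lambda>r. (1 - \<delta>) * v0 n r) r \<le> 4 * real n * ((1 - \<delta>) * v0 n r) / r\<^sup>2"
      by (rule F_op_v0_le[OF n _ _ r(1) lr]) (use \<delta> in auto)
    have "(1 - \<epsilon>) * t * F_op n (\<lambda>r. (1 - \<delta>) * v0 n r) r \<le> (1 - \<epsilon>) * t * (4 * real n * ((1 - \<delta>) * v0 n r) / r\<^sup>2)"
      using F e r by (intro mult_left_mono) auto
    also have "\<dots> = (1 - \<epsilon>) * (1 - \<delta>) * (4 * real n * v0 n r * (t / r\<^sup>2))" by simp
    also have "\<dots> \<le> 1 * (4 * real n * v0 n r * (\<epsilon> / A\<^sup>2))"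
      using e \<delta> tr v0 r by (intro mult_mono mult_le_one) auto
    finally have "v_out n \<epsilon> \<delta> (- 1) r t \<le> (1 - \<delta>) * v0 n r + 4 * real n * v0 n r * (\<epsilon> / A\<^sup>2)"
      by (simp add: v_out_def)
    also have "\<dots> \<le> 1 * v0 n r + 4 * real n * v0 n r * (\<epsilon> / A\<^sup>2)"
      using \<delta> v0 by (intro add_right_mono mult_right_mono) auto
    also have "\<dots> = N * v0 n r" by (simp add: N_def algebra_simps)
    also have "\<dots> \<le> N * (1 / N)" using v0 N by (intro mult_left_mono) auto
    also have "\<dots> = 1" using N by simp
    finally show ?thesis .
  qed
  moreover have "a > 0" using b by (simp add: a_def)
  ultimately show ?thesis by blast
qed

section \<open>Comparison with the glued barriers\<close>

text \<open>At a contact of the solution with \<open>m * V\<close> the identity $F[mV] = mF[V] + m(m-1)Q[V]$ leaves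
  $\mu v \le Q[v]$, where \<open>\<mu>\<close> is the logarithmic growth rate of \<open>m - 1\<close>. The first alternative of the
  assumption \<open>rate\<close> says that $Q[v] < \mu v$. The second says that $Q[V] \le 0$, which passes to
  $v = mV$ because the contact is from below.\<close>

lemma multiplicative_contact:
  fixes s e \<mu> w wr wrr wt V Vr Vrr Vt r :: real
  assumes s: "s = 1 \<or> s = - 1" and e: "e > 0" and m: "m = 1 + s * e" "m > 0" and l: "\<mu> > 0" and r: "r > 0"
    and w: "w > 0" "w = m * V" "wr = m * Vr"
    and second: "0 \<le> s * (m * Vrr - wrr)" and time: "0 \<le> s * (wt - (s * \<mu> * e * V + m * Vt))"
    and super: "0 \<le> s * (Vt - jet n r V Vr Vrr)" and eq: "wt = jet n r w wr wrr"
    and rate: "wt < linear_part n r w wr + \<mu> * w \<or> s = 1 \<and> Vt \<le> linear_part n r V Vr"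
  shows False
proof -
  define Q where "Q = jet n r w wr wrr - linear_part n r w wr"
  have ss: "s * s = 1" using s by auto
  have V: "V > 0" using w m by (simp add: zero_less_mult_iff)
  have id: "m * (m * (jet n r V Vr Vrr - linear_part n r V Vr)) = Q + w * (m * Vrr - wrr)"
    unfolding Q_def jet_def linear_part_def w(2,3) using r by (simp add: divide_simps) (simp add: algebra_simps power2_eq_square)
  have ml: "m * linear_part n r V Vr = linear_part n r w wr" unfolding linear_part_def w(2,3) by (simp add: algebra_simps)
  have "0 \<le> m * m * (s * (Vt - jet n r V Vr Vrr))" using super m by simp
  moreover have "0 \<le> w * (s * (m * Vrr - wrr))" using second w by simp
  moreover have "0 \<le> m * (s * (wt - (s * \<mu> * e * V + m * Vt)))" using time m by simp
  moreover have "m * m * (s * (Vt - jet n r V Vr Vrr)) + m * (s * (wt - (s * \<mu> * e * V + m * Vt)))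
       + w * (s * (m * Vrr - wrr))
     = s * (m * (wt - linear_part n r w wr)) - s * Q - \<mu> * e * w"
  proof -
    have "m * m * (s * (Vt - jet n r V Vr Vrr)) = s * (m * (m * Vt)) - s * (m * (m * (jet n r V Vr Vrr - linear_part n r V Vr))) - s * (m * (m * linear_part n r V Vr))"
      by (simp add: algebra_simps)
    also have "\<dots> = s * (m * (m * Vt)) - s * (Q + w * (m * Vrr - wrr)) - s * (m * linear_part n r w wr)"
      by (simp only: id ml)
    finally have 1: "m * m * (s * (Vt - jet n r V Vr Vrr)) = s * (m * (m * Vt)) - s * (Q + w * (m * Vrr - wrr)) - s * (m * linear_part n r w wr)" .
    have 2: "m * (s * (wt - (s * \<mu> * e * V + m * Vt))) = s * (m * wt) - (s * s) * (\<mu> * e * (m * V)) - s * (m * (m * Vt))"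
      by (simp add: algebra_simps)
    show ?thesis unfolding 1 2 ss w(2)[symmetric] by (simp add: algebra_simps)
  qed
  ultimately have "0 \<le> s * (m * (wt - linear_part n r w wr)) - s * Q - \<mu> * e * w" by linarith
  moreover have "wt - linear_part n r w wr = Q" by (simp add: Q_def eq)
  ultimately have "\<mu> * e * w \<le> s * (m * Q) - s * Q" by simp
  also have "\<dots> = (s * s) * (e * Q)" by (simp add: m(1) algebra_simps)
  finally have "e * (\<mu> * w) \<le> e * Q" using ss by (simp add: mult_ac)
  then have Q: "\<mu> * w \<le> Q" using e by simp
  from rate show False
  proof
    assume "wt < linear_part n r w wr + \<mu> * w"
    then show False using Q by (simp add: Q_def eq)
  next
    assume a: "s = 1 \<and> Vt \<le> linear_part n r V Vr"
    then have "jet n r V Vr Vrr - linear_part n r V Vr \<le> 0" using super by simp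
    then have "m * (m * (jet n r V Vr Vrr - linear_part n r V Vr)) \<le> 0" using m by (simp add: mult_nonneg_nonpos)
    moreover have "0 \<le> w * (m * Vrr - wrr)" using second w a by simp
    ultimately have "Q \<le> 0" using id by linarith
    then show False using Q w l by (smt (verit) mult_pos_pos)
  qed
qed

lemma regular_at_scaled:
  assumes V: "regular_at V r t" and m: "(m has_real_derivative m') (at t)"
  shows "regular_at (\<lambda>r t. m t * V r t) r t" "deriv (\<lambda>r. m t * V r t) r = m t * deriv (\<lambda>r. V r t) r"
    "deriv (deriv (\<lambda>r. m t * V r t)) r = m t * deriv (deriv (\<lambda>r. V r t)) r"
    "deriv (\<lambda>t. m t * V r t) t = m' * V r t + m t * deriv (V r) t"
proof -
  obtain d where d: "d > 0" "\<And>y. \<bar>y - r\<bar> < d \<Longrightarrow> (\<lambda>r. V r t) differentiable (at y)"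
    using V by (auto simp: regular_at_def twice_diff_at_def eventually_nhds_metric dist_real_def)
  have D: "((\<lambda>r. V r t) has_real_derivative deriv (\<lambda>r. V r t) y) (at y)" if "y \<in> ball r d" for y
    using d(2)[of y] that by (simp add: DERIV_deriv_iff_real_differentiable dist_real_def abs_minus_commute)
  have 1: "((\<lambda>r. m t * V r t) has_real_derivative m t * deriv (\<lambda>r. V r t) y) (at y)" if "y \<in> ball r d" for y
    by (rule DERIV_cmult[OF D[OF that]])
  have "(deriv (\<lambda>r. V r t) has_real_derivative deriv (deriv (\<lambda>r. V r t)) r) (at r)"
    using V by (simp add: regular_at_def twice_diff_at_def DERIV_deriv_iff_real_differentiable)
  then have 2: "((\<lambda>y. m t * deriv (\<lambda>r. V r t) y) has_real_derivative m t * deriv (deriv (\<lambda>r. V r t)) r) (at r)"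
    by (rule DERIV_cmult)
  have "(V r has_real_derivative deriv (V r) t) (at t)"
    using V by (simp add: regular_at_def DERIV_deriv_iff_real_differentiable)
  from DERIV_mult[OF m this]
  have 3: "((\<lambda>t. m t * V r t) has_real_derivative m' * V r t + m t * deriv (V r) t) (at t)" by (simp add: mult.commute)
  note db = derivatives_of_barrier[of "ball r d" r "\<lambda>r t. m t * V r t" t, OF open_ball _ 1 2 3]
  show "regular_at (\<lambda>r t. m t * V r t) r t" "deriv (\<lambda>r. m t * V r t) r = m t * deriv (\<lambda>r. V r t) r"
    "deriv (deriv (\<lambda>r. m t * V r t)) r = m t * deriv (deriv (\<lambda>r. V r t)) r"
    "deriv (\<lambda>t. m t * V r t) t = m' * V r t + m t * deriv (V r) t"
    using db d(1) by auto
qed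

lemma past_interior_open:
  assumes "open U" "(r, t) \<in> U" "\<And>r' t'. (r', t') \<in> U \<Longrightarrow> t' \<le> t \<Longrightarrow> (r', t') \<in> K"
  shows "past_interior K r t"
proof -
  obtain e where e: "e > 0" "ball (r, t) e \<subseteq> U" using assms(1,2) by (auto simp: open_contains_ball)
  have "(r', t') \<in> K" if "\<bar>r' - r\<bar> < e / 2" "t - e / 2 < t'" "t' \<le> t" for r' t'
  proof -
    have "dist (r, t) (r', t') \<le> \<bar>r - r'\<bar> + \<bar>t - t'\<bar>"
      unfolding dist_Pair_Pair dist_real_def by (rule sqrt_sum_squares_le_sum) auto
    then have "(r', t') \<in> ball (r, t) e" using that by (simp add: abs_if split: if_splits)
    then show ?thesis using assms(3) e(2) that by blast
  qed
  then show ?thesis unfolding past_interior_def using e(1) by (intro exI[of _ "e / 2"]) auto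
qed

datatype zone = Inner | Middle | Outer

text \<open>The sign \<open>s\<close> in the following is \<open>1\<close> for the upper and \<open>- 1\<close> for the lower barrier.\<close>

locale barriers =
  fixes n :: nat and \<BB> \<CC> :: "real \<Rightarrow> real" and A B \<epsilon> \<delta> rs ts :: real
  assumes n: "n \<ge> 2" and bryant: "is_bryant n \<BB>" and corrector: "is_corrector n \<BB> \<CC>"
    and small: "0 < \<epsilon>" "\<epsilon> < 1 / (4 * (real n)\<^sup>2)" "0 < \<delta>" "\<delta> < 1/4"
    and adm: "admissible n \<BB> \<CC> A B \<epsilon> \<delta> rs ts"
begin

lemma constants: "A > 0" "B \<ge> 1" "0 < rs" "rs < 1" "0 < ts" "ts < 1" "\<epsilon> < 1/4" "\<rho>_star A \<epsilon> > 0" "\<sigma>_star B \<epsilon> > 0"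
proof -
  show "A > 0" "B \<ge> 1" "0 < rs" "rs < 1" "0 < ts" "ts < 1" using adm by (auto simp: admissible_def)
  have "1 / (4 * (real n)\<^sup>2) \<le> 1 / (4 * 1)" using n by (intro divide_left_mono mult_left_mono) (auto simp: one_le_power)
  then show "\<epsilon> < 1/4" using small by simp
  show "\<rho>_star A \<epsilon> > 0" "\<sigma>_star B \<epsilon> > 0" using small \<open>A > 0\<close> \<open>B \<ge> 1\<close> by (auto simp: \<rho>_star_def \<sigma>_star_def)
qed

lemma kk_positive: "s = 1 \<or> s = - 1 \<Longrightarrow> kk n A \<epsilon> \<delta> s > 0"
  using kk_pos[OF n constants(1) small(1) constants(7) small(3,4)] .

primrec piece :: "zone \<Rightarrow> real \<Rightarrow> real \<Rightarrow> real \<Rightarrow> real" where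
  "piece Inner s = v_in n \<BB> \<CC> A \<epsilon> \<delta> s"
| "piece Middle s = v_par n A B \<epsilon> \<delta> s"
| "piece Outer s = v_out n \<epsilon> \<delta> s"

primrec piece_dom :: "zone \<Rightarrow> (real \<times> real) set" where
  "piece_dom Inner = dom_in B \<epsilon> ts"
| "piece_dom Middle = dom_par A B \<epsilon> ts"
| "piece_dom Outer = dom_out A \<epsilon> rs ts"

lemma nested:
  assumes "0 < t" "t < ts"
  shows "0 < \<theta> t" "3 * \<sigma>_star B \<epsilon> * \<theta> t \<le> \<rho>_star A \<epsilon> * sqrt t" "3 * \<rho>_star A \<epsilon> * sqrt t \<le> rs"
    "0 < \<sigma>_star B \<epsilon> * \<theta> t" "0 < \<rho>_star A \<epsilon> * sqrt t"
  using adm assms theta_pos[of t] constants by (auto simp: admissible_def)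

lemma piece_dom_bounds:
  assumes "(r, t) \<in> piece_dom z"
  shows "0 < r" "r < 1" "0 < t" "t < ts" "r \<le> rs"
proof -
  have t: "0 < t" "t < ts" using assms by (cases z; auto simp: dom_in_def dom_par_def dom_out_def)+
  note nt = nested[OF t]
  have "0 < r" "r \<le> rs" using assms nt by (cases z; auto simp: dom_in_def dom_par_def dom_out_def)+
  then show "0 < r" "r < 1" "0 < t" "t < ts" "r \<le> rs" using t constants by auto
qed

lemma piece_continuous:
  assumes "s = 1 \<or> s = - 1"
  shows "continuous_on ({0<..<1} \<times> {0<..<1}) (\<lambda>(r, t). piece z s r t)"
proof (cases z)
  case Inner
  show ?thesis unfolding Inner piece.simps
    by (rule continuous_on_subset[OF v_in_continuous[OF bryant corrector kk_positive[OF assms]]]) auto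
next
  case Middle
  show ?thesis unfolding Middle piece.simps by (rule continuous_on_subset[OF v_par_continuous]) auto
next
  case Outer
  show ?thesis unfolding Outer piece.simps by (rule continuous_on_subset[OF v_out_continuous]) auto
qed

lemma piece_regular:
  assumes d: "(r, t) \<in> piece_dom z" and s: "s = 1 \<or> s = - 1"
  shows "regular_at (piece z s) r t" "0 \<le> s * (deriv (piece z s r) t - F_op n (\<lambda>r'. piece z s r' t) r)"
proof -
  have sub: "is_subsolution n (piece_dom z) (piece z (- 1))" and super: "is_supersolution n (piece_dom z) (piece z 1)"
    using adm by (cases z; simp add: admissible_def)+
  show "regular_at (piece z s) r t" "0 \<le> s * (deriv (piece z s r) t - F_op n (\<lambda>r'. piece z s r' t) r)"
    using s bspec[OF sub[unfolded is_subsolution_def] d] bspec[OF super[unfolded is_supersolution_def] d] by auto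
qed

lemma compact_piece_dom:
  assumes "0 < a" "b \<le> rs" "0 < c" "d < ts"
  shows "compact (piece_dom z \<inter> ({a..b} \<times> {c..d}))"
proof -
  let ?R = "{a..b} \<times> {c..d}"
  have c: "continuous_on ?R (\<lambda>p. \<theta> (snd p))"
    by (rule continuous_on_compose2[OF theta_continuous]) (use assms constants in \<open>auto intro!: continuous_intros\<close>)
  have cl: "compact {p \<in> ?R. f p \<le> g p}" if "continuous_on ?R f" "continuous_on ?R g" for f g :: "real \<times> real \<Rightarrow> real"
  proof -
    have "closedin (top_of_set ?R) (?R \<inter> (\<lambda>p. g p - f p) -` {0..})"
      by (rule continuous_closedin_preimage) (use that in \<open>auto intro!: continuous_intros\<close>)
    moreover have "?R \<inter> (\<lambda>p. g p - f p) -` {0..} = {p \<in> ?R. f p \<le> g p}" by auto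
    ultimately show ?thesis using closedin_compact[OF compact_Times[OF compact_Icc compact_Icc], of a b c d] by simp
  qed
  have "compact {p \<in> ?R. fst p \<le> 3 * \<sigma>_star B \<epsilon> * \<theta> (snd p)}" "compact {p \<in> ?R. \<rho>_star A \<epsilon> * sqrt (snd p) \<le> fst p}"
    "compact ({p \<in> ?R. \<sigma>_star B \<epsilon> * \<theta> (snd p) \<le> fst p} \<inter> {p \<in> ?R. fst p \<le> 3 * \<rho>_star A \<epsilon> * sqrt (snd p)})"
    by (intro compact_Int cl continuous_intros c)+
  moreover have "piece_dom Inner \<inter> ?R = {p \<in> ?R. fst p \<le> 3 * \<sigma>_star B \<epsilon> * \<theta> (snd p)}"
    "piece_dom Outer \<inter> ?R = {p \<in> ?R. \<rho>_star A \<epsilon> * sqrt (snd p) \<le> fst p}"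
    "piece_dom Middle \<inter> ?R = {p \<in> ?R. \<sigma>_star B \<epsilon> * \<theta> (snd p) \<le> fst p} \<inter> {p \<in> ?R. fst p \<le> 3 * \<rho>_star A \<epsilon> * sqrt (snd p)}"
    using assms by (auto simp: dom_in_def dom_par_def dom_out_def)
  ultimately show ?thesis by (cases z) simp_all
qed

primrec inside :: "zone \<Rightarrow> real \<Rightarrow> real \<Rightarrow> bool" where
  "inside Inner r t \<longleftrightarrow> r < 3 * \<sigma>_star B \<epsilon> * \<theta> t"
| "inside Middle r t \<longleftrightarrow> \<sigma>_star B \<epsilon> * \<theta> t < r \<and> r < 3 * \<rho>_star A \<epsilon> * sqrt t"
| "inside Outer r t \<longleftrightarrow> \<rho>_star A \<epsilon> * sqrt t < r"

lemma past_interior_inside: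
  assumes rt: "a < r" "r < b" "c < t" "t \<le> d" and bd: "0 < a" "b \<le> rs" "0 < c" "d < ts" and p: "inside z r t"
  shows "past_interior (piece_dom z \<inter> ({a..b} \<times> {c..d})) r t"
proof -
  let ?O = "{a<..<b} \<times> {c<..<ts}"
  have O: "open ?O" by (intro open_Times open_greaterThanLessThan)
  have c: "continuous_on ?O (\<lambda>p. \<theta> (snd p))"
    by (rule continuous_on_compose2[OF theta_continuous]) (use bd constants in \<open>auto intro!: continuous_intros\<close>)
  have op: "open {p \<in> ?O. f p < g p}" if "continuous_on ?O f" "continuous_on ?O g" for f g :: "real \<times> real \<Rightarrow> real"
  proof -
    have "open (?O \<inter> (\<lambda>p. g p - f p) -` {0<..})"
      by (rule continuous_open_preimage[OF _ O]) (use that in \<open>auto intro!: continuous_intros\<close>)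
    moreover have "?O \<inter> (\<lambda>p. g p - f p) -` {0<..} = {p \<in> ?O. f p < g p}" by auto
    ultimately show ?thesis by simp
  qed
  have "open {p \<in> ?O. fst p < 3 * \<sigma>_star B \<epsilon> * \<theta> (snd p)}" "open {p \<in> ?O. \<rho>_star A \<epsilon> * sqrt (snd p) < fst p}"
    "open ({p \<in> ?O. \<sigma>_star B \<epsilon> * \<theta> (snd p) < fst p} \<inter> {p \<in> ?O. fst p < 3 * \<rho>_star A \<epsilon> * sqrt (snd p)})"
    by (intro open_Int op continuous_intros c)+
  moreover have "{p \<in> ?O. inside Inner (fst p) (snd p)} = {p \<in> ?O. fst p < 3 * \<sigma>_star B \<epsilon> * \<theta> (snd p)}"
    "{p \<in> ?O. inside Outer (fst p) (snd p)} = {p \<in> ?O. \<rho>_star A \<epsilon> * sqrt (snd p) < fst p}"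
    "{p \<in> ?O. inside Middle (fst p) (snd p)}
      = {p \<in> ?O. \<sigma>_star B \<epsilon> * \<theta> (snd p) < fst p} \<inter> {p \<in> ?O. fst p < 3 * \<rho>_star A \<epsilon> * sqrt (snd p)}" by auto
  ultimately have U: "open {p \<in> ?O. inside z (fst p) (snd p)}" by (cases z) simp_all
  show ?thesis
  proof (rule past_interior_open[OF U])
    show "(r, t) \<in> {p \<in> ?O. inside z (fst p) (snd p)}" using rt p bd by auto
    fix r' t' assume "(r', t') \<in> {p \<in> ?O. inside z (fst p) (snd p)}" "t' \<le> t"
    then show "(r', t') \<in> piece_dom z \<inter> ({a..b} \<times> {c..d})"
      using rt bd by (cases z) (auto simp: dom_in_def dom_par_def dom_out_def)
  qed
qed

text \<open>At an end of its domain a piece is strictly dominated by the neighbouring one, which is defined on both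
  sides of that end. So the relevant piece at a point always has the point inside its zone.\<close>

lemma better_zone:
  assumes rt: "(r, t) \<in> piece_dom z" and s: "s = 1 \<or> s = - 1"
  shows "\<exists>z'. (r, t) \<in> piece_dom z' \<and> inside z' r t \<and> s * piece z' s r t \<le> s * piece z s r t"
proof (cases "inside z r t")
  case True
  then show ?thesis using rt by blast
next
  case False
  note t = piece_dom_bounds(3,4)[OF rt]
  define X Y where "X = \<sigma>_star B \<epsilon> * \<theta> t" and "Y = \<rho>_star A \<epsilon> * sqrt t"
  have XY: "0 < X" "3 * X \<le> Y" "3 * Y \<le> rs" "0 < Y"
    using nested[OF t] by (simp_all add: X_def Y_def mult.assoc)
  have dm: "(x, t) \<in> piece_dom Inner \<longleftrightarrow> 0 < x \<and> x \<le> 3 * X" "(x, t) \<in> piece_dom Middle \<longleftrightarrow> X \<le> x \<and> x \<le> 3 * Y"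
    "(x, t) \<in> piece_dom Outer \<longleftrightarrow> Y \<le> x \<and> x \<le> rs" "inside Inner x t \<longleftrightarrow> x < 3 * X"
    "inside Middle x t \<longleftrightarrow> X < x \<and> x < 3 * Y" "inside Outer x t \<longleftrightarrow> Y < x" for x
    using t by (simp_all add: dom_in_def dom_par_def dom_out_def X_def Y_def mult.assoc)
  have ord: "ordering_ok n \<BB> \<CC> A B \<epsilon> \<delta> ts s" using adm s by (auto simp: admissible_def)
  note o = ord[unfolded ordering_ok_def Let_def, rule_format, OF conjI[OF t], folded X_def Y_def]
  show ?thesis
  proof (cases z)
    case Inner
    then have r: "r = 3 * X" using rt False by (auto simp: dm simp del: piece_dom.simps inside.simps)
    have "(r, t) \<in> piece_dom Middle" "inside Middle r t" using XY by (auto simp: dm r simp del: piece_dom.simps inside.simps)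
    moreover have "s * piece Middle s r t \<le> s * piece z s r t" using o unfolding r Inner piece.simps by linarith
    ultimately show ?thesis by blast
  next
    case Middle
    then have "r = X \<or> r = 3 * Y" using rt False by (auto simp: dm simp del: piece_dom.simps inside.simps)
    then show ?thesis
    proof
      assume r: "r = X"
      have "(r, t) \<in> piece_dom Inner" "inside Inner r t" using XY by (auto simp: dm r simp del: piece_dom.simps inside.simps)
      moreover have "s * piece Inner s r t \<le> s * piece z s r t" using o unfolding r Middle piece.simps by linarith
      ultimately show ?thesis by blast
    next
      assume r: "r = 3 * Y"
      have "(r, t) \<in> piece_dom Outer" "inside Outer r t" using XY by (auto simp: dm r simp del: piece_dom.simps inside.simps)
      moreover have "s * piece Outer s r t \<le> s * piece z s r t" using o unfolding r Middle piece.simps by linarith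
      ultimately show ?thesis by blast
    qed
  next
    case Outer
    then have r: "r = Y" using rt False by (auto simp: dm simp del: piece_dom.simps inside.simps)
    have "(r, t) \<in> piece_dom Middle" "inside Middle r t" using XY by (auto simp: dm r simp del: piece_dom.simps inside.simps)
    moreover have "s * piece Middle s r t \<le> s * piece z s r t" using o unfolding r Outer piece.simps by linarith
    ultimately show ?thesis by blast
  qed
qed

text \<open>All pieces are compared with the solution simultaneously, each on its own closed domain. A first contact with
  any of them is excluded, although for a single piece nothing is known at the ends of its domain.\<close>

lemma glued_comparison:
  fixes w :: "real \<Rightarrow> real \<Rightarrow> real" and \<kappa> \<mu> :: real
  assumes s: "s = 1 \<or> s = - 1" and bd: "0 < a" "b \<le> rs" "0 < c" "d < ts"
    and cw: "continuous_on ({a..b} \<times> {c..d}) (\<lambda>(r, t). w r t)"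
    and sol: "solves_on n ({a<..<b} \<times> {c<..d}) w"
    and \<kappa>: "\<kappa> > 0" and \<mu>: "\<mu> > 0" and m: "\<And>t. t \<in> {c..d} \<Longrightarrow> 1 + s * (\<kappa> * exp (\<mu> * t)) > 0"
    and side: "\<And>z r t. (r, t) \<in> piece_dom z \<Longrightarrow> r \<in> {a..b} \<Longrightarrow> t \<in> {c..d} \<Longrightarrow> r = a \<or> r = b \<or> t = c \<Longrightarrow>
      s * w r t < s * ((1 + s * (\<kappa> * exp (\<mu> * t))) * piece z s r t)"
    and rate: "\<And>z r t. (r, t) \<in> piece_dom z \<Longrightarrow> a < r \<Longrightarrow> r < b \<Longrightarrow> c < t \<Longrightarrow> t \<le> d \<Longrightarrow>
      (\<exists>C<\<mu>. rate_bound n w C r t) \<or> s = 1 \<and> rate_bound n (piece z s) 0 r t"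
    and rt: "(r, t) \<in> piece_dom z" "r \<in> {a..b}" "t \<in> {c..d}"
  shows "s * w r t < s * ((1 + s * (\<kappa> * exp (\<mu> * t))) * piece z s r t)"
proof -
  define M where "M = (\<lambda>t. 1 + s * (\<kappa> * exp (\<mu> * t)))"
  define K where "K = (\<lambda>z. piece_dom z \<inter> ({a..b} \<times> {c..d}))"
  define f where "f = (\<lambda>z (r, t). s * (M t * piece z s r t) - s * w r t)"
  have "f z (r, t) > 0"
  proof (rule first_contact[where I=UNIV and K=K and f=f])
    have "UNIV = {Inner, Middle, Outer}" by (auto intro: zone.exhaust)
    then show "finite (UNIV :: zone set)" by (metis finite.emptyI finite_insert)
    show "compact (K z)" for z unfolding K_def by (rule compact_piece_dom[OF bd])
    show "continuous_on (K z) (f z)" for z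
    proof -
      have "continuous_on (K z) (\<lambda>(r, t). piece z s r t)"
      proof (rule continuous_on_subset[OF piece_continuous[OF s]], rule subsetI)
        fix p assume "p \<in> K z"
        then have "(fst p, snd p) \<in> piece_dom z" by (simp add: K_def)
        from piece_dom_bounds[OF this] constants show "p \<in> {0<..<1} \<times> {0<..<1}" by (simp add: mem_Times_iff)
      qed
      moreover have "continuous_on (K z) (\<lambda>(r, t). w r t)"
        by (rule continuous_on_subset[OF cw]) (auto simp: K_def)
      ultimately show ?thesis unfolding f_def M_def case_prod_unfold by (intro continuous_intros)
    qed
    fix z r t assume p: "(r, t) \<in> K z" and le: "f z (r, t) \<le> 0"
    then have d: "(r, t) \<in> piece_dom z" "r \<in> {a..b}" "t \<in> {c..d}" by (auto simp: K_def)
    then have i: "a < r" "r < b" "c < t" "t \<le> d" using side[OF d] le by (auto simp: f_def M_def less_le)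
    obtain z' where z': "(r, t) \<in> piece_dom z'" "inside z' r t" "s * piece z' s r t \<le> s * piece z s r t"
      using better_zone[OF d(1) s] by blast
    have "0 \<le> M t" using m[OF d(3)] by (simp add: M_def less_imp_le)
    then have "M t * (s * piece z' s r t) \<le> M t * (s * piece z s r t)"
      by (rule mult_left_mono[OF z'(3)])
    then have "f z' (r, t) \<le> 0" using le by (simp add: f_def mult_ac)
    then show "\<exists>j\<in>UNIV. past_interior (K j) r t \<and> f j (r, t) \<le> 0"
      using past_interior_inside[OF i bd z'(2)] by (auto simp: K_def)
  next
    fix z r t and e :: real
    assume pi: "past_interior (K z) r t" and z: "f z (r, t) = 0" and e: "e > 0"
      and sp: "\<And>r'. \<bar>r' - r\<bar> < e \<Longrightarrow> 0 \<le> f z (r', t)"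
      and tm: "\<And>t'. t - e < t' \<Longrightarrow> t' < t \<Longrightarrow> 0 \<le> f z (r, t')"
    have d: "(r, t) \<in> piece_dom z" "r \<in> {a..b}" "t \<in> {c..d}" using past_interior_self[OF pi] by (auto simp: K_def)
    then have i: "a < r" "r < b" "c < t" "t \<le> d" using side[OF d] z by (auto simp: f_def M_def less_le)
    have so: "w r t > 0" "regular_at w r t" "deriv (w r) t = F_op n (\<lambda>r'. w r' t) r"
      using sol i by (auto simp: solves_on_def)
    have dM: "(M has_real_derivative s * \<mu> * (\<kappa> * exp (\<mu> * t))) (at t)"
      unfolding M_def by (auto intro!: derivative_eq_intros)
    note sc = regular_at_scaled[OF piece_regular(1)[OF d(1) s] dM]
    have ss: "s * s = 1" using s by auto
    have "s * (M t * piece z s r t) = s * w r t" using z by (simp add: f_def)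
    then have eq: "M t * piece z s r t = w r t" using s by auto
    have rel: "deriv (\<lambda>r'. w r' t) r = M t * deriv (\<lambda>r'. piece z s r' t) r"
      "0 \<le> s * (M t * deriv (deriv (\<lambda>r'. piece z s r' t)) r - deriv (deriv (\<lambda>r'. w r' t)) r)"
      "0 \<le> s * (deriv (w r) t - (s * \<mu> * (\<kappa> * exp (\<mu> * t)) * piece z s r t + M t * deriv (piece z s r) t))"
    proof -
      have "deriv (\<lambda>r'. w r' t) r = M t * deriv (\<lambda>r'. piece z s r' t) r \<and>
       0 \<le> s * (M t * deriv (deriv (\<lambda>r'. piece z s r' t)) r - deriv (deriv (\<lambda>r'. w r' t)) r) \<and>
       0 \<le> s * (deriv (w r) t - (s * \<mu> * (\<kappa> * exp (\<mu> * t)) * piece z s r t + M t * deriv (piece z s r) t))"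
        using s
      proof
        assume s1: "s = 1"
        have "w r' t \<le> M t * piece z s r' t" if "\<bar>r' - r\<bar> < e" for r' using sp[OF that] s1 by (simp add: f_def)
        moreover have "w r t' \<le> M t' * piece z s r t'" if "t - e < t'" "t' < t" for t' using tm[OF that] s1 by (simp add: f_def)
        ultimately show ?thesis
          using contact_relations[OF sc(1) so(2) eq[symmetric] e] s1 unfolding sc by auto
      next
        assume s1: "s = - 1"
        have "M t * piece z s r' t \<le> w r' t" if "\<bar>r' - r\<bar> < e" for r' using sp[OF that] s1 by (simp add: f_def)
        moreover have "M t' * piece z s r t' \<le> w r t'" if "t - e < t'" "t' < t" for t' using tm[OF that] s1 by (simp add: f_def)
        ultimately show ?thesis
          using contact_relations[OF so(2) sc(1) eq e] s1 unfolding sc by auto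
      qed
      then show "deriv (\<lambda>r'. w r' t) r = M t * deriv (\<lambda>r'. piece z s r' t) r"
        "0 \<le> s * (M t * deriv (deriv (\<lambda>r'. piece z s r' t)) r - deriv (deriv (\<lambda>r'. w r' t)) r)"
        "0 \<le> s * (deriv (w r) t - (s * \<mu> * (\<kappa> * exp (\<mu> * t)) * piece z s r t + M t * deriv (piece z s r) t))" by auto
    qed
    have ra: "deriv (w r) t < linear_part n r (w r t) (deriv (\<lambda>r'. w r' t) r) + \<mu> * w r t \<or>
        s = 1 \<and> deriv (piece z s r) t \<le> linear_part n r (piece z s r t) (deriv (\<lambda>r'. piece z s r' t) r)"
      using rate[OF d(1) i]
    proof
      assume "\<exists>C<\<mu>. rate_bound n w C r t"
      then obtain C where "C < \<mu>" "rate_bound n w C r t" by blast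
      moreover have "C * w r t < \<mu> * w r t" using so(1) \<open>C < \<mu>\<close> by simp
      ultimately show ?thesis by (simp add: rate_bound_def)
    next
      assume a: "s = 1 \<and> rate_bound n (piece z s) 0 r t"
      have "deriv (piece z s r) t \<le> linear_part n r (piece z s r t) (deriv (\<lambda>r'. piece z s r' t) r)"
        using conjunct2[OF a] unfolding rate_bound_def by (simp only: mult_zero_left add_0_right)
      then show ?thesis using a by blast
    qed
    have "\<kappa> * exp (\<mu> * t) > 0" using \<kappa> by simp
    moreover have "M t > 0" using m[OF d(3)] by (simp add: M_def)
    moreover have "r > 0" using d bd by auto
    ultimately show False
      using multiplicative_contact[OF s _ _ _ \<mu> _ so(1) eq[symmetric] rel
          piece_regular(2)[OF d(1) s, unfolded F_op_jet] so(3)[unfolded F_op_jet] ra]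
      by (simp add: M_def)
  qed (use rt in \<open>auto simp: K_def\<close>)
  then show ?thesis by (simp add: f_def M_def)
qed

end


section \<open>Trapping the solution\<close>

lemma regular_at_time_shift:
  assumes "regular_at v r (t + h)"
  shows "regular_at (\<lambda>r t. v r (t + h)) r t" "deriv (\<lambda>t'. v r (t' + h)) t = deriv (v r) (t + h)"
proof -
  have "(v r has_real_derivative deriv (v r) (t + h)) (at (t + h))"
    using assms by (simp add: regular_at_def DERIV_deriv_iff_real_differentiable)
  then have d: "((\<lambda>t'. v r (t' + h)) has_real_derivative deriv (v r) (t + h)) (at t)"
    by (simp only: DERIV_shift)
  then show "deriv (\<lambda>t'. v r (t' + h)) t = deriv (v r) (t + h)" by (rule DERIV_imp_deriv)
  show "regular_at (\<lambda>r t. v r (t + h)) r t"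
    using assms d by (auto simp: regular_at_def real_differentiable_def)
qed

lemma solves_on_time_shift:
  assumes "solves_on n D v" "\<And>r t. (r, t) \<in> D' \<Longrightarrow> (r, t + h) \<in> D"
  shows "solves_on n D' (\<lambda>r t. v r (t + h))"
  unfolding solves_on_def
proof (clarify, intro conjI)
  fix r t assume "(r, t) \<in> D'"
  then have s: "v r (t + h) > 0" "regular_at v r (t + h)" "deriv (v r) (t + h) = F_op n (\<lambda>r'. v r' (t + h)) r"
    using assms by (auto simp: solves_on_def)
  then show "v r (t + h) > 0" "regular_at (\<lambda>r t. v r (t + h)) r t"
    "deriv (\<lambda>t'. v r (t' + h)) t = F_op n (\<lambda>r'. v r' (t + h)) r"
    using regular_at_time_shift[OF s(2)] by auto
qed

lemma rate_bound_time_shift: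
  "regular_at v r (t + h) \<Longrightarrow> rate_bound n v C r (t + h) \<Longrightarrow> rate_bound n (\<lambda>r t. v r (t + h)) C r t"
  by (simp add: rate_bound_def regular_at_time_shift(2))

lemma remove_multiplicative_factor:
  fixes s w E V :: real
  assumes "\<kappa>0 > 0" and le: "\<And>\<kappa>. 0 < \<kappa> \<Longrightarrow> \<kappa> < \<kappa>0 \<Longrightarrow> s * w \<le> s * ((1 + s * (\<kappa> * E)) * V)"
  shows "s * w \<le> s * V"
proof -
  have "((\<lambda>\<kappa>. s * ((1 + s * (\<kappa> * E)) * V)) \<longlongrightarrow> s * ((1 + s * (0 * E)) * V)) (at_right 0)"
    by (intro tendsto_intros)
  moreover have "\<forall>\<^sub>F \<kappa> in at_right 0. s * w \<le> s * ((1 + s * (\<kappa> * E)) * V)"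
    using eventually_at_right_real[OF assms(1)] by eventually_elim (rule le, auto)
  ultimately have "s * w \<le> s * ((1 + s * (0 * E)) * V)" by (rule tendsto_lowerbound) simp
  then show ?thesis by simp
qed

lemma positive_lower_bound:
  fixes S :: "real set"
  assumes "finite S" "\<And>x. x \<in> S \<Longrightarrow> 0 < x"
  shows "\<exists>m>0. \<forall>x\<in>S. m \<le> x"
proof (cases "S = {}")
  case True
  then show ?thesis by (intro exI[of _ 1]) auto
next
  case False
  then show ?thesis using assms by (intro exI[of _ "Min S"]) auto
qed

text \<open>The radius \<open>b\<close> and the time \<open>T\<close> are so small that the a priori bounds apply, that solution and barriers
  are strictly ordered at \<open>r = b\<close>, and that the upper barrier lies above the initial data at all times up to \<open>T\<close>.\<close>

locale trapped = barriers +
  fixes vinit :: "real \<Rightarrow> real" and v :: "real \<Rightarrow> real \<Rightarrow> real" and r1 t1 b T :: real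
  assumes sol: "smooth_solution n vinit r1 t1 v" and r1: "r1 > 0"
    and b: "0 < b" "b < r1" "b \<le> rs" "- ln b \<ge> 2 * real n"
    and T: "0 < T" "T < t1" "T < ts" "3 * (\<rho>_star A \<epsilon> * sqrt T) < b" "- ln T \<ge> real n"
    and init: "\<And>r. 0 < r \<Longrightarrow> r \<le> b \<Longrightarrow> (1 - \<delta> / 4) * v0 n r \<le> v r 0 \<and> v r 0 \<le> (1 + \<delta> / 4) * v0 n r"
    and v0_le: "\<And>r. 0 < r \<Longrightarrow> r \<le> b \<Longrightarrow> v0 n r \<le> 1 / 256"
    and side: "\<And>t. 0 \<le> t \<Longrightarrow> t \<le> T \<Longrightarrow> (1 - \<delta> / 2) * v0 n b < v b t \<and> v b t < (1 + \<delta> / 2) * v0 n b"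
    and side_out: "\<And>t. 0 \<le> t \<Longrightarrow> t \<le> T \<Longrightarrow> v_out n \<epsilon> \<delta> (- 1) b t < (1 - \<delta> / 2) * v0 n b"
    and upper_init: "\<And>z r t. (r, t) \<in> piece_dom z \<Longrightarrow> t \<le> T \<Longrightarrow> r \<le> b \<Longrightarrow> (1 + \<delta> / 2) * v0 n r \<le> piece z 1 r t"
begin

lemma v0_positive: "0 < r \<Longrightarrow> r \<le> b \<Longrightarrow> 0 < v0 n r"
  using v0_pos[OF n, of r] b constants by auto

lemmas v_continuous = smooth_solution_continuous[OF sol]
lemmas v_solves = smooth_solution_solves[OF sol]

lemma v_lower: "0 < r \<Longrightarrow> r \<le> b \<Longrightarrow> 0 \<le> t \<Longrightarrow> t \<le> T \<Longrightarrow> (1 - \<delta>) * v0 n r \<le> v r t"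
proof (rule a_priori_lower_bound[OF n sol small(3) _ b(2,4) T(1,2)])
  show "(1 - \<delta>) * v0 n r \<le> v r 0" if r: "0 < r" "r \<le> b" for r
  proof -
    have "(1 - \<delta>) * v0 n r \<le> (1 - \<delta> / 4) * v0 n r" using small v0_positive[OF r] by (intro mult_right_mono) auto
    then show ?thesis using init[OF r] by linarith
  qed
  show "(1 - \<delta>) * v0 n b \<le> v b t" if t: "0 \<le> t" "t \<le> T" for t
  proof -
    have "(1 - \<delta>) * v0 n b \<le> (1 - \<delta> / 2) * v0 n b" using small v0_positive[of b] b by (intro mult_right_mono) auto
    then show ?thesis using side[OF t] by linarith
  qed
qed (use small in auto)

lemma v_positive: "0 < r \<Longrightarrow> r \<le> b \<Longrightarrow> 0 \<le> t \<Longrightarrow> t \<le> T \<Longrightarrow> 0 < v r t"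
proof -
  assume rt: "0 < r" "r \<le> b" "0 \<le> t" "t \<le> T"
  have "0 < (1 - \<delta>) * v0 n r" using v0_positive[OF rt(1,2)] small by simp
  also have "\<dots> \<le> v r t" by (rule v_lower[OF rt])
  finally show "0 < v r t" .
qed

lemma v_initial_small: "0 < r \<Longrightarrow> r \<le> b \<Longrightarrow> v r 0 < 1 / 64"
proof -
  assume r: "0 < r" "r \<le> b"
  have "(1 + \<delta> / 4) * v0 n r \<le> 2 * (1 / 256)"
    using small v0_le[OF r] v0_positive[OF r] by (intro mult_mono) auto
  then show "v r 0 < 1 / 64" using init[OF r] by linarith
qed

lemma v_le_one:
  assumes "0 < r" "r \<le> b" "0 \<le> t" "t \<le> T"
  shows "v r t \<le> 1"
proof (cases "t = 0")
  case True
  then show ?thesis using v_initial_small[OF assms(1,2)] by simp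
next
  case False
  show ?thesis
  proof (rule solution_le_one[OF n sol r1 b(2) T(2) _ v_initial_small])
    show "v b t < 1 / 64" if t: "0 \<le> t" "t \<le> T" for t
    proof -
      have "(1 + \<delta> / 2) * v0 n b \<le> 2 * (1 / 256)"
        using small v0_le[of b] v0_positive[of b] b by (intro mult_mono) auto
      then show ?thesis using side[OF t] by linarith
    qed
  qed (use assms False in auto)
qed

lemma only_outer:
  assumes "(r, t) \<in> piece_dom z" "3 * (\<rho>_star A \<epsilon> * sqrt t) < r"
  shows "z = Outer"
  using assms nested[OF piece_dom_bounds(3,4)[OF assms(1)]] by (cases z) (auto simp: dom_in_def dom_par_def)

lemma only_inner:
  assumes "(r, t) \<in> piece_dom z" "r < \<sigma>_star B \<epsilon> * \<theta> t"
  shows "z = Inner"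
  using assms nested[OF piece_dom_bounds(3,4)[OF assms(1)]] by (cases z) (auto simp: dom_out_def dom_par_def)

lemma outer_at_boundary:
  assumes "(b, t) \<in> piece_dom z" "t \<le> T"
  shows "z = Outer"
proof (rule only_outer[OF assms(1)])
  have "3 * (\<rho>_star A \<epsilon> * sqrt t) \<le> 3 * (\<rho>_star A \<epsilon> * sqrt T)" using assms constants by simp
  then show "3 * (\<rho>_star A \<epsilon> * sqrt t) < b" using T by linarith
qed

lemma lower_barrier_near_pole:
  assumes "\<kappa> > 0"
  shows "\<exists>a>0. \<forall>z r t. (r, t) \<in> piece_dom z \<and> r < a \<and> t \<le> T \<longrightarrow> piece z (- 1) r t \<le> 1 + \<kappa>"
proof -
  have T1: "T < 1" using T constants by simp
  obtain a1 where a1: "a1 > 0" "\<forall>r t. 0 < r \<and> r < a1 \<and> 0 < t \<and> t \<le> T \<and> r \<le> (3 * \<sigma>_star B \<epsilon>) * \<theta> t \<longrightarrow>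
      v_in n \<BB> \<CC> A \<epsilon> \<delta> (- 1) r t \<le> 1 + \<kappa>"
    using v_in_near_pole_upper[OF n bryant corrector kk_positive small(1) T(1) T1 assms, of "3 * \<sigma>_star B \<epsilon>"] by auto
  obtain a2 where a2: "a2 > 0" "\<forall>r t. 0 < r \<and> r < a2 \<and> 0 < t \<and> \<rho>_star A \<epsilon> * sqrt t \<le> r \<longrightarrow> v_out n \<epsilon> \<delta> (- 1) r t \<le> 1"
    using v_out_le_one[OF n small(1) _ small(3) _ constants(1)] constants small by auto
  have "piece z (- 1) r t \<le> 1 + \<kappa>" if d: "(r, t) \<in> piece_dom z" and r: "r < min a1 a2" "t \<le> T" for z r t
  proof (cases z)
    case Inner
    then show ?thesis using a1(2) piece_dom_bounds[OF d] d r by (simp add: dom_in_def)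
  next
    case Middle
    have g: "0 \<le> gam n A \<epsilon> \<delta> (- 1)" "gam n A \<epsilon> \<delta> (- 1) \<le> 1"
      using gam_ge[OF n constants(1) small(1) constants(7) small(3,4), of "- 1"]
        gam_minus_le[OF n constants(1) small(1) constants(7) small(3,4), of "- 1"] small by auto
    have "ln t \<le> ln T" using piece_dom_bounds[OF d] r T by simp
    then have "- ln t \<ge> real n" using T by linarith
    then have "v_par n A B \<epsilon> \<delta> (- 1) r t \<le> 1"
      using d piece_dom_bounds[OF d] small constants Middle
      by (intro v_par_le_one[OF n g]) (auto simp: dom_par_def)
    then show ?thesis using assms Middle by simp
  next
    case Outer
    then have "v_out n \<epsilon> \<delta> (- 1) r t \<le> 1" using a2(2) piece_dom_bounds[OF d] d r by (simp add: dom_out_def)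
    then show ?thesis using assms Outer by simp
  qed
  then show ?thesis using a1 a2 by (intro exI[of _ "min a1 a2"]) auto
qed

text \<open>The comparison starts at a time \<open>c > 0\<close> so small that only the outer piece is present for
  \<open>r \<ge> a\<close>, and is confined to \<open>r \<ge> a\<close> with \<open>a\<close> so small that on \<open>r = a\<close> the solution, which is
  close to \<open>1\<close>, exceeds the reduced barrier. The constant \<open>C\<close>, and with it \<open>\<mu>\<close>, depends on \<open>s\<close> but not on \<open>\<kappa>\<close>.\<close>

lemma lower_barrier_shifted:
  assumes d: "(r, t) \<in> piece_dom z" and r: "r \<le> b" and s: "0 < s" "t + s \<le> T"
  shows "piece z (- 1) r t \<le> v r (t + s)"
proof -
  note db = piece_dom_bounds[OF d]
  define T' where "T' = T - s"
  have T': "0 < T'" "t \<le> T'" "T' < ts" "T' + s = T" using s db T by (auto simp: T'_def)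
  obtain C where C: "\<And>r t. r \<in> {0<..b} \<Longrightarrow> t \<in> {s..T} \<Longrightarrow> rate_bound n v C r t"
    using rate_bound_positive_time[OF sol r1 s(1) T(2) b(2)] n by (metis one_le_numeral order.trans)
  define \<mu> where "\<mu> = max C 0 + 1"
  have \<mu>: "\<mu> > 0" "C < \<mu>" by (auto simp: \<mu>_def)
  define \<kappa>0 where "\<kappa>0 = exp (- (\<mu> * T)) / 2"
  have "- 1 * v r (t + s) \<le> - 1 * piece z (- 1) r t"
  proof (rule remove_multiplicative_factor)
    show "\<kappa>0 > 0" by (simp add: \<kappa>0_def)
    fix \<kappa> assume \<kappa>: "0 < \<kappa>" "\<kappa> < \<kappa>0"
    have fac: "\<kappa> \<le> \<kappa> * exp (\<mu> * t)" "\<kappa> * exp (\<mu> * t) < 1/2" if t: "0 \<le> t" "t \<le> T" for t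
    proof -
      show "\<kappa> \<le> \<kappa> * exp (\<mu> * t)" using \<kappa> t \<mu> by simp
      have "\<kappa> * exp (\<mu> * t) \<le> \<kappa> * exp (\<mu> * T)" using \<kappa> t \<mu> by simp
      also have "\<dots> < \<kappa>0 * exp (\<mu> * T)" using \<kappa> by simp
      also have "\<dots> = 1/2" by (simp add: \<kappa>0_def exp_minus)
      finally show "\<kappa> * exp (\<mu> * t) < 1/2" .
    qed
    obtain a1 where a1: "a1 > 0" "\<And>r t. r \<in> {0..a1} \<Longrightarrow> t \<in> {s..T} \<Longrightarrow> \<bar>v r t - 1\<bar> < \<kappa> / 3"
      using pole_limit[OF sol r1 s(1) T(2), of "\<kappa> / 3"] \<kappa> by auto
    obtain a2 where a2: "a2 > 0" "\<And>z r t. (r, t) \<in> piece_dom z \<Longrightarrow> r < a2 \<Longrightarrow> t \<le> T \<Longrightarrow> piece z (- 1) r t \<le> 1 + \<kappa> / 3"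
      using lower_barrier_near_pole[of "\<kappa> / 3"] \<kappa> by auto
    define a where "a = min (min a1 (a2 / 2)) (r / 2)"
    have a: "0 < a" "a \<le> a1" "a < a2" "a < r" "a < b" using a1 a2 db r by (auto simp: a_def)
    have b1: "b < 1" using b constants by simp
    have "continuous_on ({a..b} \<times> {0..T'}) (\<lambda>(r, t). (1 - \<kappa> * exp (\<mu> * t)) * v_out n \<epsilon> \<delta> (- 1) r t - (1 - \<delta>) * v0 n r)"
    proof -
      have "continuous_on ({a..b} \<times> {0..T'}) (\<lambda>(r, t). v_out n \<epsilon> \<delta> (- 1) r t)"
        by (rule continuous_on_subset[OF v_out_continuous]) (use a b1 in auto)
      moreover have "continuous_on ({a..b} \<times> {0..T'}) (\<lambda>p. v0 n (fst p))"
        by (rule continuous_on_compose2[OF v0_continuous]) (use a b1 in \<open>auto intro!: continuous_intros\<close>)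
      ultimately show ?thesis unfolding case_prod_unfold by (intro continuous_intros)
    qed
    moreover have "(1 - \<kappa> * exp (\<mu> * 0)) * v_out n \<epsilon> \<delta> (- 1) r 0 - (1 - \<delta>) * v0 n r < 0" if "r \<in> {a..b}" for r
    proof -
      have "0 < (1 - \<delta>) * v0 n r" using that a small v0_positive[of r] by auto
      then show ?thesis using \<kappa> by (simp add: v_out_def algebra_simps)
    qed
    ultimately obtain c1 where c1: "c1 > 0" "c1 \<le> T'" "\<And>r t. r \<in> {a..b} \<Longrightarrow> t \<in> {0..c1} \<Longrightarrow>
        (1 - \<kappa> * exp (\<mu> * t)) * v_out n \<epsilon> \<delta> (- 1) r t - (1 - \<delta>) * v0 n r < 0"
      using uniform_for_small_times[OF _ T'(1), of a b _ 0] by force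
    define q where "q = a / (3 * \<rho>_star A \<epsilon>)"
    have q: "q > 0" "3 * (\<rho>_star A \<epsilon> * q) = a" using a constants by (auto simp: q_def)
    define c where "c = min (min c1 t) (q\<^sup>2 / 2)"
    have c: "0 < c" "c \<le> c1" "c \<le> t" "c \<le> q\<^sup>2 / 2" using c1 db q by (auto simp: c_def)
    have "c < q\<^sup>2" using c q by (smt (verit) field_sum_of_halves zero_less_power)
    then have "sqrt c < sqrt (q\<^sup>2)" by (rule real_sqrt_less_mono)
    then have "sqrt c < q" using q by simp
    then have ca: "3 * (\<rho>_star A \<epsilon> * sqrt c) < a" using q(2) constants(8) by (metis mult_strict_left_mono zero_less_numeral)
    have "- 1 * v r (t + s) < - 1 * ((1 + - 1 * (\<kappa> * exp (\<mu> * t))) * piece z (- 1) r t)"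
    proof (rule glued_comparison[where w="\<lambda>r t. v r (t + s)" and a=a and b=b and c=c and d=T' and r=r])
      show "(- 1 :: real) = 1 \<or> (- 1 :: real) = - 1" by simp
      show "continuous_on ({a..b} \<times> {c..T'}) (\<lambda>(r, t). v r (t + s))"
        unfolding case_prod_unfold
        by (rule continuous_on_compose2[OF v_continuous[unfolded case_prod_unfold], of _ "\<lambda>p. (fst p, snd p + s)", simplified])
           (use a b c s T T' in \<open>auto intro!: continuous_intros\<close>)
      show "solves_on n ({a<..<b} \<times> {c<..T'}) (\<lambda>r t. v r (t + s))"
        by (rule solves_on_time_shift[OF v_solves]) (use a b c s T T' in auto)
      show "1 + - 1 * (\<kappa> * exp (\<mu> * t)) > 0" if "t \<in> {c..T'}" for t
        using fac(2)[of t] that c T' s by auto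
      show "(\<exists>C<\<mu>. rate_bound n (\<lambda>r t. v r (t + s)) C r t) \<or> (- 1 :: real) = 1 \<and> rate_bound n (piece z (- 1)) 0 r t"
        if i: "a < r" "r < b" "c < t" "t \<le> T'" for z r t
      proof -
        have "regular_at v r (t + s)" using v_solves i a b c s T T' by (auto simp: solves_on_def)
        moreover have "rate_bound n v C r (t + s)" using C i a c T' by auto
        ultimately show ?thesis using rate_bound_time_shift \<mu> by blast
      qed
      show "- 1 * v r (t + s) < - 1 * ((1 + - 1 * (\<kappa> * exp (\<mu> * t))) * piece z (- 1) r t)"
        if d': "(r, t) \<in> piece_dom z" "r \<in> {a..b}" "t \<in> {c..T'}" "r = a \<or> r = b \<or> t = c" for z r t
      proof -
        define m where "m = 1 - \<kappa> * exp (\<mu> * t)"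
        have m: "0 < m" "m \<le> 1 - \<kappa>" using fac[of t] d' c T' s by (auto simp: m_def)
        have ts: "t + s \<in> {s..T}" "0 < r" "r \<le> b" using d' c T' a by auto
        have "m * piece z (- 1) r t < v r (t + s)"
          using d'(4)
        proof (elim disjE)
          assume ra: "r = a"
          have "piece z (- 1) r t \<le> 1 + \<kappa> / 3" using a2(2)[OF d'(1)] ra a T' s d' by auto
          then have "m * piece z (- 1) r t \<le> m * (1 + \<kappa> / 3)" using m by (intro mult_left_mono) auto
          also have "\<dots> \<le> (1 - \<kappa>) * (1 + \<kappa> / 3)" using m \<kappa> by (intro mult_right_mono) auto
          also have "\<dots> = 1 - 2/3 * \<kappa> - 1/3 * (\<kappa> * \<kappa>)" by (simp add: field_simps)
          also have "\<dots> < 1 - \<kappa> / 3" using \<kappa>(1) mult_pos_pos[OF \<kappa>(1) \<kappa>(1)] by linarith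
          also have "\<dots> < v r (t + s)"
          proof -
            have "\<bar>v r (t + s) - 1\<bar> < \<kappa> / 3" using ts ra a by (intro a1(2)) auto
            then show ?thesis by linarith
          qed
          finally show ?thesis .
        next
          assume rb: "r = b"
          have "z = Outer" using outer_at_boundary[of t z] d' rb T' s by auto
          then have "piece z (- 1) r t < v r (t + s)"
            using side_out[of t] side[of "t + s"] rb ts d' c T' s by auto
          moreover have "0 < v r (t + s)" using v_positive ts s by auto
          moreover have "m * piece z (- 1) r t \<le> max 0 (piece z (- 1) r t)"
          proof (cases "piece z (- 1) r t \<le> 0")
            case True
            then show ?thesis using m by (simp add: mult_nonneg_nonpos max_def)
          next
            case False
            then show ?thesis using m \<kappa> by (simp add: mult_left_le_one_le)
          qed
          ultimately show ?thesis by (auto simp: max_def split: if_splits)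
        next
          assume tc: "t = c"
          have "z = Outer" using only_outer[OF d'(1)] ca tc d' by auto
          then have "m * piece z (- 1) r t < (1 - \<delta>) * v0 n r" using c1(3)[of r t] d' tc c by (auto simp: m_def)
          also have "\<dots> \<le> v r (t + s)" using v_lower[of r "t + s"] ts s by auto
          finally show ?thesis .
        qed
        then show ?thesis by (simp add: m_def)
      qed
    qed (use a b c \<kappa> \<mu> T' d r in auto)
    then show "- 1 * v r (t + s) \<le> - 1 * ((1 + - 1 * (\<kappa> * exp (\<mu> * t))) * piece z (- 1) r t)" by simp
  qed
  then show ?thesis by simp
qed

lemma v_time_continuous:
  assumes "0 < r" "r \<le> b" "0 < t" "t \<le> T"
  shows "isCont (v r) t"
proof -
  have "regular_at v r t" using v_solves assms b T by (auto simp: solves_on_def)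
  then show ?thesis by (auto simp: regular_at_def intro: differentiable_imp_continuous_within)
qed

lemma lower_barrier_below:
  assumes d: "(r, t) \<in> piece_dom z" and r: "r \<le> b" and t: "t < T"
  shows "piece z (- 1) r t \<le> v r t"
proof -
  note db = piece_dom_bounds[OF d]
  have "isCont (v r) (t + 0)" using v_time_continuous db r t by simp
  then have "((\<lambda>s. v r (t + s)) \<longlongrightarrow> v r (t + 0)) (at_right 0)"
    by (rule isCont_tendsto_compose) (intro tendsto_intros)
  moreover have "\<forall>\<^sub>F s in at_right 0. piece z (- 1) r t \<le> v r (t + s)"
    using eventually_at_right_real[of 0 "T - t"] t
    by (auto elim!: eventually_mono intro: lower_barrier_shifted[OF d r])
  ultimately have "piece z (- 1) r t \<le> v r (t + 0)" by (rule tendsto_lowerbound) simp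
  then show ?thesis by simp
qed

text \<open>The rate bound of the solution degenerates at the corner, so it is used only for \<open>r \<ge> a'\<close>. For smaller \<open>r\<close>
  only the inner piece is present, and its own rate bound is used. Since \<open>a'\<close> depends on \<open>s\<close>
  only, the constant \<open>\<mu>\<close> does not depend on \<open>\<kappa>\<close>, and \<open>\<kappa>\<close> can tend to \<open>0\<close>.\<close>

lemma upper_barrier_shifted:
  assumes d: "(r, t) \<in> piece_dom z" and r: "r \<le> b" and s: "0 < s" "s < t" "t \<le> T"
  shows "v r (t - s) \<le> piece z 1 r t"
proof -
  note db = piece_dom_bounds[OF d]
  have T1: "T < 1" using T constants by simp
  have e1: "\<epsilon> < 1" using constants by simp
  have s01: "0 < s" "s < 1" "s < ts" using s T T1 by auto
  obtain a3 where a3: "a3 > 0" "\<And>r t. 0 < r \<Longrightarrow> r < a3 \<Longrightarrow> s \<le> t \<Longrightarrow> t \<le> T \<Longrightarrow> rate_bound n (v_in n \<BB> \<CC> A \<epsilon> \<delta> 1) 0 r t"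
    using v_in_rate_near_pole[OF n bryant corrector kk_positive e1 s(1) T1] by auto
  define a4 where "a4 = \<sigma>_star B \<epsilon> * \<theta> s"
  have a4: "a4 > 0" using nested[OF s01(1,3)] by (simp add: a4_def)
  have inner: "z = Inner" if "(r, t) \<in> piece_dom z" "r < a4" "s \<le> t" for z r t
  proof (rule only_inner[OF that(1)])
    have "\<theta> s \<le> \<theta> t" using theta_mono[OF s(1) that(3)] piece_dom_bounds[OF that(1)] constants by auto
    then have "a4 \<le> \<sigma>_star B \<epsilon> * \<theta> t" unfolding a4_def using constants by (intro mult_left_mono) auto
    then show "r < \<sigma>_star B \<epsilon> * \<theta> t" using that by simp
  qed
  define a' where "a' = min a3 a4"
  have a': "a' > 0" using a3 a4 by (simp add: a'_def)
  have "\<exists>C. \<forall>r\<in>{a'..b}. \<forall>t\<in>{0..T}. 0 < t \<longrightarrow> rate_bound n v C r t"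
    by (rule rate_bound_away_from_pole[OF sol a' b(2) order_refl T(2)]) (use v_positive a' in auto)
  then obtain C where C: "\<And>r t. r \<in> {a'..b} \<Longrightarrow> t \<in> {0..T} \<Longrightarrow> 0 < t \<Longrightarrow> rate_bound n v C r t"
    by blast
  define \<mu> where "\<mu> = max C 0 + 1"
  have \<mu>: "\<mu> > 0" "C < \<mu>" by (auto simp: \<mu>_def)
  have "1 * v r (t - s) \<le> 1 * piece z 1 r t"
  proof (rule remove_multiplicative_factor)
    show "(1::real) > 0" by simp
    fix \<kappa> :: real assume \<kappa>: "0 < \<kappa>" "\<kappa> < 1"
    obtain a1 where a1: "a1 > 0" "\<And>r t. 0 < r \<Longrightarrow> r < a1 \<Longrightarrow> s \<le> t \<Longrightarrow> t \<le> T \<Longrightarrow> 1 - \<kappa> / 3 \<le> v_in n \<BB> \<CC> A \<epsilon> \<delta> 1 r t"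
      using v_in_near_pole_lower[OF n bryant corrector kk_positive e1 s(1) T1, of "\<kappa> / 3"] \<kappa> by auto
    define a where "a = min (a1 / 2) (min (a4 / 2) (r / 2))"
    have a: "0 < a" "a < a1" "a < a4" "a < r" "a < b" using a1 a4 db r by (auto simp: a_def)
    have "1 * v r (t - s) < 1 * ((1 + 1 * (\<kappa> * exp (\<mu> * t))) * piece z 1 r t)"
    proof (rule glued_comparison[where w="\<lambda>r t. v r (t - s)" and a=a and b=b and c=s and d=T and r=r])
      show "(1 :: real) = 1 \<or> (1 :: real) = - 1" by simp
      show "continuous_on ({a..b} \<times> {s..T}) (\<lambda>(r, t). v r (t - s))"
        unfolding case_prod_unfold
        by (rule continuous_on_compose2[OF v_continuous[unfolded case_prod_unfold], of _ "\<lambda>p. (fst p, snd p - s)", simplified])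
           (use a b s T in \<open>auto intro!: continuous_intros\<close>)
      show "solves_on n ({a<..<b} \<times> {s<..T}) (\<lambda>r t. v r (t - s))"
        using solves_on_time_shift[OF v_solves, of "{a<..<b} \<times> {s<..T}" "- s"] a b s T by auto
      show "1 + 1 * (\<kappa> * exp (\<mu> * t)) > 0" for t using \<kappa> by (simp add: add_pos_pos)
      show "(\<exists>C<\<mu>. rate_bound n (\<lambda>r t. v r (t - s)) C r t) \<or> (1 :: real) = 1 \<and> rate_bound n (piece z 1) 0 r t"
        if i: "(r, t) \<in> piece_dom z" "a < r" "r < b" "s < t" "t \<le> T" for z r t
      proof (cases "r < a'")
        case True
        then have "z = Inner" using inner[OF i(1)] i by (auto simp: a'_def)
        then show ?thesis using a3(2)[of r t] True i piece_dom_bounds[OF i(1)] by (auto simp: a'_def)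
      next
        case False
        have "regular_at v r (t + - s)" using v_solves i a b s T by (auto simp: solves_on_def)
        moreover have "rate_bound n v C r (t + - s)" using C[of r "t - s"] i False s by auto
        ultimately have "rate_bound n (\<lambda>r t. v r (t + - s)) C r t" by (rule rate_bound_time_shift)
        then show ?thesis using \<mu> by auto
      qed
      show "1 * v r (t - s) < 1 * ((1 + 1 * (\<kappa> * exp (\<mu> * t))) * piece z 1 r t)"
        if d': "(r, t) \<in> piece_dom z" "r \<in> {a..b}" "t \<in> {s..T}" "r = a \<or> r = b \<or> t = s" for z r t
      proof -
        define m where "m = 1 + \<kappa> * exp (\<mu> * t)"
        have "\<kappa> * 1 \<le> \<kappa> * exp (\<mu> * t)" using \<kappa> \<mu> d' s by (intro mult_left_mono) auto
        then have m: "1 + \<kappa> \<le> m" by (simp add: m_def)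
        have r0: "0 < r" "r \<le> b" using d' a by auto
        have vz: "(1 + \<delta> / 2) * v0 n r \<le> piece z 1 r t" using upper_init[OF d'(1)] d' by auto
        have pos: "0 < (1 + \<delta> / 2) * v0 n r" using v0_positive[OF r0] small by simp
        have mv: "piece z 1 r t \<le> m * piece z 1 r t"
          using m \<kappa> vz pos mult_right_mono[of 1 m "piece z 1 r t"] by auto
        have "v r (t - s) < m * piece z 1 r t"
          using d'(4)
        proof (elim disjE)
          assume ra: "r = a"
          have "z = Inner" using inner[OF d'(1)] ra a d' by auto
          then have V: "1 - \<kappa> / 3 \<le> piece z 1 r t" using a1(2)[of r t] ra a d' by auto
          have "v r (t - s) \<le> 1" using v_le_one[OF r0, of "t - s"] d' s by auto
          also have "1 < (1 + \<kappa>) * (1 - \<kappa> / 3)"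
          proof -
            have "\<kappa> * \<kappa> < 1 * \<kappa>" using \<kappa> by (intro mult_strict_right_mono) auto
            then show ?thesis using \<kappa> by (simp add: algebra_simps)
          qed
          also have "\<dots> \<le> m * piece z 1 r t" using m V \<kappa> by (intro mult_mono) auto
          finally show ?thesis .
        next
          assume rb: "r = b"
          have "v r (t - s) < (1 + \<delta> / 2) * v0 n r" using side[of "t - s"] rb d' s by auto
          then show ?thesis using vz mv by linarith
        next
          assume ts: "t = s"
          have "(1 + \<delta> / 4) * v0 n r < (1 + \<delta> / 2) * v0 n r"
            using small v0_positive[OF r0] by (intro mult_strict_right_mono) auto
          then have "v r (t - s) < (1 + \<delta> / 2) * v0 n r" using init[OF r0] ts by simp
          then show ?thesis using vz mv by linarith
        qed
        then show ?thesis by (simp add: m_def)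
      qed
    qed (use a b s \<kappa> \<mu> T d r in auto)
    then show "1 * v r (t - s) \<le> 1 * ((1 + 1 * (\<kappa> * exp (\<mu> * t))) * piece z 1 r t)" by simp
  qed
  then show ?thesis by simp
qed

lemma upper_barrier_above:
  assumes d: "(r, t) \<in> piece_dom z" and r: "r \<le> b" and t: "t \<le> T"
  shows "v r t \<le> piece z 1 r t"
proof -
  note db = piece_dom_bounds[OF d]
  have "isCont (v r) (t - 0)" using v_time_continuous db r t by simp
  then have "((\<lambda>s. v r (t - s)) \<longlongrightarrow> v r (t - 0)) (at_right 0)"
    by (rule isCont_tendsto_compose) (intro tendsto_intros)
  moreover have "\<forall>\<^sub>F s in at_right 0. v r (t - s) \<le> piece z 1 r t"
    using eventually_at_right_real[of 0 t] t db
    by (auto elim!: eventually_mono intro: upper_barrier_shifted[OF d r])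
  ultimately have "v r (t - 0) \<le> piece z 1 r t" by (rule tendsto_upperbound) simp
  then show ?thesis by simp
qed

lemma trapped_between_barriers:
  assumes r: "0 \<le> r" "r \<le> b" and t: "0 \<le> t" "t < T" and ne: "(r, t) \<noteq> (0, 0)"
  shows "v_lower n \<BB> \<CC> A B \<epsilon> \<delta> r t \<le> v r t \<and> v r t \<le> v_upper n \<BB> \<CC> A B \<epsilon> \<delta> r t"
proof (cases "t = 0")
  case True
  then have r0: "0 < r" using r ne by auto
  have "(1 - \<delta>) * v0 n r \<le> (1 - \<delta> / 4) * v0 n r" "(1 + \<delta> / 4) * v0 n r \<le> (1 + \<delta>) * v0 n r"
    using small v0_positive[OF r0 r(2)] by (auto intro!: mult_right_mono)
  then show ?thesis using init[OF r0 r(2)] True by (auto simp: barrier_def)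
next
  case False
  then have t0: "0 < t" "t < ts" using t T by auto
  show ?thesis
  proof (cases "r = 0")
    case True
    have "v 0 t = 1" using sol t0 t T by (auto simp: smooth_solution_def)
    then show ?thesis using True False by (simp add: barrier_def)
  next
    case r0: False
    have lo: "piece z (- 1) r t \<le> v r t" if "(r, t) \<in> piece_dom z" for z using lower_barrier_below[OF that r(2) t(2)] .
    have up: "v r t \<le> piece z 1 r t" if "(r, t) \<in> piece_dom z" for z using upper_barrier_above[OF that r(2)] t by simp
    have di: "r \<le> 3 * \<sigma>_star B \<epsilon> * \<theta> t \<Longrightarrow> (r, t) \<in> piece_dom Inner" using t0 r0 r by (simp add: dom_in_def)
    have dp: "\<sigma>_star B \<epsilon> * \<theta> t \<le> r \<Longrightarrow> r \<le> 3 * \<rho>_star A \<epsilon> * sqrt t \<Longrightarrow> (r, t) \<in> piece_dom Middle"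
      using t0 by (simp add: dom_par_def)
    have dq: "\<rho>_star A \<epsilon> * sqrt t \<le> r \<Longrightarrow> (r, t) \<in> piece_dom Outer" using t0 r b by (simp add: dom_out_def)
    note nt = nested[OF t0]
    consider "r \<le> \<sigma>_star B \<epsilon> * \<theta> t"
      | "\<sigma>_star B \<epsilon> * \<theta> t < r" "r \<le> 3 * \<sigma>_star B \<epsilon> * \<theta> t"
      | "3 * \<sigma>_star B \<epsilon> * \<theta> t < r" "r \<le> \<rho>_star A \<epsilon> * sqrt t"
      | "\<rho>_star A \<epsilon> * sqrt t < r" "r \<le> 3 * \<rho>_star A \<epsilon> * sqrt t"
      | "3 * \<rho>_star A \<epsilon> * sqrt t < r" by linarith
    then show ?thesis
    proof cases
      case 1
      then have "(r, t) \<in> piece_dom Inner" using di nt by auto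
      then show ?thesis using lo[of Inner] up[of Inner] 1 r0 False by (simp add: barrier_def)
    next
      case 2
      then have "(r, t) \<in> piece_dom Inner" "(r, t) \<in> piece_dom Middle" using di dp nt by auto
      then show ?thesis using lo[of Inner] up[of Inner] lo[of Middle] up[of Middle] 2 r0 False
        by (simp add: barrier_def glue_def)
    next
      case 3
      then have "(r, t) \<in> piece_dom Middle" using dp nt by auto
      then show ?thesis using lo[of Middle] up[of Middle] 3 r0 False nt by (simp add: barrier_def)
    next
      case 4
      then have "(r, t) \<in> piece_dom Middle" "(r, t) \<in> piece_dom Outer" using dp dq nt by auto
      then show ?thesis using lo[of Middle] up[of Middle] lo[of Outer] up[of Outer] 4 r0 False nt
        by (simp add: barrier_def glue_def)
    next
      case 5
      then have "(r, t) \<in> piece_dom Outer" using dq nt by auto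
      then show ?thesis using lo[of Outer] up[of Outer] 5 r0 False nt by (simp add: barrier_def)
    qed
  qed
qed

end

theorem theorem3:
  fixes n :: nat
    and \<BB> \<CC> :: "real \<Rightarrow> real"
    and vinit :: "real \<Rightarrow> real"
    and v :: "real \<Rightarrow> real \<Rightarrow> real"
    and r0 r1 t1 A :: real
  assumes n: "n \<ge> 2"
    and special: "is_bryant n \<BB>" "is_corrector n \<BB> \<CC>"
    and vinit_pos: "r0 > 0" "\<And>r. 0 < r \<Longrightarrow> r < r0 \<Longrightarrow> vinit r > 0"
    and vinit_smooth: "smooth1_on {0<..<r0} vinit"
    and vinit_asymp: "vinit \<sim>[at_right 0] v0 n"
    and solution: "r1 > 0" "t1 > 0" "smooth_solution n vinit r1 t1 v"
    and A: "A > 0"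
  shows "\<exists>\<eta>>0. \<forall>\<epsilon> \<delta>. 0 < \<epsilon> \<and> \<epsilon> < \<eta> \<and> 0 < \<delta> \<and> \<delta> < \<eta> \<longrightarrow>
    (\<forall>B rs ts. admissible n \<BB> \<CC> A B \<epsilon> \<delta> rs ts \<longrightarrow>
      (\<exists>rbar tbar. 0 < rbar \<and> rbar \<le> rs \<and> rbar \<le> r1 \<and> 0 < tbar \<and> tbar < ts \<and> tbar < t1 \<and>
        (\<forall>r\<in>{0..rbar}. \<forall>t\<in>{0..tbar}. (r, t) \<noteq> (0, 0) \<longrightarrow>
          v_lower n \<BB> \<CC> A B \<epsilon> \<delta> r t \<le> v r t \<and> v r t \<le> v_upper n \<BB> \<CC> A B \<epsilon> \<delta> r t)))"
proof -
  define \<eta> where "\<eta> = 1 / (4 * (real n)\<^sup>2)"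
  have \<eta>: "\<eta> > 0" using n by (simp add: \<eta>_def)
  have "1 / (4 * (real n)\<^sup>2) \<le> 1 / (4 * 1)" using n by (intro divide_left_mono mult_left_mono) (auto simp: one_le_power)
  then have \<eta>4: "\<eta> \<le> 1/4" by (simp add: \<eta>_def)
  show ?thesis
  proof (rule exI[of _ \<eta>], rule conjI[OF \<eta>], intro allI impI)
    fix \<epsilon> \<delta> B rs ts
    assume small: "0 < \<epsilon> \<and> \<epsilon> < \<eta> \<and> 0 < \<delta> \<and> \<delta> < \<eta>" and adm: "admissible n \<BB> \<CC> A B \<epsilon> \<delta> rs ts"
    interpret barriers n \<BB> \<CC> A B \<epsilon> \<delta> rs ts
    proof unfold_locales
      show "\<delta> < 1 / 4" using small \<eta>4 by linarith
    qed (use n special small adm in \<open>simp_all add: \<eta>_def\<close>)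
    note \<delta> = small(3,4)
    \<comment> \<open>the radius, so that on \<open>{0<..b}\<close> the initial data are within a factor \<open>1 \<plusminus> \<delta> / 4\<close> of \<open>v0\<close>\<close>
    have "((\<lambda>r. vinit r / v0 n r) \<longlongrightarrow> 1) (at_right 0)"
    proof (rule asymp_equivD_strong[OF vinit_asymp])
      show "\<forall>\<^sub>F r in at_right 0. vinit r \<noteq> 0 \<or> v0 n r \<noteq> 0"
        using eventually_at_right_real[OF vinit_pos(1)] by eventually_elim (use vinit_pos(2) in force)
    qed
    then have "\<forall>\<^sub>F r in at_right 0. dist (vinit r / v0 n r) 1 < \<delta> / 4"
      using \<delta>(1) by (intro tendstoD) auto
    then obtain b1 where b1: "b1 > 0" "\<And>r. 0 < r \<Longrightarrow> r < b1 \<Longrightarrow> dist (vinit r / v0 n r) 1 < \<delta> / 4"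
      by (auto simp: eventually_at_right_field)
    obtain b2 where b2: "b2 > 0" "b2 < 1" "\<And>r. 0 < r \<Longrightarrow> r \<le> b2 \<Longrightarrow> v0 n r \<le> 1 / 256"
      using v0_small[OF n, of "1/256"] by auto
    have "\<exists>m>0. \<forall>x\<in>{b1 / 2, b2, r1 / 2, rs, exp (- (2 * real n))}. m \<le> x"
      by (rule positive_lower_bound) (use b1(1) b2(1) solution(1) constants(3) in auto)
    then obtain b where l: "0 < b" "b \<le> b1 / 2" "b \<le> b2" "b \<le> r1 / 2" "b \<le> rs" "b \<le> exp (- (2 * real n))"
      by auto
    then have b: "0 < b" "b < b1" "b \<le> b2" "b < r1" "b \<le> rs" "b \<le> exp (- (2 * real n))" "b < 1"
      using b1(1) b2(2) solution(1) by linarith+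
    have lnb: "- ln b \<ge> 2 * real n"
      using b(1,6) by (metis ln_exp ln_le_cancel_iff exp_gt_zero le_minus_iff)
    have init: "(1 - \<delta> / 4) * v0 n r \<le> v r 0 \<and> v r 0 \<le> (1 + \<delta> / 4) * v0 n r" if r: "0 < r" "r \<le> b" for r
    proof -
      have p: "v0 n r > 0" using v0_pos[OF n, of r] r b by auto
      have "\<bar>vinit r / v0 n r - 1\<bar> < \<delta> / 4" using b1(2)[of r] r b by (simp add: dist_real_def)
      then have "1 - \<delta> / 4 \<le> vinit r / v0 n r" "vinit r / v0 n r \<le> 1 + \<delta> / 4" by linarith+
      then have "(1 - \<delta> / 4) * v0 n r \<le> vinit r" "vinit r \<le> (1 + \<delta> / 4) * v0 n r"
        using p by (simp_all only: pos_le_divide_eq pos_divide_le_eq)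
      moreover have "v r 0 = vinit r" using solution(3) r b by (auto simp: smooth_solution_def)
      ultimately show ?thesis by simp
    qed
    have v0b: "v0 n b > 0" using v0_pos[OF n b(1) b(7)] .
    \<comment> \<open>the time, so that the order of solution and barriers at \<open>r = b\<close> is that at \<open>t = 0\<close>\<close>
    define T0 where "T0 = min t1 ts / 2"
    have T0: "0 < T0" "T0 < t1" "T0 < ts" using solution(2) constants(5) by (auto simp: T0_def)
    have c: "continuous_on ({0<..r1} \<times> {0..<t1}) (\<lambda>(r, t). v r t)"
      by (rule smooth_solution_continuous[OF solution(3)])
    have cb: "continuous_on ({b..b} \<times> {0..T0}) (\<lambda>(r, t). v r t)"
      by (rule continuous_on_subset[OF c]) (use b T0 in auto)
    have ib: "(1 - \<delta> / 2) * v0 n b < v b 0" "v b 0 < (1 + \<delta> / 2) * v0 n b"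
    proof -
      have "(1 - \<delta> / 2) * v0 n b < (1 - \<delta> / 4) * v0 n b" "(1 + \<delta> / 4) * v0 n b < (1 + \<delta> / 2) * v0 n b"
        using \<delta> v0b by (auto intro!: mult_strict_right_mono)
      then show "(1 - \<delta> / 2) * v0 n b < v b 0" "v b 0 < (1 + \<delta> / 2) * v0 n b"
        using init[OF b(1) order_refl] by linarith+
    qed
    obtain T1 where T1: "T1 > 0" "\<And>t. t \<in> {0..T1} \<Longrightarrow> v b t < (1 + \<delta> / 2) * v0 n b"
      using uniform_for_small_times[OF cb T0(1), of "(1 + \<delta> / 2) * v0 n b"] ib by auto
    have "continuous_on ({b..b} \<times> {0..T0}) (\<lambda>p. - (case p of (r, t) \<Rightarrow> v r t))"
      by (rule continuous_on_minus[OF cb])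
    then obtain T2 where T2: "T2 > 0" "\<And>t. t \<in> {0..T2} \<Longrightarrow> (1 - \<delta> / 2) * v0 n b < v b t"
      using uniform_for_small_times[OF _ T0(1), of b b "\<lambda>p. - (case p of (r, t) \<Rightarrow> v r t)" "- ((1 - \<delta> / 2) * v0 n b)"] ib by auto
    have "continuous_on ({b..b} \<times> {0..T0}) (\<lambda>(r, t). v_out n \<epsilon> \<delta> (- 1) r t)"
      by (rule continuous_on_subset[OF v_out_continuous]) (use b in auto)
    moreover have "v_out n \<epsilon> \<delta> (- 1) b 0 < (1 - \<delta> / 2) * v0 n b" using \<delta> v0b by (simp add: v_out_def)
    ultimately obtain T3 where T3: "T3 > 0" "\<And>t. t \<in> {0..T3} \<Longrightarrow> v_out n \<epsilon> \<delta> (- 1) b t < (1 - \<delta> / 2) * v0 n b"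
      using uniform_for_small_times[OF _ T0(1), of b b "\<lambda>(r, t). v_out n \<epsilon> \<delta> (- 1) r t" "(1 - \<delta> / 2) * v0 n b"] by auto
    obtain T4 where T4: "T4 > 0" "\<forall>r t. 0 < r \<and> 0 < t \<and> t \<le> T4 \<and> r \<le> (3 * \<sigma>_star B \<epsilon>) * \<theta> t \<longrightarrow>
        (1 + \<delta> / 2) * v0 n r \<le> v_in n \<BB> \<CC> A \<epsilon> \<delta> 1 r t"
      using v_in_above_v0[OF n special kk_positive, of "3 * \<sigma>_star B \<epsilon>" "1 + \<delta> / 2"] constants \<delta> by auto
    have g: "\<delta> \<le> gam n A \<epsilon> \<delta> 1"
      using gam_ge[OF n constants(1) small(1) constants(7) small(3,4), of 1] by simp
    obtain T5 where T5: "T5 > 0" "\<forall>r t. 0 < r \<and> 0 < t \<and> t \<le> T5 \<and> r \<le> (3 * \<rho>_star A \<epsilon>) * sqrt t \<longrightarrow>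
        (1 + \<delta> / 2) * v0 n r \<le> v_par n A B \<epsilon> \<delta> 1 r t"
      using v_par_above_v0[OF n g \<delta>(1), where R="3 * \<rho>_star A \<epsilon>" and B=B] constants(8) \<delta>(2) by auto
    define q where "q = b / (3 * \<rho>_star A \<epsilon>)"
    have q: "q > 0" "3 * (\<rho>_star A \<epsilon> * q) = b" using b constants by (auto simp: q_def)
    have "\<exists>m>0. \<forall>x\<in>{T0, T1, T2, T3, T4, T5, q\<^sup>2 / 2, exp (- real n)}. m \<le> x"
    proof (rule positive_lower_bound)
      fix x assume "x \<in> {T0, T1, T2, T3, T4, T5, q\<^sup>2 / 2, exp (- real n)}"
      moreover have "0 < q\<^sup>2 / 2" using q(1) by simp
      ultimately show "0 < x" using T0(1) T1(1) T2(1) T3(1) T4(1) T5(1) exp_gt_zero by blast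
    qed simp
    then obtain T where T: "0 < T" "T \<le> T0" "T \<le> T1" "T \<le> T2" "T \<le> T3" "T \<le> T4" "T \<le> T5"
      "T \<le> q\<^sup>2 / 2" "T \<le> exp (- real n)"
      by auto
    have lnT: "- ln T \<ge> real n" using T(1,9) by (metis ln_exp ln_le_cancel_iff exp_gt_zero le_minus_iff)
    have Tq: "3 * (\<rho>_star A \<epsilon> * sqrt T) < b"
    proof -
      have "0 < q\<^sup>2" using q by simp
      then have "T < q\<^sup>2" using T(8) by linarith
      then have "sqrt T < sqrt (q\<^sup>2)" by (rule real_sqrt_less_mono)
      then have "sqrt T < q" using q by simp
      then have "\<rho>_star A \<epsilon> * sqrt T < \<rho>_star A \<epsilon> * q" using constants(8) by (rule mult_strict_left_mono)
      then show ?thesis using q(2) by linarith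
    qed
    have upper_init: "(1 + \<delta> / 2) * v0 n r \<le> piece z 1 r t"
      if d: "(r, t) \<in> piece_dom z" and t: "t \<le> T" and r: "r \<le> b" for z r t
    proof -
      note db = piece_dom_bounds[OF d]
      show ?thesis
      proof (cases z)
        case Inner
        then show ?thesis using T4(2) d db t T by (simp add: dom_in_def)
      next
        case Middle
        then show ?thesis using T5(2) d db t T by (simp add: dom_par_def)
      next
        case Outer
        have "ln r \<le> ln b" using db r b by simp
        then have "- ln r \<ge> 2 * real n" using lnb by linarith
        then have "(1 + 1 * \<delta>) * v0 n r \<le> v_out n \<epsilon> \<delta> 1 r t"
          by (intro v_out_ge_v0[OF n]) (use \<delta> small constants db in auto)
        moreover have "(1 + \<delta> / 2) * v0 n r \<le> (1 + 1 * \<delta>) * v0 n r"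
          using \<delta> v0_pos[OF n, of r] db by (intro mult_right_mono) auto
        ultimately show ?thesis using Outer by simp
      qed
    qed
    interpret trapped n \<BB> \<CC> A B \<epsilon> \<delta> rs ts vinit v r1 t1 b T
      by unfold_locales (use solution b lnb T T0 lnT Tq init T1(2) T2(2) T3(2) b2(3) upper_init in auto)
    show "\<exists>rbar tbar. 0 < rbar \<and> rbar \<le> rs \<and> rbar \<le> r1 \<and> 0 < tbar \<and> tbar < ts \<and> tbar < t1 \<and>
        (\<forall>r\<in>{0..rbar}. \<forall>t\<in>{0..tbar}. (r, t) \<noteq> (0, 0) \<longrightarrow>
          v_lower n \<BB> \<CC> A B \<epsilon> \<delta> r t \<le> v r t \<and> v r t \<le> v_upper n \<BB> \<CC> A B \<epsilon> \<delta> r t)"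
      using b T T0 trapped_between_barriers by (intro exI[of _ b] exI[of _ "T / 2"] conjI ballI impI) auto
  qed
qed


end
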